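(* Let $(Y_n)_{n\ge0}$ be a stationary Markov chain of bounded real random variables with invariant measure $\mu$ and transition kernel $K$. Assume that there exist two constants $C>0$ and $\rho\in(0,1)$ such that for all $n\ge1$ $$\sup_{g\in\Lambda_1}\|K^n(g)-\mu(g)\|_{\infty,\mu}\le C\rho^n,$$ and that for any $g,g'\in\Lambda_1$ and any $l\ge0$, $$\lim_{n\to\infty}\Big\|K^n\big(g'K^l(g)\big)-\mu\big(g'K^l(g)\big)\Big\|_{\infty,\mu}=0.$$ Let $f$ belong to the class $\mathcal{L}$ and let $X_n=f(Y_n)-\mu(f)$. Assume $m=m(n)\to\infty$ and $n^{1/2}/m\to\infty$ as $n\to\infty$. Let $(a_n)$ be any sequence of real numbers such that $a_n\to0$ and $a_nn^{1/2}/m\to\infty$ as $n\to\infty$. If $$\sigma^2:=\sigma^2(f)=\mu\big((f-\mu(f))^2\big)+2\sum_{n\ge1}\mu\big(K^n(f)\,(f-\mu(f))\big)>0,$$ then, for each Borel set $B\subset\mathbb{R}$, $$-\inf_{x\in B^o}\frac{x^2}{2}\le\liminf_{n\to\infty}a_n^2\ln\mathbb{P}\big(a_nW_n^\circ\in B\big)\le\limsup_{n\to\infty}a_n^2\ln\mathbb{P}\big(a_nW_n^\circ\in B\big)\le-\inf_{x\in\overline{B}}\frac{x^2}{2},$$ where $B^o$ and $\overline{B}$ denote the interior and the closure of $B$, and $W_n^\circ$ is the block self-normalized sum of $X_1,\dots,X_n$ with block length $m$ defined in the context.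
   Context: $\|\cdot\|_{\infty,\mu}$ is the essential supremum norm with respect to $\mu$; $\Lambda_1$ is the set of $1$-Lipschitz functions $\mathbb{R}\to\mathbb{R}$; $K^n(g)$ denotes the $n$-step kernel applied to $g$ and $\mu(g)=\int g\,d\mu$. $\mathcal{L}$ is the class of functions $f:\mathbb{R}\to\mathbb{R}$ such that $|f(x)-f(y)|\le h(|x-y|)$ for all $x,y$, where $h$ is a concave and non-decreasing function (on $[0,\infty)$) satisfying $$\int_0^1\frac{h(t)}{t\sqrt{|\ln t|}}\,dt<\infty.$$ For an integer $m=m(n)\in[1,n]$: $k=\lfloor n/m\rfloor$, $H_j=\{i:m(j-1)+1\le i\le mj\}$, $S_j^\circ=\sum_{i\in H_j}X_i$ for $1\le j\le k$, $(V_k^\circ)^2=\sum_{j=1}^k(S_j^\circ)^2$, and $W_n^\circ=\big(\sum_{j=1}^kS_j^\circ\big)/V_k^\circ$ (with the convention $W_n^\circ=0$ when $V_k^\circ=0$). Conventions: $\inf\emptyset=+\infty$, $\ln0=-\infty$. *)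

theory Defs
  imports "HOL-Probability.Probability" "HOL-Probability.Essential_Supremum"
    "HOL-Analysis.Lipschitz"
begin

definition natural_algebra :: "'w measure \<Rightarrow> (nat \<Rightarrow> 'w \<Rightarrow> real) \<Rightarrow> nat \<Rightarrow> 'w measure" where
  "natural_algebra M Y n =
     sigma (space M) {Y i -` A \<inter> space M | i A. i \<le> n \<and> A \<in> sets borel}"

text \<open>Stationarity is expressed by giving \<open>Y 0\<close> the \<open>K\<close>-invariant law \<open>\<mu>\<close>.\<close>

definition stationary_markov_chain ::
    "'w measure \<Rightarrow> (nat \<Rightarrow> 'w \<Rightarrow> real) \<Rightarrow> real measure \<Rightarrow> (real \<Rightarrow> real measure) \<Rightarrow> bool" where
  "stationary_markov_chain M Y \<mu> K \<longleftrightarrow>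
     prob_space M \<and>
     (\<forall>n. Y n \<in> borel_measurable M) \<and>
     \<mu> \<in> space (prob_algebra borel) \<and>
     K \<in> borel \<rightarrow>\<^sub>M prob_algebra borel \<and>
     \<mu> \<bind> K = \<mu> \<and>
     distr M borel (Y 0) = \<mu> \<and>
     (\<forall>n. \<forall>A\<in>sets borel. AE \<omega> in M.
        real_cond_exp M (natural_algebra M Y n) (\<lambda>\<omega>. indicator A (Y (Suc n) \<omega>)) \<omega>
          = measure (K (Y n \<omega>)) A)"

primrec kernel_power :: "(real \<Rightarrow> real measure) \<Rightarrow> nat \<Rightarrow> real \<Rightarrow> real measure" where
  "kernel_power K 0 = return borel"
| "kernel_power K (Suc n) = (\<lambda>x. K x \<bind> kernel_power K n)"

text \<open>Under the hypotheses used later, the Lipschitz (possibly unbounded) \<open>g\<close> is integrable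
  against \<open>kernel_power K n x\<close> for \<open>\<mu>\<close>-almost every \<open>x\<close>; the junk value of the Bochner
  integral on the exceptional null set does not matter.\<close>

definition kernel_apply :: "(real \<Rightarrow> real measure) \<Rightarrow> nat \<Rightarrow> (real \<Rightarrow> real) \<Rightarrow> real \<Rightarrow> real" where
  "kernel_apply K n g x = (\<integral>y. g y \<partial>kernel_power K n x)"

definition ess_norm :: "real measure \<Rightarrow> (real \<Rightarrow> real) \<Rightarrow> ereal" where
  "ess_norm \<mu> g = esssup \<mu> (\<lambda>x. ereal \<bar>g x\<bar>)"

definition Lip1 :: "(real \<Rightarrow> real) set" where
  "Lip1 = {g. 1-lipschitz_on UNIV g}"

text \<open>The inequality for \<open>f\<close> forces \<open>h \<ge> 0\<close> on \<open>[0, \<infinity>)\<close>, so \<open>ennreal\<close> truncates nothing.\<close>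

definition class_L :: "(real \<Rightarrow> real) set" where
  "class_L = {f. \<exists>h. concave_on {0..} h \<and> mono_on {0..} h \<and>
      (\<integral>\<^sup>+t\<in>{0<..<1}. ennreal (h t / (t * sqrt \<bar>ln t\<bar>)) \<partial>lborel) < \<infinity> \<and>
      (\<forall>x y. \<bar>f x - f y\<bar> \<le> h \<bar>x - y\<bar>)}"

text \<open>The series starts at \<open>n = 1\<close>, hence the shift by \<open>Suc\<close>.\<close>

definition asymp_variance ::
    "real measure \<Rightarrow> (real \<Rightarrow> real measure) \<Rightarrow> (real \<Rightarrow> real) \<Rightarrow> real" where
  "asymp_variance \<mu> K f =
     (\<integral>x. (f x - (\<integral>z. f z \<partial>\<mu>))\<^sup>2 \<partial>\<mu>)
     + 2 * (\<Sum>n. \<integral>x. kernel_apply K (Suc n) f x * (f x - (\<integral>z. f z \<partial>\<mu>)) \<partial>\<mu>)"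

definition block_sum :: "(nat \<Rightarrow> real) \<Rightarrow> nat \<Rightarrow> nat \<Rightarrow> real" where
  "block_sum X m j = (\<Sum>i\<in>{m * (j - 1) + 1..m * j}. X i)"

definition block_norm :: "(nat \<Rightarrow> real) \<Rightarrow> nat \<Rightarrow> nat \<Rightarrow> real" where
  "block_norm X m n = sqrt (\<Sum>j=1..n div m. (block_sum X m j)\<^sup>2)"

definition block_self_normalized :: "(nat \<Rightarrow> real) \<Rightarrow> nat \<Rightarrow> nat \<Rightarrow> real" where
  "block_self_normalized X m n =
     (if block_norm X m n = 0 then 0
      else (\<Sum>j=1..n div m. block_sum X m j) / block_norm X m n)"

definition eln :: "real \<Rightarrow> ereal" where
  "eln p = (if p = 0 then - \<infinity> else ereal (ln p))"

end

theory Submission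
  imports Defs
begin

text \<open>
  Let \<open>c n\<close> bound the conditional expectation of an observation given the chain \<open>n\<close> steps earlier.
  For \<open>f\<close> with concave modulus \<open>h\<close>, replacing \<open>f\<close> by a Lipschitz minorant whose constant is adapted to the
  scale \<open>C * \<rho> ^ n\<close> turns the contraction of Lipschitz functions into \<open>c n \<approx> h (C * \<rho> ^ n)\<close>, and the integral
  condition on \<open>h\<close> becomes summability of \<open>c n / sqrt n\<close>.

  Write a block sum as a martingale difference plus its drift, the conditional expectation given the past
  of the block. Regrouping the drifts in pairs, then in pairs of pairs, and so on, produces one martingale per dyadic
  level; by the summability of \<open>c n / sqrt n\<close> the total is sub-Gaussian at scale \<open>sqrt n\<close> with a constant that
  vanishes as the block length \<open>m\<close> grows, hence it is negligible for moderate deviations. The same bound applied to short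
  blocks inside a long one shows that the conditional second moment of a block of length \<open>m\<close> is \<open>m * \<sigma>\<^sup>2\<close> up to
  a relative error that is uniform in the past. Since \<open>m / (a n * sqrt n)\<close> tends to 0, all exponents stay small blockwise, and
  second order Taylor expansion gives the Laplace transform of the martingale and superexponential concentration of
  the sum of squares around \<open>n * \<sigma>\<^sup>2\<close>. The tails of the ratio follow by Chernoff bounds and exponential tilting.
\<close>

section \<open>Essentially bounded random variables and conditional expectations\<close>

text \<open>Conditional statements are phrased as inequalities between integrals against arbitrary
  bounded non-negative variables known at time \<open>i\<close>. No versions of conditional
  expectations have to be chosen, and the exponential of a past sum is again such a weight, so
  one-step bounds iterate. The drifts cannot be bounded block by block: \<open>n / m\<close> drifts
  of size o(sqrt m) only give o(n / sqrt m), which may be far larger than sqrt n. Cancellation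
  between blocks is indispensable. The mixing hypothesis for products has no rate and treats one lag
  at a time, so it is usable only inside blocks of fixed length; the decay for single observations
  is what glues such blocks into a long one. The autocovariances are also delicate: they are bounded
  by a multiple of \<open>c n\<close>, but only \<open>c n / sqrt n\<close> is summable, so their
  summability needs a decomposition into innovations. Drift and sum of squares are controlled up to
  probability exp(- A / a^2) for every \<open>A\<close>. The rate x^2 / 2 therefore comes from the
  martingale alone, and the variance cancels in the ratio.\<close>

locale filtered_prob_space = prob_space M for M :: "'a measure" +
  fixes F :: "nat \<Rightarrow> 'a measure"
  assumes filtration_subalgebra: "subalgebra M (F i)"
    and filtration_mono: "i \<le> j \<Longrightarrow> sets (F i) \<subseteq> sets (F j)"
begin

abbreviation cond :: "nat \<Rightarrow> ('a \<Rightarrow> real) \<Rightarrow> 'a \<Rightarrow> real" where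
  "cond i \<equiv> real_cond_exp M (F i)"

text \<open>Only measurability refers to \<open>G\<close>; the bound is always almost everywhere in
  \<open>M\<close>, because conditional expectations are bounded only up to null sets.\<close>

definition Linf :: "'a measure \<Rightarrow> ('a \<Rightarrow> real) set" where
  "Linf G = {A \<in> borel_measurable G. \<exists>B. AE \<omega> in M. \<bar>A \<omega>\<bar> \<le> B}"

text \<open>Test variables for conditional inequalities: an inequality between the integrals of
  \<open>Z * A\<close> and \<open>Z * A'\<close> for all weights \<open>Z\<close> at time
  \<open>i\<close> says that the conditional expectations given \<open>F i\<close> are ordered
  almost surely.\<close>

definition weights :: "nat \<Rightarrow> ('a \<Rightarrow> real) set" where
  "weights i = {Z \<in> Linf (F i). AE \<omega> in M. 0 \<le> Z \<omega>}"

lemma sigma_finite_filtration: "sigma_finite_subalgebra M (F i)"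
proof -
  interpret finite_measure_subalgebra M "F i"
    by unfold_locales (rule filtration_subalgebra)
  show ?thesis by unfold_locales
qed

lemma subalgebra_filtration_mono: "i \<le> j \<Longrightarrow> subalgebra (F j) (F i)"
  using filtration_subalgebra filtration_mono by (simp add: subalgebra_def)

lemma LinfI: "A \<in> borel_measurable G \<Longrightarrow> (AE \<omega> in M. \<bar>A \<omega>\<bar> \<le> B) \<Longrightarrow> A \<in> Linf G"
  unfolding Linf_def by auto

lemma Linf_bound:
  assumes "A \<in> Linf G"
  obtains B where "B \<ge> 0" "AE \<omega> in M. \<bar>A \<omega>\<bar> \<le> B"
proof -
  obtain B where B: "AE \<omega> in M. \<bar>A \<omega>\<bar> \<le> B" using assms unfolding Linf_def by auto
  have "AE \<omega> in M. \<bar>A \<omega>\<bar> \<le> max B 0" using B by eventually_elim auto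
  then show thesis using that[of "max B 0"] by auto
qed

lemma Linf_measurable: "A \<in> Linf G \<Longrightarrow> A \<in> borel_measurable G"
  unfolding Linf_def by auto

lemma Linf_const [intro!, simp]: "(\<lambda>_. c) \<in> Linf G"
  by (rule LinfI[where B = "\<bar>c\<bar>"]) auto

lemma Linf_add [intro!]:
  assumes "A \<in> Linf G" "A' \<in> Linf G" shows "(\<lambda>\<omega>. A \<omega> + A' \<omega>) \<in> Linf G"
proof -
  obtain B B' where B: "AE \<omega> in M. \<bar>A \<omega>\<bar> \<le> B" "AE \<omega> in M. \<bar>A' \<omega>\<bar> \<le> B'"
    using Linf_bound[OF assms(1)] Linf_bound[OF assms(2)] by metis
  have "AE \<omega> in M. \<bar>A \<omega> + A' \<omega>\<bar> \<le> B + B'" using B by eventually_elim linarith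
  then show ?thesis using assms[THEN Linf_measurable] by (intro LinfI) auto
qed

lemma Linf_mult [intro!]:
  assumes "A \<in> Linf G" "A' \<in> Linf G" shows "(\<lambda>\<omega>. A \<omega> * A' \<omega>) \<in> Linf G"
proof -
  obtain B B' where B: "AE \<omega> in M. \<bar>A \<omega>\<bar> \<le> B" "B \<ge> 0" "AE \<omega> in M. \<bar>A' \<omega>\<bar> \<le> B'"
    using Linf_bound[OF assms(1)] Linf_bound[OF assms(2)] by metis
  have "AE \<omega> in M. \<bar>A \<omega> * A' \<omega>\<bar> \<le> B * B'" using B(1,3)
    by eventually_elim (auto simp: abs_mult intro!: mult_mono B(2))
  then show ?thesis using assms[THEN Linf_measurable] by (intro LinfI) auto
qed

lemma Linf_uminus [intro!]: "A \<in> Linf G \<Longrightarrow> (\<lambda>\<omega>. - A \<omega>) \<in> Linf G"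
  using Linf_mult[OF Linf_const[of "-1"], of A G] by simp

lemma Linf_divide [intro!]: "A \<in> Linf G \<Longrightarrow> (\<lambda>\<omega>. A \<omega> / r) \<in> Linf G"
  unfolding divide_inverse by auto

lemma Linf_diff [intro!]:
  "A \<in> Linf G \<Longrightarrow> A' \<in> Linf G \<Longrightarrow> (\<lambda>\<omega>. A \<omega> - A' \<omega>) \<in> Linf G"
  using Linf_add[of A G "\<lambda>\<omega>. - A' \<omega>"] Linf_uminus[of A' G] by simp

lemma Linf_sum [intro!]:
  assumes "\<And>i. i \<in> I \<Longrightarrow> A i \<in> Linf G" shows "(\<lambda>\<omega>. \<Sum>i\<in>I. A i \<omega>) \<in> Linf G"
  using assms by (induction I rule: infinite_finite_induct) auto

lemma Linf_power2 [intro!]: "A \<in> Linf G \<Longrightarrow> (\<lambda>\<omega>. (A \<omega>)\<^sup>2) \<in> Linf G"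
  unfolding power2_eq_square by auto

lemma Linf_exp [intro!]:
  assumes "A \<in> Linf G" shows "(\<lambda>\<omega>. exp (A \<omega>)) \<in> Linf G"
proof -
  obtain B where B: "AE \<omega> in M. \<bar>A \<omega>\<bar> \<le> B" using assms by (rule Linf_bound)
  have "AE \<omega> in M. \<bar>exp (A \<omega>)\<bar> \<le> exp B" using B by eventually_elim auto
  then show ?thesis using assms[THEN Linf_measurable] by (intro LinfI) auto
qed

lemma Linf_filtration_mono: "i \<le> j \<Longrightarrow> A \<in> Linf (F i) \<Longrightarrow> A \<in> Linf (F j)"
  unfolding Linf_def using measurable_from_subalg[OF subalgebra_filtration_mono] by blast

lemma Linf_filtration: "A \<in> Linf (F i) \<Longrightarrow> A \<in> Linf M"
  unfolding Linf_def using measurable_from_subalg[OF filtration_subalgebra] by blast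

lemma Linf_integrable:
  assumes "A \<in> Linf M" shows "integrable M A"
proof -
  obtain B where "AE \<omega> in M. \<bar>A \<omega>\<bar> \<le> B" using assms by (rule Linf_bound)
  then show ?thesis using Linf_measurable[OF assms] by (intro integrable_const_bound[where B = B]) auto
qed

lemma weights_Linf: "Z \<in> weights i \<Longrightarrow> Z \<in> Linf (F i)"
  unfolding weights_def by simp

lemma weights_nonneg: "Z \<in> weights i \<Longrightarrow> AE \<omega> in M. 0 \<le> Z \<omega>"
  unfolding weights_def by simp

lemma weights_LinfM: "Z \<in> weights i \<Longrightarrow> Z \<in> Linf M"
  using Linf_filtration weights_Linf by blast

lemma weights_mono: "i \<le> j \<Longrightarrow> Z \<in> weights i \<Longrightarrow> Z \<in> weights j"
  unfolding weights_def using Linf_filtration_mono by blast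

lemma weights_one: "(\<lambda>_. 1) \<in> weights i"
  unfolding weights_def by simp

lemma weights_exp: "A \<in> Linf (F i) \<Longrightarrow> (\<lambda>\<omega>. exp (A \<omega>)) \<in> weights i"
  unfolding weights_def by auto

lemma weights_mult:
  assumes "Z \<in> weights i" "Z' \<in> weights i" shows "(\<lambda>\<omega>. Z \<omega> * Z' \<omega>) \<in> weights i"
proof -
  have "AE \<omega> in M. 0 \<le> Z \<omega> * Z' \<omega>"
    using assms[THEN weights_nonneg] by eventually_elim auto
  then show ?thesis using assms unfolding weights_def by auto
qed

lemma weights_integral_nonneg: "Z \<in> weights i \<Longrightarrow> 0 \<le> (\<integral>\<omega>. Z \<omega> \<partial>M)"
  by (simp add: integral_nonneg_AE weights_nonneg)

lemma weight_integral_mono: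
  assumes "Z \<in> weights i" "A \<in> Linf M" "A' \<in> Linf M" "AE \<omega> in M. A \<omega> \<le> A' \<omega>"
  shows "(\<integral>\<omega>. Z \<omega> * A \<omega> \<partial>M) \<le> (\<integral>\<omega>. Z \<omega> * A' \<omega> \<partial>M)"
proof (rule integral_mono_AE)
  show "AE \<omega> in M. Z \<omega> * A \<omega> \<le> Z \<omega> * A' \<omega>"
    using assms(4) weights_nonneg[OF assms(1)] by eventually_elim (auto intro: mult_left_mono)
qed (use assms weights_LinfM in \<open>auto intro!: Linf_integrable\<close>)

lemma weight_integral_bound:
  assumes "Z \<in> weights i" "A \<in> Linf M" "AE \<omega> in M. \<bar>A \<omega>\<bar> \<le> c"
  shows "\<bar>\<integral>\<omega>. Z \<omega> * A \<omega> \<partial>M\<bar> \<le> c * (\<integral>\<omega>. Z \<omega> \<partial>M)"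
proof -
  have "(\<integral>\<omega>. Z \<omega> * A \<omega> \<partial>M) \<le> (\<integral>\<omega>. Z \<omega> * c \<partial>M)"
    by (rule weight_integral_mono[OF assms(1,2)]) (use assms(3) in \<open>auto elim: eventually_mono\<close>)
  moreover have "(\<integral>\<omega>. Z \<omega> * (- c) \<partial>M) \<le> (\<integral>\<omega>. Z \<omega> * A \<omega> \<partial>M)"
    by (rule weight_integral_mono[OF assms(1) _ assms(2)]) (use assms(3) in \<open>auto elim: eventually_mono\<close>)
  ultimately show ?thesis by (simp add: abs_le_iff mult.commute)
qed

lemma weight_integral_add:
  assumes "Z \<in> weights i" "A \<in> Linf M" "A' \<in> Linf M"
  shows "(\<integral>\<omega>. Z \<omega> * (A \<omega> + A' \<omega>) \<partial>M) = (\<integral>\<omega>. Z \<omega> * A \<omega> \<partial>M) + (\<integral>\<omega>. Z \<omega> * A' \<omega> \<partial>M)"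
  unfolding distrib_left
  by (rule Bochner_Integration.integral_add) (use assms weights_LinfM in \<open>auto intro!: Linf_integrable\<close>)

lemma weight_integral_diff:
  assumes "Z \<in> weights i" "A \<in> Linf M" "A' \<in> Linf M"
  shows "(\<integral>\<omega>. Z \<omega> * (A \<omega> - A' \<omega>) \<partial>M) = (\<integral>\<omega>. Z \<omega> * A \<omega> \<partial>M) - (\<integral>\<omega>. Z \<omega> * A' \<omega> \<partial>M)"
  unfolding right_diff_distrib
  by (rule Bochner_Integration.integral_diff) (use assms weights_LinfM in \<open>auto intro!: Linf_integrable\<close>)

lemma weight_integral_cmult:
  "(\<integral>\<omega>. Z \<omega> * (c * A \<omega>) \<partial>M) = c * (\<integral>\<omega>. Z \<omega> * A \<omega> \<partial>M)" for c :: real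
  by (simp add: mult.left_commute)

lemma weight_integral_sum:
  assumes "Z \<in> weights i" "\<And>j. j \<in> J \<Longrightarrow> A j \<in> Linf M"
  shows "(\<integral>\<omega>. Z \<omega> * (\<Sum>j\<in>J. A j \<omega>) \<partial>M) = (\<Sum>j\<in>J. \<integral>\<omega>. Z \<omega> * A j \<omega> \<partial>M)"
  unfolding sum_distrib_left
  by (rule Bochner_Integration.integral_sum) (use assms weights_LinfM in \<open>auto intro!: Linf_integrable\<close>)

lemma cond_measurable: "cond i A \<in> borel_measurable (F i)"
  by (rule borel_measurable_cond_exp)

lemma cond_bound:
  assumes "A \<in> Linf M" "AE \<omega> in M. \<bar>A \<omega>\<bar> \<le> B"
  shows "AE \<omega> in M. \<bar>cond i A \<omega>\<bar> \<le> B"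
proof -
  interpret sigma_finite_subalgebra M "F i" by (rule sigma_finite_filtration)
  have "AE \<omega> in M. cond i A \<omega> \<le> B"
    by (rule real_cond_exp_le_c) (use assms Linf_integrable in \<open>auto elim: eventually_mono\<close>)
  moreover have "AE \<omega> in M. cond i A \<omega> \<ge> - B"
    by (rule real_cond_exp_ge_c) (use assms Linf_integrable in \<open>auto elim: eventually_mono\<close>)
  ultimately show ?thesis by eventually_elim auto
qed

lemma cond_Linf:
  assumes "A \<in> Linf M" shows "cond i A \<in> Linf (F i)"
proof -
  obtain B where B: "AE \<omega> in M. \<bar>A \<omega>\<bar> \<le> B" using assms by (rule Linf_bound)
  show ?thesis by (rule LinfI[OF cond_measurable cond_bound[OF assms B]])
qed

lemma cond_LinfM: "A \<in> Linf M \<Longrightarrow> cond i A \<in> Linf M"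
  using cond_Linf Linf_filtration by blast

lemma cond_integral:
  assumes "Z \<in> Linf (F i)" "A \<in> Linf M"
  shows "(\<integral>\<omega>. Z \<omega> * cond i A \<omega> \<partial>M) = (\<integral>\<omega>. Z \<omega> * A \<omega> \<partial>M)"
proof -
  interpret sigma_finite_subalgebra M "F i" by (rule sigma_finite_filtration)
  show ?thesis
    by (rule real_cond_exp_intg)
       (use assms Linf_filtration in \<open>auto intro!: Linf_integrable dest: Linf_measurable\<close>)
qed

lemma cond_add:
  assumes "A \<in> Linf M" "A' \<in> Linf M"
  shows "AE \<omega> in M. cond i (\<lambda>\<omega>. A \<omega> + A' \<omega>) \<omega> = cond i A \<omega> + cond i A' \<omega>"
proof -
  interpret sigma_finite_subalgebra M "F i" by (rule sigma_finite_filtration)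
  show ?thesis using assms by (intro real_cond_exp_add Linf_integrable)
qed

lemma cond_sum:
  assumes "\<And>j. A j \<in> Linf M"
  shows "AE \<omega> in M. cond i (\<lambda>\<omega>. \<Sum>j\<in>J. A j \<omega>) \<omega> = (\<Sum>j\<in>J. cond i (A j) \<omega>)"
proof -
  interpret sigma_finite_subalgebra M "F i" by (rule sigma_finite_filtration)
  show ?thesis using assms by (intro real_cond_exp_sum Linf_integrable)
qed

lemma cond_tower:
  assumes "A \<in> Linf M" "i \<le> j"
  shows "AE \<omega> in M. cond i (cond j A) \<omega> = cond i A \<omega>"
proof -
  interpret sigma_finite_subalgebra M "F i" by (rule sigma_finite_filtration)
  show ?thesis
    using assms by (intro real_cond_exp_nested_subalg filtration_subalgebra
      subalgebra_filtration_mono Linf_integrable)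
qed

lemma partial_sum_Linf:
  assumes g: "\<And>j. g j \<le> g (Suc j)"
    and A: "\<And>j. j < k \<Longrightarrow> A j \<in> Linf (F (g (Suc j)))"
  shows "j \<le> k \<Longrightarrow> (\<lambda>\<omega>. \<Sum>i<j. A i \<omega>) \<in> Linf (F (g j))"
proof (rule Linf_sum)
  fix i assume j: "j \<le> k" and "i \<in> {..<j}"
  then have "g (Suc i) \<le> g j" using g by (auto intro: lift_Suc_mono_le)
  then show "A i \<in> Linf (F (g j))" using A[of i] j \<open>i \<in> _\<close> Linf_filtration_mono by auto
qed

text \<open>The exponential of the first \<open>j\<close> terms is a weight at time
  \<open>g j\<close>, so it is absorbed into \<open>Z\<close> and the one-step bound is applied once
  more. The times \<open>g j\<close> are left free so that blocks of any length are covered.\<close>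

lemma weight_exp_sum_le:
  assumes g: "\<And>j. g j \<le> g (Suc j)"
    and A: "\<And>j. j < k \<Longrightarrow> A j \<in> Linf (F (g (Suc j)))"
    and step: "\<And>j Z. j < k \<Longrightarrow> Z \<in> weights (g j) \<Longrightarrow>
        (\<integral>\<omega>. Z \<omega> * exp (A j \<omega>) \<partial>M) \<le> \<kappa> * (\<integral>\<omega>. Z \<omega> \<partial>M)"
    and "\<kappa> \<ge> 0" "Z \<in> weights (g 0)"
  shows "(\<integral>\<omega>. Z \<omega> * exp (\<Sum>j<k. A j \<omega>) \<partial>M) \<le> \<kappa> ^ k * (\<integral>\<omega>. Z \<omega> \<partial>M)"
proof -
  have "(\<integral>\<omega>. Z \<omega> * exp (\<Sum>i<j. A i \<omega>) \<partial>M) \<le> \<kappa> ^ j * (\<integral>\<omega>. Z \<omega> \<partial>M)" if "j \<le> k" for j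
    using that
  proof (induction j)
    case (Suc j)
    have W: "(\<lambda>\<omega>. Z \<omega> * exp (\<Sum>i<j. A i \<omega>)) \<in> weights (g j)"
      using Suc.prems assms(5) g partial_sum_Linf[where g = g and A = A, OF g A, of k j]
      by (intro weights_mult weights_exp) (auto intro: weights_mono lift_Suc_mono_le)
    have "(\<integral>\<omega>. Z \<omega> * exp (\<Sum>i<Suc j. A i \<omega>) \<partial>M)
        = (\<integral>\<omega>. (Z \<omega> * exp (\<Sum>i<j. A i \<omega>)) * exp (A j \<omega>) \<partial>M)"
      by (simp add: exp_add mult.assoc)
    also have "\<dots> \<le> \<kappa> * (\<integral>\<omega>. Z \<omega> * exp (\<Sum>i<j. A i \<omega>) \<partial>M)"
      using step[OF _ W] Suc.prems by simp
    also have "\<dots> \<le> \<kappa> * (\<kappa> ^ j * (\<integral>\<omega>. Z \<omega> \<partial>M))"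
      using Suc assms(4) by (intro mult_left_mono) auto
    finally show ?case by (simp add: mult.assoc)
  qed simp
  then show ?thesis by simp
qed

lemma weight_exp_sum_ge:
  assumes g: "\<And>j. g j \<le> g (Suc j)"
    and A: "\<And>j. j < k \<Longrightarrow> A j \<in> Linf (F (g (Suc j)))"
    and step: "\<And>j Z. j < k \<Longrightarrow> Z \<in> weights (g j) \<Longrightarrow>
        \<kappa> * (\<integral>\<omega>. Z \<omega> \<partial>M) \<le> (\<integral>\<omega>. Z \<omega> * exp (A j \<omega>) \<partial>M)"
    and "\<kappa> \<ge> 0" "Z \<in> weights (g 0)"
  shows "\<kappa> ^ k * (\<integral>\<omega>. Z \<omega> \<partial>M) \<le> (\<integral>\<omega>. Z \<omega> * exp (\<Sum>j<k. A j \<omega>) \<partial>M)"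
proof -
  have "\<kappa> ^ j * (\<integral>\<omega>. Z \<omega> \<partial>M) \<le> (\<integral>\<omega>. Z \<omega> * exp (\<Sum>i<j. A i \<omega>) \<partial>M)" if "j \<le> k" for j
    using that
  proof (induction j)
    case (Suc j)
    have W: "(\<lambda>\<omega>. Z \<omega> * exp (\<Sum>i<j. A i \<omega>)) \<in> weights (g j)"
      using Suc.prems assms(5) g partial_sum_Linf[where g = g and A = A, OF g A, of k j]
      by (intro weights_mult weights_exp) (auto intro: weights_mono lift_Suc_mono_le)
    have "\<kappa> * (\<kappa> ^ j * (\<integral>\<omega>. Z \<omega> \<partial>M)) \<le> \<kappa> * (\<integral>\<omega>. Z \<omega> * exp (\<Sum>i<j. A i \<omega>) \<partial>M)"
      using Suc assms(4) by (intro mult_left_mono) auto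
    also have "\<dots> \<le> (\<integral>\<omega>. (Z \<omega> * exp (\<Sum>i<j. A i \<omega>)) * exp (A j \<omega>) \<partial>M)"
      using step[OF _ W] Suc.prems by simp
    also have "\<dots> = (\<integral>\<omega>. Z \<omega> * exp (\<Sum>i<Suc j. A i \<omega>) \<partial>M)"
      by (simp add: exp_add mult.assoc)
    finally show ?case by (simp add: mult.assoc)
  qed simp
  then show ?thesis by simp
qed

end

section \<open>Sub-Gaussian bounds for sums of block drifts\<close>

text \<open>The Lagrange remainder has coefficient exp t / 6, and exp t is at most 3 on the unit
  interval.\<close>

lemma exp_Taylor2:
  fixes x :: real assumes "\<bar>x\<bar> \<le> 1"
  shows "\<bar>exp x - (1 + x + x\<^sup>2 / 2)\<bar> \<le> \<bar>x\<bar> ^ 3 / 2"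
proof -
  obtain t where t: "\<bar>t\<bar> \<le> \<bar>x\<bar>" "exp x = (\<Sum>m<3. x ^ m / fact m) + exp t / fact 3 * x ^ 3"
    using Maclaurin_exp_le[of x 3] by blast
  have "exp t \<le> exp 1" using t(1) assms by auto
  also have "\<dots> \<le> 3" by (rule exp_le)
  finally have "\<bar>exp t / 6 * x ^ 3\<bar> \<le> 3 / 6 * \<bar>x\<bar> ^ 3"
    unfolding abs_mult power_abs by (intro mult_right_mono) auto
  moreover have "exp x - (1 + x + x\<^sup>2 / 2) = exp t / 6 * x ^ 3"
    unfolding t(2) by (simp add: eval_nat_numeral)
  ultimately show ?thesis by linarith
qed

text \<open>Made for martingale differences: the linear term integrates to zero, and what is left is
  a Gaussian factor without any smallness condition on the exponent.\<close>

lemma exp_le_add_exp_square: "exp x \<le> x + exp (x\<^sup>2)" for x :: real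
proof (cases "\<bar>x\<bar> \<le> 1")
  case True
  have "\<bar>x\<bar> ^ 3 \<le> x\<^sup>2"
    using True mult_left_mono[of "\<bar>x\<bar>" 1 "x\<^sup>2"] by (simp add: power2_eq_square power3_eq_cube)
  then have "exp x \<le> x + (1 + x\<^sup>2)" using exp_Taylor2[OF True] by linarith
  then show ?thesis using exp_ge_add_one_self[of "x\<^sup>2"] by linarith
next
  case False
  show ?thesis
  proof (cases "x > 0")
    case True
    then have "x \<le> x\<^sup>2" using False by (simp add: power2_eq_square)
    then have "exp x \<le> exp (x\<^sup>2)" by simp
    then show ?thesis using True by linarith
  next
    case neg: False
    have "- x \<le> x\<^sup>2" using False neg mult_right_mono_neg[of x "-1" x] by (simp add: power2_eq_square)
    moreover have "exp x \<le> 1" using neg by simp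
    ultimately show ?thesis using exp_ge_add_one_self[of "x\<^sup>2"] by linarith
  qed
qed

text \<open>Recovers a second moment from exponential moments at two opposite tilts.\<close>

lemma square_le_exp: "x\<^sup>2 / 2 \<le> exp x + exp (- x)" for x :: real
proof (cases "x \<ge> 0")
  case True
  then show ?thesis using exp_lower_Taylor_quadratic[of x] exp_gt_zero[of "-x"] by linarith
next
  case False
  then show ?thesis using exp_lower_Taylor_quadratic[of "-x"] exp_gt_zero[of x]
    unfolding power2_minus by linarith
qed

lemma sum_lessThan_double:
  fixes f :: "nat \<Rightarrow> 'a::comm_monoid_add"
  shows "(\<Sum>j<2 * n. f j) = (\<Sum>j<n. f (2 * j)) + (\<Sum>j<n. f (2 * j + 1))"
  by (induction n) (auto simp: ac_simps)

section \<open>Conditionally sub-Gaussian variables\<close>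

context filtered_prob_space
begin

definition block :: "(nat \<Rightarrow> 'a \<Rightarrow> real) \<Rightarrow> nat \<Rightarrow> nat \<Rightarrow> 'a \<Rightarrow> real" where
  "block X a q \<omega> = (\<Sum>i\<in>{a + 1..a + q}. X i \<omega>)"

definition block_drift :: "(nat \<Rightarrow> 'a \<Rightarrow> real) \<Rightarrow> nat \<Rightarrow> nat \<Rightarrow> 'a \<Rightarrow> real" where
  "block_drift X a q = cond a (block X a q)"

text \<open>The summand 1 in the exponent admits variables that are not centred: since x <= 1 + x^2,
  a bounded variable qualifies with its bound as scale. It also survives addition unchanged, so it
  does not accumulate over the dyadic levels.\<close>

definition subgauss :: "nat \<Rightarrow> real \<Rightarrow> ('a \<Rightarrow> real) \<Rightarrow> bool" where
  "subgauss a s A \<longleftrightarrow> (\<forall>t. \<forall>Z\<in>weights a.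
     (\<integral>\<omega>. Z \<omega> * exp (t * A \<omega>) \<partial>M) \<le> exp (1 + t\<^sup>2 * s\<^sup>2) * (\<integral>\<omega>. Z \<omega> \<partial>M))"

lemma subgaussD:
  "subgauss a s A \<Longrightarrow> Z \<in> weights a \<Longrightarrow>
    (\<integral>\<omega>. Z \<omega> * exp (t * A \<omega>) \<partial>M) \<le> exp (1 + t\<^sup>2 * s\<^sup>2) * (\<integral>\<omega>. Z \<omega> \<partial>M)"
  unfolding subgauss_def by blast

lemma subgauss_mono:
  assumes "subgauss a s A" "0 \<le> s" "s \<le> s'" shows "subgauss a s' A"
  unfolding subgauss_def
proof (intro allI ballI)
  fix t Z assume Z: "Z \<in> weights a"
  have "exp (1 + t\<^sup>2 * s\<^sup>2) * (\<integral>\<omega>. Z \<omega> \<partial>M) \<le> exp (1 + t\<^sup>2 * s'\<^sup>2) * (\<integral>\<omega>. Z \<omega> \<partial>M)"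
    using assms weights_integral_nonneg[OF Z]
    by (intro mult_right_mono) (auto intro!: mult_left_mono power_mono)
  then show "(\<integral>\<omega>. Z \<omega> * exp (t * A \<omega>) \<partial>M) \<le> exp (1 + t\<^sup>2 * s'\<^sup>2) * (\<integral>\<omega>. Z \<omega> \<partial>M)"
    using subgaussD[OF assms(1) Z, of t] by linarith
qed

lemma subgauss_cong:
  assumes "subgauss a s A" "A \<in> Linf M" "A' \<in> Linf M" "AE \<omega> in M. A \<omega> = A' \<omega>"
  shows "subgauss a s A'"
  unfolding subgauss_def
proof (intro allI ballI)
  fix t Z assume Z: "Z \<in> weights a"
  have "(\<integral>\<omega>. Z \<omega> * exp (t * A' \<omega>) \<partial>M) = (\<integral>\<omega>. Z \<omega> * exp (t * A \<omega>) \<partial>M)"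
  proof (rule integral_cong_AE)
    show "AE \<omega> in M. Z \<omega> * exp (t * A' \<omega>) = Z \<omega> * exp (t * A \<omega>)"
      using assms(4) by eventually_elim simp
  qed (use assms weights_LinfM[OF Z] in \<open>auto intro!: Linf_measurable\<close>)
  then show "(\<integral>\<omega>. Z \<omega> * exp (t * A' \<omega>) \<partial>M) \<le> exp (1 + t\<^sup>2 * s\<^sup>2) * (\<integral>\<omega>. Z \<omega> \<partial>M)"
    using subgaussD[OF assms(1) Z, of t] by simp
qed

lemma subgauss_bounded:
  assumes "A \<in> Linf M" "AE \<omega> in M. \<bar>A \<omega>\<bar> \<le> s"
  shows "subgauss a s A"
  unfolding subgauss_def
proof (intro allI ballI)
  fix t Z assume Z: "Z \<in> weights a"
  have "AE \<omega> in M. exp (t * A \<omega>) \<le> exp (1 + t\<^sup>2 * s\<^sup>2)"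
    using assms(2)
  proof eventually_elim
    fix \<omega> assume "\<bar>A \<omega>\<bar> \<le> s"
    then have "\<bar>t * A \<omega>\<bar> \<le> \<bar>t * s\<bar>" unfolding abs_mult by (intro mult_left_mono) auto
    then have "t * A \<omega> \<le> \<bar>t * s\<bar>" by linarith
    also have "\<dots> \<le> 1 + \<bar>t * s\<bar>\<^sup>2"
    proof -
      have "0 \<le> (\<bar>t * s\<bar> - 1 / 2)\<^sup>2" by simp
      then show ?thesis unfolding power2_diff by (simp only: power2_eq_square)
    qed
    finally show "exp (t * A \<omega>) \<le> exp (1 + t\<^sup>2 * s\<^sup>2)" by (simp add: power_mult_distrib)
  qed
  then have "(\<integral>\<omega>. Z \<omega> * exp (t * A \<omega>) \<partial>M) \<le> (\<integral>\<omega>. Z \<omega> * exp (1 + t\<^sup>2 * s\<^sup>2) \<partial>M)"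
    using assms by (intro weight_integral_mono[OF Z]) auto
  then show "(\<integral>\<omega>. Z \<omega> * exp (t * A \<omega>) \<partial>M) \<le> exp (1 + t\<^sup>2 * s\<^sup>2) * (\<integral>\<omega>. Z \<omega> \<partial>M)"
    by (simp add: mult.commute)
qed

text \<open>No independence is involved. By convexity of exp the sum is split with proportions s /
  (s + s') and s' / (s + s'); both rescaled exponents then become t^2 (s + s')^2. The two bounds are
  averaged and not multiplied, hence scales add and the constant stays 1.\<close>

lemma subgauss_add:
  assumes A: "subgauss a s A" "A \<in> Linf M" "s > 0"
    and A': "subgauss a s' A'" "A' \<in> Linf M" "s' > 0"
  shows "subgauss a (s + s') (\<lambda>\<omega>. A \<omega> + A' \<omega>)"
  unfolding subgauss_def
proof (intro allI ballI)
  fix t Z assume Z: "Z \<in> weights a"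
  define p where "p = s / (s + s')"
  have p: "0 < p" "p < 1" "1 - p = s' / (s + s')" using A(3) A'(3) by (auto simp: p_def field_simps)
  have sq: "(t / p)\<^sup>2 * s\<^sup>2 = t\<^sup>2 * (s + s')\<^sup>2" "(t / (1 - p))\<^sup>2 * s'\<^sup>2 = t\<^sup>2 * (s + s')\<^sup>2"
    unfolding p(3) using A(3) A'(3) by (auto simp: p_def power_mult_distrib power_divide)
  let ?b = "exp (1 + t\<^sup>2 * (s + s')\<^sup>2) * (\<integral>\<omega>. Z \<omega> \<partial>M)"
  have conv: "exp (t * (A \<omega> + A' \<omega>)) \<le> p * exp (t / p * A \<omega>) + (1 - p) * exp (t / (1 - p) * A' \<omega>)" for \<omega>
  proof -
    have "t * (A \<omega> + A' \<omega>) = (1 - (1 - p)) *\<^sub>R (t / p * A \<omega>) + (1 - p) *\<^sub>R (t / (1 - p) * A' \<omega>)"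
      using p(1,2) by (simp add: field_simps)
    then show ?thesis
      using convex_onD[OF exp_convex, of "1 - p" "t / p * A \<omega>" "t / (1 - p) * A' \<omega>"] p(1,2) by simp
  qed
  have "(\<integral>\<omega>. Z \<omega> * exp (t * (A \<omega> + A' \<omega>)) \<partial>M)
      \<le> (\<integral>\<omega>. Z \<omega> * (p * exp (t / p * A \<omega>) + (1 - p) * exp (t / (1 - p) * A' \<omega>)) \<partial>M)"
    using A A' conv by (intro weight_integral_mono[OF Z]) auto
  also have "\<dots> = p * (\<integral>\<omega>. Z \<omega> * exp (t / p * A \<omega>) \<partial>M) + (1 - p) * (\<integral>\<omega>. Z \<omega> * exp (t / (1 - p) * A' \<omega>) \<partial>M)"
    using A A' by (subst weight_integral_add[OF Z]) (auto simp only: weight_integral_cmult)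
  also have "\<dots> \<le> p * ?b + (1 - p) * ?b"
    using subgaussD[OF A(1) Z, of "t / p"] subgaussD[OF A'(1) Z, of "t / (1 - p)"] p(1,2) sq
    by (intro add_mono mult_left_mono) auto
  also have "\<dots> = ?b" by (simp add: algebra_simps)
  finally show "(\<integral>\<omega>. Z \<omega> * exp (t * (A \<omega> + A' \<omega>)) \<partial>M) \<le> ?b" .
qed

text \<open>Apply \<open>square_le_exp\<close> to \<open>A / s\<close> and use the tilts 1 / s and -
  1 / s. The result is 4 s^2 exp 2, and exp 2 <= 9 gives 36.\<close>

lemma subgauss_second_moment:
  assumes "subgauss a s A" "A \<in> Linf M" "s > 0" and Z: "Z \<in> weights a"
  shows "(\<integral>\<omega>. Z \<omega> * (A \<omega>)\<^sup>2 \<partial>M) \<le> 36 * s\<^sup>2 * (\<integral>\<omega>. Z \<omega> \<partial>M)"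
proof -
  have e2: "exp (1 + (1 :: real)) \<le> 9"
    unfolding exp_add using mult_mono[OF exp_le exp_le] by simp
  have one: "(1 / s)\<^sup>2 * s\<^sup>2 = 1" "(- 1 / s)\<^sup>2 * s\<^sup>2 = 1" using assms(3) by (auto simp: power_divide)
  have "(A \<omega>)\<^sup>2 \<le> 2 * s\<^sup>2 * (exp (1 / s * A \<omega>) + exp (- 1 / s * A \<omega>))" for \<omega>
    using square_le_exp[of "A \<omega> / s"] assms(3) by (simp add: power_divide field_simps)
  then have "(\<integral>\<omega>. Z \<omega> * (A \<omega>)\<^sup>2 \<partial>M)
      \<le> (\<integral>\<omega>. Z \<omega> * (2 * s\<^sup>2 * (exp (1 / s * A \<omega>) + exp (- 1 / s * A \<omega>))) \<partial>M)"
    using assms by (intro weight_integral_mono[OF Z]) auto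
  also have "\<dots> = 2 * s\<^sup>2 * ((\<integral>\<omega>. Z \<omega> * exp (1 / s * A \<omega>) \<partial>M) + (\<integral>\<omega>. Z \<omega> * exp (- 1 / s * A \<omega>) \<partial>M))"
    unfolding weight_integral_cmult using assms
    by (subst weight_integral_add[OF Z]) auto
  also have "\<dots> \<le> 2 * s\<^sup>2 * (exp (1 + 1) * (\<integral>\<omega>. Z \<omega> \<partial>M) + exp (1 + 1) * (\<integral>\<omega>. Z \<omega> \<partial>M))"
    using subgaussD[OF assms(1) Z, of "1 / s"] subgaussD[OF assms(1) Z, of "- 1 / s"]
    unfolding one by (intro mult_left_mono add_mono) auto
  also have "\<dots> = 4 * s\<^sup>2 * (\<integral>\<omega>. Z \<omega> \<partial>M) * exp (1 + 1)" by simp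
  also have "\<dots> \<le> 4 * s\<^sup>2 * (\<integral>\<omega>. Z \<omega> \<partial>M) * 9"
    using e2 weights_integral_nonneg[OF Z] by (intro mult_left_mono) auto
  finally show ?thesis by simp
qed

text \<open>By \<open>exp_le_add_exp_square\<close> and the vanishing conditional mean, each
  increment costs a factor exp(t^2 u^2); \<open>k\<close> such factors multiply to the scale sqrt k
  * u.\<close>

lemma subgauss_martingale:
  assumes g: "\<And>j. g j \<le> g (Suc j)" "g 0 = a"
    and D: "\<And>j. D j \<in> Linf (F (g (Suc j)))" "\<And>j. AE \<omega> in M. \<bar>D j \<omega>\<bar> \<le> u"
    and mart: "\<And>j Z. Z \<in> weights (g j) \<Longrightarrow> (\<integral>\<omega>. Z \<omega> * D j \<omega> \<partial>M) = 0"
  shows "subgauss a (sqrt (real k) * u) (\<lambda>\<omega>. \<Sum>j<k. D j \<omega>)"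
  unfolding subgauss_def
proof (intro allI ballI)
  fix t Z assume Z: "Z \<in> weights a"
  have DM: "D j \<in> Linf M" for j using D(1) Linf_filtration by blast
  have step: "(\<integral>\<omega>. Z \<omega> * exp (t * D j \<omega>) \<partial>M) \<le> exp (t\<^sup>2 * u\<^sup>2) * (\<integral>\<omega>. Z \<omega> \<partial>M)"
    if Z: "Z \<in> weights (g j)" for j Z
  proof -
    have "AE \<omega> in M. exp (t * D j \<omega>) \<le> t * D j \<omega> + exp (t\<^sup>2 * u\<^sup>2)"
      using D(2)[of j]
    proof eventually_elim
      fix \<omega> assume "\<bar>D j \<omega>\<bar> \<le> u"
      then have "(D j \<omega>)\<^sup>2 \<le> u\<^sup>2" using abs_le_square_iff[of "D j \<omega>" u] by auto
      then have "exp ((t * D j \<omega>)\<^sup>2) \<le> exp (t\<^sup>2 * u\<^sup>2)"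
        by (simp add: power_mult_distrib mult_left_mono)
      then show "exp (t * D j \<omega>) \<le> t * D j \<omega> + exp (t\<^sup>2 * u\<^sup>2)"
        using exp_le_add_exp_square[of "t * D j \<omega>"] by linarith
    qed
    then have "(\<integral>\<omega>. Z \<omega> * exp (t * D j \<omega>) \<partial>M) \<le> (\<integral>\<omega>. Z \<omega> * (t * D j \<omega> + exp (t\<^sup>2 * u\<^sup>2)) \<partial>M)"
      using DM by (intro weight_integral_mono[OF Z]) auto
    also have "\<dots> = exp (t\<^sup>2 * u\<^sup>2) * (\<integral>\<omega>. Z \<omega> \<partial>M)"
      using DM mart[OF Z]
      by (subst weight_integral_add[OF Z]) (auto simp: weight_integral_cmult)
    finally show ?thesis .
  qed
  have "(\<integral>\<omega>. Z \<omega> * exp (\<Sum>j<k. t * D j \<omega>) \<partial>M) \<le> exp (t\<^sup>2 * u\<^sup>2) ^ k * (\<integral>\<omega>. Z \<omega> \<partial>M)"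
    using D(1) Z g step by (intro weight_exp_sum_le[where g = g]) auto
  also have "exp (t\<^sup>2 * u\<^sup>2) ^ k = exp (t\<^sup>2 * (sqrt (real k) * u)\<^sup>2)"
    by (simp add: exp_of_nat_mult[symmetric] power_mult_distrib ac_simps)
  also have "exp (t\<^sup>2 * (sqrt (real k) * u)\<^sup>2) * (\<integral>\<omega>. Z \<omega> \<partial>M)
      \<le> exp (1 + t\<^sup>2 * (sqrt (real k) * u)\<^sup>2) * (\<integral>\<omega>. Z \<omega> \<partial>M)"
    using weights_integral_nonneg[OF Z] by (intro mult_right_mono) auto
  finally show "(\<integral>\<omega>. Z \<omega> * exp (t * (\<Sum>j<k. D j \<omega>)) \<partial>M)
      \<le> exp (1 + t\<^sup>2 * (sqrt (real k) * u)\<^sup>2) * (\<integral>\<omega>. Z \<omega> \<partial>M)"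
    by (simp add: sum_distrib_left)
qed

end

text \<open>Centring is implicit: the decay of \<open>c\<close> forces the conditional means far
  ahead to be small. The series has no contribution at index 0, where division by sqrt 0 yields 0,
  and \<open>c 0\<close> is constrained only to be positive.\<close>

locale short_memory_process = filtered_prob_space +
  fixes X :: "nat \<Rightarrow> 'a \<Rightarrow> real" and b :: real and c :: "nat \<Rightarrow> real"
  assumes X_adapted: "X n \<in> borel_measurable (F n)"
    and X_bounded: "\<bar>X n \<omega>\<bar> \<le> b"
    and c_pos: "c n > 0"
    and c_summable: "summable (\<lambda>n. c n / sqrt (real n))"
    and cond_decay: "n \<ge> 1 \<Longrightarrow> AE \<omega> in M. \<bar>cond a (X (a + n)) \<omega>\<bar> \<le> c n"
begin

definition csum :: "nat \<Rightarrow> real" where "csum q = (\<Sum>i\<in>{1..q}. c i)"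

lemma csum_pos: "q \<ge> 1 \<Longrightarrow> csum q > 0"
  unfolding csum_def using c_pos by (intro sum_pos) auto

lemma csum_nonneg: "csum q \<ge> 0"
  unfolding csum_def using c_pos by (intro sum_nonneg) (auto intro: less_imp_le)

lemma b_nonneg: "b \<ge> 0"
  using X_bounded[of 0 undefined] by linarith

lemma X_Linf: "X n \<in> Linf (F n)"
  using X_adapted X_bounded by (intro LinfI[where B = b]) auto

lemma X_LinfM: "X n \<in> Linf M"
  using X_Linf Linf_filtration by blast

lemma block_Linf: "a + q \<le> i \<Longrightarrow> block X a q \<in> Linf (F i)"
  unfolding block_def by (rule Linf_sum) (auto intro: Linf_filtration_mono[OF _ X_Linf])

lemma block_LinfM: "block X a q \<in> Linf M"
  using block_Linf Linf_filtration by blast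

lemma block_bound: "\<bar>block X a q \<omega>\<bar> \<le> b * real q"
proof -
  have "\<bar>block X a q \<omega>\<bar> \<le> (\<Sum>i\<in>{a + 1..a + q}. b)"
    unfolding block_def using X_bounded by (intro sum_abs[THEN order_trans] sum_mono)
  then show ?thesis by (simp add: mult.commute)
qed

lemma block_drift_Linf: "block_drift X a q \<in> Linf (F a)"
  unfolding block_drift_def by (rule cond_Linf[OF block_LinfM])

lemma block_drift_LinfM: "block_drift X a q \<in> Linf M"
  using block_drift_Linf Linf_filtration by blast

lemma block_drift_bound: "AE \<omega> in M. \<bar>block_drift X a q \<omega>\<bar> \<le> csum q"
proof -
  have 1: "block X a q = (\<lambda>\<omega>. \<Sum>i\<in>{1..q}. X (a + i) \<omega>)"
    unfolding block_def using sum.shift_bounds_cl_nat_ivl[of "\<lambda>i. X i _" 1 a q] by (simp add: add.commute)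
  have "AE \<omega> in M. \<forall>i\<in>{1..q}. \<bar>cond a (X (a + i)) \<omega>\<bar> \<le> c i"
    by (rule AE_finite_allI) (auto intro: cond_decay)
  then show ?thesis using cond_sum[of "\<lambda>i. X (a + i)" a "{1..q}", OF X_LinfM]
    unfolding block_drift_def 1
  proof eventually_elim
    fix \<omega> assume *: "\<forall>i\<in>{1..q}. \<bar>cond a (X (a + i)) \<omega>\<bar> \<le> c i"
      and eq: "cond a (\<lambda>\<omega>. \<Sum>j\<in>{1..q}. X (a + j) \<omega>) \<omega> = (\<Sum>j\<in>{1..q}. cond a (X (a + j)) \<omega>)"
    show "\<bar>cond a (\<lambda>\<omega>. \<Sum>j\<in>{1..q}. X (a + j) \<omega>) \<omega>\<bar> \<le> csum q"
      unfolding eq csum_def using * by (intro sum_abs[THEN order_trans] sum_mono) auto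
  qed
qed

text \<open>By the tower property the second half enters through the expectation of its own drift.
  Replacing that drift by its expectation is the only change made when two blocks are
  merged.\<close>

lemma block_drift_double:
  "AE \<omega> in M. block_drift X a (2 * q) \<omega> = block_drift X a q \<omega> + cond a (block_drift X (a + q) q) \<omega>"
proof -
  have "block X a (2 * q) = (\<lambda>\<omega>. block X a q \<omega> + block X (a + q) q \<omega>)"
  proof
    fix \<omega>
    have "{a + 1..a + 2 * q} = {a + 1..a + q} \<union> {a + q + 1..a + q + q}" by auto
    then show "block X a (2 * q) \<omega> = block X a q \<omega> + block X (a + q) q \<omega>"
      unfolding block_def by (simp add: sum.union_disjoint)
  qed
  then show ?thesis
    using cond_add[OF block_LinfM[of a q] block_LinfM[of "a + q" q], of a]
      cond_tower[OF block_LinfM[of "a + q" q], of a "a + q"]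
    unfolding block_drift_def by (auto elim: eventually_elim2)
qed

text \<open>Grouping the blocks in pairs replaces the block length \<open>q\<close> by \<open>2 * q\<close> up to a martingale
  whose increments are bounded by \<open>2 * csum q\<close>.\<close>

lemma subgauss_dyadic:
  assumes "q \<ge> 1"
  shows "subgauss a (2 * sqrt (real (q * 2 ^ r)) * (\<Sum>t\<le>r. csum (q * 2 ^ t) / sqrt (real (q * 2 ^ t))))
           (\<lambda>\<omega>. \<Sum>j<2 ^ r. block_drift X (a + q * j) q \<omega>)"
  using assms
proof (induction r arbitrary: q)
  case 0
  have "csum q \<le> 2 * csum q" using csum_nonneg by simp
  then have "AE \<omega> in M. \<bar>block_drift X a q \<omega>\<bar> \<le> 2 * csum q"
    using block_drift_bound[of a q] by (auto elim: eventually_mono)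
  then show ?case using subgauss_bounded[OF block_drift_LinfM] 0 by simp
next
  case (Suc r)
  \<comment> \<open>\<open>E j\<close> compares the drift of the second half of a pair with its
    expectation at the start of the pair. This expectation and the drift of the first half add up to
    the drift of the doubled block, so the \<open>E j\<close> are exactly the error of merging, and
    they are martingale differences along the pairs.\<close>
  define E where "E j \<omega> = block_drift X (a + 2 * q * j + q) q \<omega>
      - cond (a + 2 * q * j) (block_drift X (a + 2 * q * j + q) q) \<omega>" for j \<omega>
  define R where "R \<omega> = (\<Sum>j<2 ^ r. block_drift X (a + 2 * q * j) (2 * q) \<omega>)" for \<omega>
  define s where "s = 2 * sqrt (real (2 * q * 2 ^ r)) *
      (\<Sum>t\<le>r. csum (2 * q * 2 ^ t) / sqrt (real (2 * q * 2 ^ t)))"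
  have cE: "AE \<omega> in M. \<bar>cond (a + 2 * q * j) (block_drift X (a + 2 * q * j + q) q) \<omega>\<bar> \<le> csum q" for j
    by (rule cond_bound[OF block_drift_LinfM block_drift_bound])
  have E_bound: "AE \<omega> in M. \<bar>E j \<omega>\<bar> \<le> 2 * csum q" for j
    using cE[of j] block_drift_bound[of "a + 2 * q * j + q" q]
    unfolding E_def by eventually_elim linarith
  have E_Linf: "E j \<in> Linf (F (a + 2 * q * Suc j))" for j
    unfolding E_def
    by (intro Linf_diff Linf_filtration_mono[OF _ block_drift_Linf]
        Linf_filtration_mono[OF _ cond_Linf] block_drift_LinfM) auto
  have E_mart: "(\<integral>\<omega>. Z \<omega> * E j \<omega> \<partial>M) = 0" if "Z \<in> weights (a + 2 * q * j)" for Z j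
    unfolding E_def
    by (subst weight_integral_diff[OF that block_drift_LinfM cond_LinfM[OF block_drift_LinfM]])
      (use cond_integral[OF weights_Linf[OF that] block_drift_LinfM] in simp)
  have sgE: "subgauss a (sqrt (real (2 ^ r)) * (2 * csum q)) (\<lambda>\<omega>. \<Sum>j<2 ^ r. E j \<omega>)"
    by (rule subgauss_martingale[where g = "\<lambda>j. a + 2 * q * j"]) (use E_bound E_Linf E_mart in auto)
  have sgR: "subgauss a s R"
    unfolding s_def R_def using Suc.IH[of "2 * q"] Suc.prems by simp
  have s_pos: "s > 0" unfolding s_def
    using Suc.prems by (intro mult_pos_pos sum_pos divide_pos_pos csum_pos) auto
  have AEeq: "AE \<omega> in M. R \<omega> + (\<Sum>j<2 ^ r. E j \<omega>) = (\<Sum>j<2 ^ Suc r. block_drift X (a + q * j) q \<omega>)"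
  proof -
    have "AE \<omega> in M. \<forall>j\<in>{..<2 ^ r}. block_drift X (a + 2 * q * j) (2 * q) \<omega>
        = block_drift X (a + 2 * q * j) q \<omega>
          + cond (a + 2 * q * j) (block_drift X (a + 2 * q * j + q) q) \<omega>"
      by (rule AE_finite_allI) (auto intro: block_drift_double)
    then show ?thesis
    proof eventually_elim
      case (elim \<omega>)
      have "R \<omega> + (\<Sum>j<2 ^ r. E j \<omega>) = (\<Sum>j<2 ^ r. block_drift X (a + 2 * q * j) q \<omega>
          + block_drift X (a + 2 * q * j + q) q \<omega>)"
        unfolding R_def E_def sum.distrib[symmetric] using elim by (intro sum.cong) auto
      also have "\<dots> = (\<Sum>j<2 * 2 ^ r. block_drift X (a + q * j) q \<omega>)"
        unfolding sum_lessThan_double sum.distrib[symmetric] by (simp add: algebra_simps)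
      finally show ?case by simp
    qed
  qed
  have RL: "R \<in> Linf M" unfolding R_def using block_drift_LinfM by auto
  have EL: "(\<lambda>\<omega>. \<Sum>j<2 ^ r. E j \<omega>) \<in> Linf M"
    using E_Linf Linf_filtration by auto
  have "subgauss a (s + sqrt (real (2 ^ r)) * (2 * csum q)) (\<lambda>\<omega>. R \<omega> + (\<Sum>j<2 ^ r. E j \<omega>))"
    using Suc.prems csum_pos by (intro subgauss_add[OF sgR RL s_pos sgE EL]) auto
  then have sg: "subgauss a (s + sqrt (real (2 ^ r)) * (2 * csum q))
      (\<lambda>\<omega>. \<Sum>j<2 ^ Suc r. block_drift X (a + q * j) q \<omega>)"
    by (rule subgauss_cong) (use RL EL AEeq block_drift_LinfM in auto)
  \<comment> \<open>The martingale of this level supplies the \<open>t = 0\<close> term of the sum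
    for \<open>Suc r\<close>. Bringing its scale to the common prefactor loses a factor sqrt
    2.\<close>
  have "sqrt (real (2 ^ r)) * (2 * csum q) \<le> 2 * sqrt (real (q * 2 ^ Suc r)) * (csum q / sqrt (real q))"
  proof -
    have "sqrt (real (q * 2 ^ Suc r)) * (csum q / sqrt (real q)) = sqrt (2 ^ Suc r) * csum q"
      using Suc.prems by (simp add: real_sqrt_mult)
    moreover have "sqrt (2 ^ r) * csum q \<le> sqrt (2 ^ Suc r) * csum q"
      using csum_nonneg by (intro mult_right_mono) auto
    ultimately show ?thesis by simp
  qed
  moreover have "(\<Sum>t\<le>Suc r. csum (q * 2 ^ t) / sqrt (real (q * 2 ^ t)))
     = csum q / sqrt (real q) + (\<Sum>t\<le>r. csum (2 * q * 2 ^ t) / sqrt (real (2 * q * 2 ^ t)))"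
    by (subst sum.atMost_Suc_shift) (simp add: ac_simps)
  ultimately have "s + sqrt (real (2 ^ r)) * (2 * csum q) \<le> 2 * sqrt (real (q * 2 ^ Suc r))
      * (\<Sum>t\<le>Suc r. csum (q * 2 ^ t) / sqrt (real (q * 2 ^ t)))"
    unfolding s_def by (simp add: distrib_left ac_simps)
  then show ?case
    using sg s_pos csum_nonneg by (intro subgauss_mono[OF sg]) auto
qed

end

text \<open>From the first level that reaches \<open>x\<close>, the terms form a geometric series of
  ratio 1 / sqrt 2 whose first term is at most 1 / sqrt x.\<close>

lemma sum_dyadic_tail_le:
  fixes q :: nat and x :: real
  assumes "q \<ge> 1" "x > 0"
  shows "(\<Sum>t\<le>r. if x \<le> real (q * 2 ^ t) then 1 / sqrt (real (q * 2 ^ t)) else 0) \<le> 4 / sqrt x"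
proof -
  define y where "y t = real (q * 2 ^ t)" for t
  let ?s = "\<lambda>r. \<Sum>t\<le>r. if x \<le> y t then 1 / sqrt (y t) else 0"
  have y0: "y t > 0" "y (Suc t) = 2 * y t" for t using assms(1) by (auto simp: y_def)
  \<comment> \<open>The amount 5 / 2 / sqrt (y t) is the reserve for all later levels: sqrt 2 >= 7 /
    5 and (5 / 2 + 1) / (7 / 5) = 5 / 2. At the first active level, reserve and term together cost 7
    / 2 <= 4.\<close>
  have step: "5 / 2 / sqrt (y (Suc t)) + 1 / sqrt (y (Suc t)) \<le> 5 / 2 / sqrt (y t)" for t
  proof -
    have "7 / 5 \<le> sqrt 2" by (rule real_le_rsqrt) (simp add: power2_eq_square)
    then have "7 / 5 * sqrt (y t) \<le> sqrt (y (Suc t))"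
      unfolding y0(2) real_sqrt_mult using y0(1)[of t] by (intro mult_right_mono) auto
    then have "1 / sqrt (y (Suc t)) \<le> 1 / (7 / 5 * sqrt (y t))"
      using y0(1)[of t] y0(1)[of "Suc t"] by (intro divide_left_mono mult_pos_pos) auto
    then show ?thesis by simp
  qed
  have "(y r < x \<longrightarrow> ?s r = 0) \<and> (x \<le> y r \<longrightarrow> ?s r + 5 / 2 / sqrt (y r) \<le> 4 / sqrt x)" for r
  proof (induction r)
    case 0
    have "x \<le> y 0 \<Longrightarrow> 7 / 2 / sqrt (y 0) \<le> 4 / sqrt x"
      using assms(2) y0(1)[of 0] by (intro frac_le) auto
    then show ?case by auto
  next
    case (Suc r)
    show ?case
    proof (cases "x \<le> y r")
      case True
      moreover have "y r \<le> y (Suc r)" using y0[of r] by simp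
      ultimately have "x \<le> y (Suc r)" by linarith
      then show ?thesis using Suc True step[of r] by auto
    next
      case False
      moreover have "x \<le> y (Suc r) \<Longrightarrow> 7 / 2 / sqrt (y (Suc r)) \<le> 4 / sqrt x"
        using assms(2) y0(1)[of "Suc r"] by (intro frac_le) auto
      ultimately show ?thesis using Suc by auto
    qed
  qed
  note main = this[of r]
  have "0 \<le> 5 / 2 / sqrt (y r)" using y0(1)[of r] by simp
  moreover have "0 \<le> 4 / sqrt x" using assms(2) by simp
  ultimately have "?s r \<le> 4 / sqrt x" using main by linarith
  then show ?thesis unfolding y_def .
qed

section \<open>Drifts at the scale of the square root\<close>

context short_memory_process
begin

text \<open>Majorant of the sum over dyadic levels in \<open>subgauss_dyadic\<close>:
  \<open>c i\<close> occurs in those \<open>csum (q * 2 ^ t)\<close> whose length is at least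
  \<open>max i q\<close>, and the reciprocal square roots of these lengths sum to at most 4 / sqrt
  (max i q).\<close>

definition tau :: "nat \<Rightarrow> real" where
  "tau q = 4 * (\<Sum>i. c i / sqrt (real (max i q)))"

lemma tau_term_le: "i \<ge> 1 \<Longrightarrow> c i / sqrt (real (max i q)) \<le> c i / sqrt (real i)"
  using c_pos[of i] by (intro divide_left_mono) auto

lemma tau_summable: "summable (\<lambda>i. c i / sqrt (real (max i q)))"
proof (rule summable_comparison_test[OF _ c_summable], intro exI[of _ 1] allI impI)
  fix i :: nat assume "i \<ge> 1"
  then show "norm (c i / sqrt (real (max i q))) \<le> c i / sqrt (real i)"
    using tau_term_le[of i q] c_pos[of i] by (simp add: abs_of_pos)
qed

lemma tau_nonneg: "tau q \<ge> 0"
  unfolding tau_def using tau_summable[of q] c_pos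
  by (intro mult_nonneg_nonneg suminf_nonneg) (auto intro!: divide_nonneg_nonneg intro: less_imp_le)

text \<open>Dominated convergence for series: each term tends to 0 as \<open>q\<close> grows, under
  the summable majorant \<open>c i / sqrt i\<close>.\<close>

lemma tau_tendsto_0: "tau \<longlonglongrightarrow> 0"
proof -
  have lim: "(\<lambda>q. c i / sqrt (real (max i q))) \<longlonglongrightarrow> 0" for i
  proof -
    have "filterlim (\<lambda>q. real (max i q)) at_top sequentially"
      by (rule filterlim_at_top_mono[OF filterlim_real_sequentially]) auto
    then have "filterlim (\<lambda>q. sqrt (real (max i q))) at_top sequentially"
      by (rule filterlim_compose[OF sqrt_at_top])
    then show ?thesis by (rule tendsto_divide_0[OF tendsto_const filterlim_at_top_imp_at_infinity])
  qed
  have "(\<lambda>q. \<Sum>i. c i / sqrt (real (max i q))) \<longlonglongrightarrow> (\<Sum>i. 0)"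
  proof (rule tannerys_theorem[where M = "\<lambda>i. if i = 0 then c 0 else c i / sqrt (real i)",
        THEN conjunct2, THEN conjunct2])
    show "eventually (\<lambda>(i, q). norm (c i / sqrt (real (max i q)))
        \<le> (if i = 0 then c 0 else c i / sqrt (real i))) (at_top \<times>\<^sub>F sequentially)"
    proof -
      have "eventually (\<lambda>(i, q). i \<ge> (1 :: nat)) (at_top \<times>\<^sub>F sequentially)"
        using eventually_prod1[of sequentially "\<lambda>i. i \<ge> (1 :: nat)" at_top]
        by (simp add: eventually_ge_at_top)
      then show ?thesis
      proof eventually_elim
        case (elim x)
        then show ?case using tau_term_le[of "fst x" "snd x"] c_pos[of "fst x"]
          by (auto simp: case_prod_beta abs_of_pos)
      qed
    qed
    show "summable (\<lambda>i. if i = 0 then c 0 else c i / sqrt (real i))"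
    proof -
      have "\<forall>\<^sub>F i in sequentially. (if i = 0 then c 0 else c i / sqrt (real i)) = c i / sqrt (real i)"
        using eventually_gt_at_top[of "0::nat"] by eventually_elim auto
      from summable_cong[OF this] show ?thesis using c_summable by simp
    qed
  qed (use lim in auto)
  then show ?thesis unfolding tau_def using tendsto_mult_left[of _ 0 sequentially 4] by fastforce
qed

text \<open>Exchange the sums over levels and over \<open>i\<close>; the inner sum over levels is
  then the geometric tail of \<open>sum_dyadic_tail_le\<close>.\<close>

lemma sum_csum_le_tau:
  assumes "q \<ge> 1"
  shows "(\<Sum>t\<le>r. csum (q * 2 ^ t) / sqrt (real (q * 2 ^ t))) \<le> tau q"
proof -
  have q: "q \<le> q * 2 ^ t" for t :: nat by simp
  have "(\<Sum>t\<le>r. csum (q * 2 ^ t) / sqrt (real (q * 2 ^ t)))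
      = (\<Sum>t\<le>r. \<Sum>i\<in>{1..q * 2 ^ r}. c i *
          (if real (max i q) \<le> real (q * 2 ^ t) then 1 / sqrt (real (q * 2 ^ t)) else 0))"
  proof (rule sum.cong[OF refl])
    fix t assume t: "t \<in> {..r}"
    then have "q * 2 ^ t \<le> q * 2 ^ r" by (intro mult_left_mono power_increasing) auto
    moreover have "A \<le> B \<Longrightarrow> {1..A} = {i\<in>{1..B}. i \<le> A}" for A B :: nat by auto
    ultimately have "{1..q * 2 ^ t} = {i\<in>{1..q * 2 ^ r}. i \<le> q * 2 ^ t}" by blast
    then have "csum (q * 2 ^ t) / sqrt (real (q * 2 ^ t))
        = (\<Sum>i\<in>{1..q * 2 ^ r}. if i \<le> q * 2 ^ t then c i / sqrt (real (q * 2 ^ t)) else 0)"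
      unfolding csum_def sum_divide_distrib by (simp only: sum.inter_filter finite_atLeastAtMost)
    then show "csum (q * 2 ^ t) / sqrt (real (q * 2 ^ t)) = (\<Sum>i\<in>{1..q * 2 ^ r}. c i *
          (if real (max i q) \<le> real (q * 2 ^ t) then 1 / sqrt (real (q * 2 ^ t)) else 0))"
      using q[of t] by (auto intro!: sum.cong simp del: of_nat_mult of_nat_power)
  qed
  also have "\<dots> = (\<Sum>i\<in>{1..q * 2 ^ r}. c i *
      (\<Sum>t\<le>r. if real (max i q) \<le> real (q * 2 ^ t) then 1 / sqrt (real (q * 2 ^ t)) else 0))"
    unfolding sum_distrib_left by (rule sum.swap)
  also have "\<dots> \<le> (\<Sum>i\<in>{1..q * 2 ^ r}. c i * (4 / sqrt (real (max i q))))"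
    using assms c_pos by (intro sum_mono mult_left_mono sum_dyadic_tail_le) (auto intro: less_imp_le)
  also have "\<dots> = 4 * (\<Sum>i\<in>{1..q * 2 ^ r}. c i / sqrt (real (max i q)))"
    by (simp add: sum_distrib_left mult_ac)
  also have "\<dots> \<le> tau q"
    unfolding tau_def using c_pos
    by (intro mult_left_mono sum_le_suminf[OF tau_summable])
      (auto intro!: divide_nonneg_nonneg intro: less_imp_le)
  finally show ?thesis .
qed

lemma csum_le_tau: "q \<ge> 1 \<Longrightarrow> csum q \<le> sqrt (real q) * tau q"
  using sum_csum_le_tau[of q 0] by (simp add: divide_simps mult_ac split: if_splits)

lemma tau_pos: "q \<ge> 1 \<Longrightarrow> tau q > 0"
  using csum_pos[of q] csum_le_tau[of q] tau_nonneg[of q] by (cases "tau q = 0") auto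

text \<open>An arbitrary number of blocks is reduced to a power of two by setting the process to zero
  after the last block, which preserves all hypotheses.\<close>

lemma subgauss_block_drift:
  assumes "q \<ge> 1" "k \<ge> 1"
  shows "subgauss a (3 * sqrt (real (q * k)) * tau q) (\<lambda>\<omega>. \<Sum>j<k. block_drift X (a + q * j) q \<omega>)"
proof -
  define X' where "X' i \<omega> = (if i \<le> a + q * k then X i \<omega> else 0)" for i \<omega>
  have cond0: "AE \<omega> in M. cond i (\<lambda>_. 0) \<omega> = 0" for i
    using cond_bound[of "\<lambda>_. 0" 0 i] by auto
  have X'_eq: "X' i = (if i \<le> a + q * k then X i else (\<lambda>_. 0))" for i unfolding X'_def by auto
  interpret X': short_memory_process M F X' b c
  proof unfold_locales
    show "X' n \<in> borel_measurable (F n)" for n unfolding X'_eq using X_adapted by auto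
    show "\<bar>X' n \<omega>\<bar> \<le> b" for n \<omega> unfolding X'_def using X_bounded b_nonneg by auto
    show "AE \<omega> in M. \<bar>cond a (X' (a + n)) \<omega>\<bar> \<le> c n" if "n \<ge> 1" for a n
      using cond_decay[OF that, of a] cond0[of a]
      unfolding X'_eq by eventually_elim (use c_pos[of n] in auto)
  qed (use c_pos c_summable in auto)
  obtain r where r: "k \<le> 2 ^ r" "2 ^ r \<le> 2 * k"
  proof -
    define r where "r = (LEAST r. k \<le> 2 ^ r)"
    have ex: "k \<le> 2 ^ k" by (simp add: less_imp_le)
    have 1: "k \<le> 2 ^ r" unfolding r_def using LeastI[of "\<lambda>r. k \<le> 2 ^ r" k] ex by simp
    have "2 ^ r \<le> 2 * k"
    proof (cases r)
      case (Suc r')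
      have "\<not> k \<le> 2 ^ r'" using not_less_Least[of r' "\<lambda>r. k \<le> 2 ^ r"] Suc r_def by auto
      then show ?thesis using Suc by simp
    qed (use assms in simp)
    with 1 show thesis using that by blast
  qed
  let ?S = "\<lambda>\<omega>. \<Sum>j<2 ^ r. block_drift X' (a + q * j) q \<omega>"
  have sg: "subgauss a (2 * sqrt (real (q * 2 ^ r)) * (\<Sum>t\<le>r. csum (q * 2 ^ t) / sqrt (real (q * 2 ^ t)))) ?S"
    by (rule X'.subgauss_dyadic[OF assms(1)])
  \<comment> \<open>Rounding \<open>k\<close> up to a power of two below 2 k enlarges the scale by
    at most sqrt 2, and 2 sqrt 2 <= 3.\<close>
  have "2 * sqrt (real (q * 2 ^ r)) * (\<Sum>t\<le>r. csum (q * 2 ^ t) / sqrt (real (q * 2 ^ t)))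
      \<le> (3 * sqrt (real (q * k))) * tau q"
  proof (rule mult_mono)
    have "real (q * 2 ^ r) \<le> real (q * (2 * k))" using r(2) by (intro of_nat_mono mult_left_mono) auto
    then have "sqrt (real (q * 2 ^ r)) \<le> sqrt (2 * real (q * k))"
      by (intro real_sqrt_le_mono) (simp add: mult_ac)
    moreover have "2 * sqrt 2 \<le> 3"
      by (rule power2_le_imp_le) (auto simp: power_mult_distrib)
    ultimately show "2 * sqrt (real (q * 2 ^ r)) \<le> 3 * sqrt (real (q * k))"
      using mult_right_mono[of "2 * sqrt 2" 3 "sqrt (real (q * k))"] by (simp add: real_sqrt_mult)
  qed (use sum_csum_le_tau[OF assms(1)] csum_nonneg tau_nonneg in \<open>auto intro!: sum_nonneg\<close>)
  then have sgS: "subgauss a (3 * sqrt (real (q * k)) * tau q) ?S"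
    by (intro subgauss_mono[OF sg]) (auto intro!: mult_nonneg_nonneg sum_nonneg divide_nonneg_nonneg csum_nonneg)
  have AES: "AE \<omega> in M. ?S \<omega> = (\<Sum>j<k. block_drift X (a + q * j) q \<omega>)"
  proof -
    have inside: "block_drift X' (a + q * j) q = block_drift X (a + q * j) q" if "j < k" for j
    proof -
      have "q * j + q \<le> q * k" using that by (metis Suc_leI mult_Suc_right add.commute mult_le_mono2)
      then have "block X' (a + q * j) q = block X (a + q * j) q"
        unfolding block_def X'_def by (intro ext sum.cong) auto
      then show ?thesis unfolding block_drift_def by simp
    qed
    have outside: "AE \<omega> in M. block_drift X' (a + q * j) q \<omega> = 0" if "k \<le> j" for j
    proof -
      have "q * k \<le> q * j" using that by simp
      then have "\<not> i \<le> a + q * k" if "i \<in> {a + q * j + 1..a + q * j + q}" for i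
        using that unfolding atLeastAtMost_iff by linarith
      then have "block X' (a + q * j) q = (\<lambda>_. 0)"
        unfolding block_def X'_def by (intro ext sum.neutral) simp
      then show ?thesis unfolding block_drift_def using cond0 by simp
    qed
    have "AE \<omega> in M. \<forall>j\<in>{k..<2 ^ r}. block_drift X' (a + q * j) q \<omega> = 0"
      by (rule AE_finite_allI) (use outside in auto)
    then show ?thesis
    proof eventually_elim
      fix \<omega> assume 0: "\<forall>j\<in>{k..<2 ^ r}. block_drift X' (a + q * j) q \<omega> = 0"
      have "?S \<omega> = (\<Sum>j<k. block_drift X' (a + q * j) q \<omega>) + (\<Sum>j\<in>{k..<2 ^ r}. block_drift X' (a + q * j) q \<omega>)"
        using sum.atLeastLessThan_concat[of 0 k "2 ^ r" "\<lambda>j. block_drift X' (a + q * j) q \<omega>"] r(1)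
        by (simp add: atLeast0LessThan)
      then show "?S \<omega> = (\<Sum>j<k. block_drift X (a + q * j) q \<omega>)"
        using 0 inside by simp
    qed
  qed
  show ?thesis
    by (rule subgauss_cong[OF sgS _ _ AES]) (auto intro: X'.block_drift_LinfM block_drift_LinfM)
qed

definition fluct :: "nat \<Rightarrow> nat \<Rightarrow> 'a \<Rightarrow> real" where
  "fluct a q \<omega> = block X a q \<omega> - block_drift X a q \<omega>"

lemma fluct_Linf: "a + q \<le> i \<Longrightarrow> fluct a q \<in> Linf (F i)"
  unfolding fluct_def
  by (intro Linf_diff block_Linf Linf_filtration_mono[OF _ block_drift_Linf]) auto

lemma fluct_LinfM: "fluct a q \<in> Linf M"
  using fluct_Linf Linf_filtration by blast

lemma fluct_bound: "AE \<omega> in M. \<bar>fluct a q \<omega>\<bar> \<le> 2 * b * real q"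
proof -
  have "AE \<omega> in M. \<bar>block_drift X a q \<omega>\<bar> \<le> b * real q"
    unfolding block_drift_def by (rule cond_bound[OF block_LinfM]) (simp add: block_bound)
  then show ?thesis
    unfolding fluct_def
  proof eventually_elim
    fix \<omega> assume "\<bar>block_drift X a q \<omega>\<bar> \<le> b * real q"
    then show "\<bar>block X a q \<omega> - block_drift X a q \<omega>\<bar> \<le> 2 * b * real q"
      using block_bound[of a q \<omega>] by linarith
  qed
qed

lemma fluct_mean_zero: "Z \<in> Linf (F a) \<Longrightarrow> (\<integral>\<omega>. Z \<omega> * fluct a q \<omega> \<partial>M) = 0"
  unfolding fluct_def right_diff_distrib
  using cond_integral[of Z a "block X a q", OF _ block_LinfM] Linf_filtration block_LinfM block_drift_LinfM
  by (subst Bochner_Integration.integral_diff) (auto simp: block_drift_def intro!: Linf_integrable cond_LinfM)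

text \<open>Pythagoras: the drift is the projection of the block onto the past, so subtracting it
  removes exactly its own second moment. That moment is at most \<open>csum q\<close> squared, hence
  at most q * tau(q)^2.\<close>

lemma fluct_square:
  assumes Z: "Z \<in> weights a" and q: "q \<ge> 1"
  shows "(\<integral>\<omega>. Z \<omega> * (fluct a q \<omega>)\<^sup>2 \<partial>M) \<le> (\<integral>\<omega>. Z \<omega> * (block X a q \<omega>)\<^sup>2 \<partial>M)" (is ?upper)
    and "(\<integral>\<omega>. Z \<omega> * (block X a q \<omega>)\<^sup>2 \<partial>M) - real q * (tau q)\<^sup>2 * (\<integral>\<omega>. Z \<omega> \<partial>M)
      \<le> (\<integral>\<omega>. Z \<omega> * (fluct a q \<omega>)\<^sup>2 \<partial>M)" (is ?lower)
proof -
  let ?U = "block_drift X a q" and ?S = "block X a q"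
  have LU: "?U \<in> Linf M" and LS: "?S \<in> Linf M" and LZ: "Z \<in> Linf M"
    using block_drift_LinfM block_LinfM weights_LinfM[OF Z] by auto
  have ZU: "(\<lambda>\<omega>. Z \<omega> * ?U \<omega>) \<in> Linf (F a)"
    using weights_Linf[OF Z] block_drift_Linf by auto
  have USint: "(\<integral>\<omega>. Z \<omega> * (?U \<omega> * ?S \<omega>) \<partial>M) = (\<integral>\<omega>. Z \<omega> * (?U \<omega>)\<^sup>2 \<partial>M)"
    using cond_integral[OF ZU LS] by (simp add: block_drift_def power2_eq_square mult_ac)
  have "(\<integral>\<omega>. Z \<omega> * (fluct a q \<omega>)\<^sup>2 \<partial>M)
      = (\<integral>\<omega>. Z \<omega> * ((?S \<omega>)\<^sup>2 - (2 * (?U \<omega> * ?S \<omega>) - (?U \<omega>)\<^sup>2)) \<partial>M)"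
    unfolding fluct_def by (simp add: power2_diff algebra_simps)
  also have "\<dots> = (\<integral>\<omega>. Z \<omega> * (?S \<omega>)\<^sup>2 \<partial>M) - (\<integral>\<omega>. Z \<omega> * (2 * (?U \<omega> * ?S \<omega>) - (?U \<omega>)\<^sup>2) \<partial>M)"
    by (rule weight_integral_diff[OF Z]) (use LU LS in auto)
  also have "(\<integral>\<omega>. Z \<omega> * (2 * (?U \<omega> * ?S \<omega>) - (?U \<omega>)\<^sup>2) \<partial>M)
      = (\<integral>\<omega>. Z \<omega> * (2 * (?U \<omega> * ?S \<omega>)) \<partial>M) - (\<integral>\<omega>. Z \<omega> * (?U \<omega>)\<^sup>2 \<partial>M)"
    by (rule weight_integral_diff[OF Z]) (use LU LS in auto)
  also have "(\<integral>\<omega>. Z \<omega> * (2 * (?U \<omega> * ?S \<omega>)) \<partial>M) = 2 * (\<integral>\<omega>. Z \<omega> * (?U \<omega> * ?S \<omega>) \<partial>M)"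
    by (rule weight_integral_cmult)
  finally have eq: "(\<integral>\<omega>. Z \<omega> * (fluct a q \<omega>)\<^sup>2 \<partial>M)
      = (\<integral>\<omega>. Z \<omega> * (?S \<omega>)\<^sup>2 \<partial>M) - (\<integral>\<omega>. Z \<omega> * (?U \<omega>)\<^sup>2 \<partial>M)"
    unfolding USint by simp
  have "0 \<le> (\<integral>\<omega>. Z \<omega> * (?U \<omega>)\<^sup>2 \<partial>M)"
    using weights_nonneg[OF Z] by (intro integral_nonneg_AE) (auto elim!: eventually_mono)
  then show ?upper using eq by simp
  have "AE \<omega> in M. \<bar>(?U \<omega>)\<^sup>2\<bar> \<le> real q * (tau q)\<^sup>2"
    using block_drift_bound[of a q]
  proof eventually_elim
    fix \<omega> assume "\<bar>?U \<omega>\<bar> \<le> csum q"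
    then have "\<bar>?U \<omega>\<bar> \<le> sqrt (real q) * tau q" using csum_le_tau[OF q] by linarith
    then have "\<bar>?U \<omega>\<bar>\<^sup>2 \<le> (sqrt (real q) * tau q)\<^sup>2" by (intro power_mono) auto
    then show "\<bar>(?U \<omega>)\<^sup>2\<bar> \<le> real q * (tau q)\<^sup>2" by (simp add: power_mult_distrib)
  qed
  from weight_integral_bound[OF Z Linf_power2[OF LU] this]
  have "(\<integral>\<omega>. Z \<omega> * (?U \<omega>)\<^sup>2 \<partial>M) \<le> real q * (tau q)\<^sup>2 * (\<integral>\<omega>. Z \<omega> \<partial>M)" by simp
  then show ?lower using eq by simp
qed

text \<open>The weight times the earlier partial sum is known when the next block starts, so every
  cross term vanishes. This product may change sign, which is why \<open>fluct_mean_zero\<close> is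
  stated for \<open>Linf\<close> and not for weights.\<close>

lemma fluct_orthogonal:
  assumes Z: "Z \<in> weights a"
  shows "(\<integral>\<omega>. Z \<omega> * (\<Sum>j<k. fluct (a + q * j) q \<omega>)\<^sup>2 \<partial>M)
    = (\<Sum>j<k. \<integral>\<omega>. Z \<omega> * (fluct (a + q * j) q \<omega>)\<^sup>2 \<partial>M)"
proof (induction k)
  case (Suc k)
  let ?A = "\<lambda>\<omega>. \<Sum>j<k. fluct (a + q * j) q \<omega>" and ?D = "fluct (a + q * k) q"
  have AF: "?A \<in> Linf (F (a + q * k))"
  proof (rule Linf_sum)
    fix j assume "j \<in> {..<k}"
    then have "q * j + q \<le> q * k" by (metis Suc_leI mult_Suc_right add.commute mult_le_mono2 lessThan_iff)
    then show "fluct (a + q * j) q \<in> Linf (F (a + q * k))" by (intro fluct_Linf) simp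
  qed
  then have LA: "?A \<in> Linf M" by (rule Linf_filtration)
  have LD: "?D \<in> Linf M" by (rule fluct_LinfM)
  have ZA: "(\<lambda>\<omega>. Z \<omega> * ?A \<omega>) \<in> Linf (F (a + q * k))"
    using Linf_filtration_mono[OF _ weights_Linf[OF Z], of "a + q * k"] AF by (intro Linf_mult) auto
  have cross: "(\<integral>\<omega>. Z \<omega> * (?A \<omega> * ?D \<omega>) \<partial>M) = 0"
    using fluct_mean_zero[OF ZA, of q] by (simp add: mult_ac)
  have "(\<integral>\<omega>. Z \<omega> * (\<Sum>j<Suc k. fluct (a + q * j) q \<omega>)\<^sup>2 \<partial>M)
      = (\<integral>\<omega>. Z \<omega> * ((?A \<omega>)\<^sup>2 + ((?D \<omega>)\<^sup>2 + 2 * (?A \<omega> * ?D \<omega>))) \<partial>M)"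
    by (simp add: power2_sum algebra_simps)
  also have "\<dots> = (\<integral>\<omega>. Z \<omega> * (?A \<omega>)\<^sup>2 \<partial>M)
      + (\<integral>\<omega>. Z \<omega> * ((?D \<omega>)\<^sup>2 + 2 * (?A \<omega> * ?D \<omega>)) \<partial>M)"
    by (rule weight_integral_add[OF Z])
      (rule Linf_power2 Linf_add Linf_mult Linf_const LA LD)+
  also have "(\<integral>\<omega>. Z \<omega> * ((?D \<omega>)\<^sup>2 + 2 * (?A \<omega> * ?D \<omega>)) \<partial>M)
      = (\<integral>\<omega>. Z \<omega> * (?D \<omega>)\<^sup>2 \<partial>M) + (\<integral>\<omega>. Z \<omega> * (2 * (?A \<omega> * ?D \<omega>)) \<partial>M)"
    by (rule weight_integral_add[OF Z])
      (rule Linf_power2 Linf_mult Linf_const LA LD)+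
  also have "(\<integral>\<omega>. Z \<omega> * (2 * (?A \<omega> * ?D \<omega>)) \<partial>M) = 2 * (\<integral>\<omega>. Z \<omega> * (?A \<omega> * ?D \<omega>) \<partial>M)"
    by (rule weight_integral_cmult)
  finally show ?case using Suc cross by simp
qed simp

end

section \<open>Conditional variance of long blocks\<close>

lemma Cesaro_mean_tendsto:
  fixes s :: "nat \<Rightarrow> real"
  assumes "s \<longlonglongrightarrow> L"
  shows "(\<lambda>n. (\<Sum>i<n. s i) / real n) \<longlonglongrightarrow> L"
proof (rule LIMSEQ_I)
  fix r :: real assume r: "r > 0"
  obtain N where N: "\<And>i. i \<ge> N \<Longrightarrow> \<bar>s i - L\<bar> < r / 2"
    using LIMSEQ_D[OF assms, of "r / 2"] r by auto
  define C where "C = (\<Sum>i<N. \<bar>s i - L\<bar>)"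
  obtain N' :: nat where N': "real N' > 2 * C / r" using reals_Archimedean2 by blast
  have "norm ((\<Sum>i<n. s i) / real n - L) < r" if n: "n \<ge> max (max N N') 1" for n
  proof -
    have "\<bar>(\<Sum>i<n. s i - L)\<bar> \<le> (\<Sum>i<n. \<bar>s i - L\<bar>)" by (rule sum_abs)
    also have "(\<Sum>i<n. \<bar>s i - L\<bar>) = C + (\<Sum>i\<in>{N..<n}. \<bar>s i - L\<bar>)"
      using sum.atLeastLessThan_concat[of 0 N n "\<lambda>i. \<bar>s i - L\<bar>"] n
      by (simp add: C_def atLeast0LessThan)
    also have "(\<Sum>i\<in>{N..<n}. \<bar>s i - L\<bar>) \<le> (\<Sum>i\<in>{N..<n}. r / 2)"
      using N by (intro sum_mono less_imp_le) auto
    also have "\<dots> \<le> real n * (r / 2)" using r by simp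
    also have "C < real n * (r / 2)"
    proof -
      have "2 * C / r < real n" using N' n by linarith
      then show ?thesis using r by (simp add: field_simps)
    qed
    finally have "\<bar>(\<Sum>i<n. s i) - real n * L\<bar> < real n * r"
      by (simp add: sum_subtractf mult.commute)
    moreover have "(\<Sum>i<n. s i) / real n - L = ((\<Sum>i<n. s i) - real n * L) / real n"
      using n by (simp add: field_simps)
    ultimately show ?thesis using n by (simp add: abs_div divide_less_eq mult.commute)
  qed
  then show "\<exists>no. \<forall>n\<ge>no. norm ((\<Sum>i<n. s i) / real n - L) < r" by blast
qed

text \<open>The limit in \<open>cov_limit\<close> is uniform in the past \<open>a\<close>, but it
  has no rate and its threshold may depend on the lag \<open>l\<close>. It can therefore be invoked
  only for finitely many lags at once.\<close>

locale covariance_process = short_memory_process +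
  fixes \<gamma> :: "nat \<Rightarrow> real"
  assumes cov_limit: "\<eta> > 0 \<Longrightarrow> \<exists>i0. \<forall>i\<ge>i0. \<forall>a. AE \<omega> in M.
      \<bar>cond a (\<lambda>\<omega>. X (a + i) \<omega> * X (a + i + l) \<omega>) \<omega> - \<gamma> l\<bar> \<le> \<eta>"
    and cov_summable: "summable \<gamma>"
    and variance_pos: "\<gamma> 0 + 2 * (\<Sum>l. \<gamma> (Suc l)) > 0"
begin

definition sigma2 :: real where "sigma2 = \<gamma> 0 + 2 * (\<Sum>l. \<gamma> (Suc l))"

text \<open>The second moment of a block of length \<open>q\<close> in the stationary regime. The
  difference of maximum and minimum is the distance of the indices; truncated subtraction of the two
  naturals would not be symmetric.\<close>

definition bcov :: "nat \<Rightarrow> real" where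
  "bcov q = (\<Sum>i\<in>{1..q}. \<Sum>l\<in>{1..q}. \<gamma> (max i l - min i l))"

lemma sigma2_pos: "sigma2 > 0"
  unfolding sigma2_def by (rule variance_pos)

lemma bcov_Suc: "bcov (Suc q) = bcov q + (\<gamma> 0 + 2 * (\<Sum>l<q. \<gamma> (Suc l)))"
proof -
  have "(\<Sum>l\<in>{1..q}. \<gamma> (Suc q - l)) = (\<Sum>l<q. \<gamma> (Suc l))"
    by (rule sum.reindex_bij_witness[where i = "\<lambda>l. q - l" and j = "\<lambda>l. q - l"])
      (auto simp: Suc_diff_le)
  moreover have "{1..Suc q} = insert (Suc q) {1..q}" by auto
  moreover have "(\<Sum>l\<in>{1..q}. \<gamma> (max (Suc q) l - min (Suc q) l)) = (\<Sum>l\<in>{1..q}. \<gamma> (Suc q - l))"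
      "(\<Sum>l\<in>{1..q}. \<gamma> (max l (Suc q) - min l (Suc q))) = (\<Sum>l\<in>{1..q}. \<gamma> (Suc q - l))"
    by (auto intro!: sum.cong simp: max_def min_def)
  ultimately show ?thesis
    unfolding bcov_def by (simp add: sum.distrib)
qed

text \<open>The increments of \<open>bcov\<close> are the partial sums of the series for
  \<open>sigma2\<close>, so \<open>bcov q / q\<close> is their Cesaro mean.\<close>

lemma bcov_tendsto: "(\<lambda>q. bcov q / real q) \<longlonglongrightarrow> sigma2"
proof -
  have "bcov q = (\<Sum>i<q. \<gamma> 0 + 2 * (\<Sum>l<i. \<gamma> (Suc l)))" for q
    by (induction q) (simp_all add: bcov_Suc, simp add: bcov_def)
  moreover have "(\<lambda>i. \<Sum>l<i. \<gamma> (Suc l)) \<longlonglongrightarrow> (\<Sum>l. \<gamma> (Suc l))"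
    using cov_summable summable_LIMSEQ[of "\<lambda>l. \<gamma> (Suc l)"] summable_Suc_iff[of \<gamma>] by simp
  then have "(\<lambda>i. \<gamma> 0 + 2 * (\<Sum>l<i. \<gamma> (Suc l))) \<longlonglongrightarrow> sigma2"
    unfolding sigma2_def by (intro tendsto_intros)
  ultimately show ?thesis using Cesaro_mean_tendsto by simp
qed

text \<open>Expanding the square of a block of fixed length leaves q^2 products with lags at most
  \<open>q\<close>, so finitely many uses of \<open>cov_limit\<close> suffice.\<close>

lemma block_square_limit:
  assumes "\<eta> > 0"
  shows "\<exists>i0. \<forall>i\<ge>i0. \<forall>a. \<forall>Z\<in>weights a.
    \<bar>(\<integral>\<omega>. Z \<omega> * (block X (a + i) q \<omega>)\<^sup>2 \<partial>M) - bcov q * (\<integral>\<omega>. Z \<omega> \<partial>M)\<bar> \<le> \<eta> * (\<integral>\<omega>. Z \<omega> \<partial>M)"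
proof -
  \<comment> \<open>An equal share of the error for each of the q^2 pairs; the 1 keeps the
    denominator positive for \<open>q = 0\<close>.\<close>
  define \<eta>' where "\<eta>' = \<eta> / (real q * real q + 1)"
  have \<eta>': "\<eta>' > 0" using assms by (auto simp: \<eta>'_def intro!: divide_pos_pos add_nonneg_pos)
  have \<eta>'_le: "real q * real q * \<eta>' \<le> \<eta>"
    using assms by (simp add: \<eta>'_def divide_simps add_nonneg_pos)
  \<comment> \<open>One threshold per lag. The sum of these thresholds over all lags up to
    \<open>q\<close> serves below as a common one.\<close>
  obtain N where N: "\<And>l i a. i \<ge> N l \<Longrightarrow> AE \<omega> in M.
      \<bar>cond a (\<lambda>\<omega>. X (a + i) \<omega> * X (a + i + l) \<omega>) \<omega> - \<gamma> l\<bar> \<le> \<eta>'"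
    using cov_limit[OF \<eta>'] by metis
  have "\<bar>(\<integral>\<omega>. Z \<omega> * (block X (a + i) q \<omega>)\<^sup>2 \<partial>M) - bcov q * (\<integral>\<omega>. Z \<omega> \<partial>M)\<bar> \<le> \<eta> * (\<integral>\<omega>. Z \<omega> \<partial>M)"
    if i: "i \<ge> (\<Sum>l\<le>q. N l)" and Z: "Z \<in> weights a" for i a Z
  proof -
    let ?I = "\<integral>\<omega>. Z \<omega> \<partial>M"
    have pair: "\<bar>(\<integral>\<omega>. Z \<omega> * (X (a + p) \<omega> * X (a + p + d) \<omega>) \<partial>M) - \<gamma> d * ?I\<bar> \<le> \<eta>' * ?I"
      if "p \<ge> i" "d \<le> q" for p d
    proof -
      let ?XX = "\<lambda>\<omega>. X (a + p) \<omega> * X (a + p + d) \<omega>"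
      have L: "?XX \<in> Linf M" using X_LinfM by auto
      have "N d \<le> (\<Sum>l\<le>q. N l)" using that(2) by (intro member_le_sum) auto
      then have "AE \<omega> in M. \<bar>cond a ?XX \<omega> - \<gamma> d\<bar> \<le> \<eta>'" using N[of d p a] that i by simp
      then have "\<bar>\<integral>\<omega>. Z \<omega> * (cond a ?XX \<omega> - \<gamma> d) \<partial>M\<bar> \<le> \<eta>' * ?I"
        using cond_LinfM[OF L] by (intro weight_integral_bound[OF Z]) auto
      also have "(\<integral>\<omega>. Z \<omega> * (cond a ?XX \<omega> - \<gamma> d) \<partial>M) = (\<integral>\<omega>. Z \<omega> * ?XX \<omega> \<partial>M) - \<gamma> d * ?I"
        using weight_integral_diff[OF Z cond_LinfM[OF L] Linf_const]
          cond_integral[OF weights_Linf[OF Z] L] by (simp add: mult.commute)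
      finally show ?thesis .
    qed
    have pair': "\<bar>(\<integral>\<omega>. Z \<omega> * (X (a + i + u) \<omega> * X (a + i + v) \<omega>) \<partial>M) - \<gamma> (max u v - min u v) * ?I\<bar> \<le> \<eta>' * ?I"
      if "u \<in> {1..q}" "v \<in> {1..q}" for u v
    proof (cases "u \<le> v")
      case True
      then have "a + (i + u) + (v - u) = a + i + v" "max u v - min u v = v - u" "v - u \<le> q"
        using that by auto
      then show ?thesis using pair[of "i + u" "v - u"] that by (simp add: add.assoc)
    next
      case False
      then have "a + (i + v) + (u - v) = a + i + u" "max u v - min u v = u - v" "u - v \<le> q"
        using that by auto
      moreover have "(\<integral>\<omega>. Z \<omega> * (X (a + i + u) \<omega> * X (a + i + v) \<omega>) \<partial>M)
          = (\<integral>\<omega>. Z \<omega> * (X (a + i + v) \<omega> * X (a + i + u) \<omega>) \<partial>M)"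
        by (simp only: mult.commute)
      ultimately show ?thesis using pair[of "i + v" "u - v"] by (simp add: add.assoc)
    qed
    have blk: "block X (a + i) q \<omega> = (\<Sum>u\<in>{1..q}. X (a + i + u) \<omega>)" for \<omega>
      unfolding block_def using sum.shift_bounds_cl_nat_ivl[of "\<lambda>j. X j \<omega>" 1 "a + i" q]
      by (simp add: add.commute)
    have "(\<integral>\<omega>. Z \<omega> * (block X (a + i) q \<omega>)\<^sup>2 \<partial>M)
        = (\<integral>\<omega>. Z \<omega> * (\<Sum>u\<in>{1..q}. \<Sum>v\<in>{1..q}. X (a + i + u) \<omega> * X (a + i + v) \<omega>) \<partial>M)"
      unfolding blk power2_eq_square sum_product ..
    also have "\<dots> = (\<Sum>u\<in>{1..q}. \<integral>\<omega>. Z \<omega> * (\<Sum>v\<in>{1..q}. X (a + i + u) \<omega> * X (a + i + v) \<omega>) \<partial>M)"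
      by (rule weight_integral_sum[OF Z]) (auto intro: X_LinfM)
    also have "\<dots> = (\<Sum>u\<in>{1..q}. \<Sum>v\<in>{1..q}. \<integral>\<omega>. Z \<omega> * (X (a + i + u) \<omega> * X (a + i + v) \<omega>) \<partial>M)"
      by (intro sum.cong refl weight_integral_sum[OF Z]) (auto intro: X_LinfM)
    finally have "\<bar>(\<integral>\<omega>. Z \<omega> * (block X (a + i) q \<omega>)\<^sup>2 \<partial>M) - bcov q * ?I\<bar>
        = \<bar>\<Sum>u\<in>{1..q}. \<Sum>v\<in>{1..q}. (\<integral>\<omega>. Z \<omega> * (X (a + i + u) \<omega> * X (a + i + v) \<omega>) \<partial>M)
            - \<gamma> (max u v - min u v) * ?I\<bar>"
      unfolding bcov_def sum_distrib_right sum_subtractf by simp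
    also have "\<dots> \<le> (\<Sum>u\<in>{1..q}. \<Sum>v\<in>{1..q}. \<eta>' * ?I)"
      by (intro order_trans[OF sum_abs] sum_mono pair')
    also have "\<dots> = (real q * real q * \<eta>') * ?I" by simp
    also have "\<dots> \<le> \<eta> * ?I" using \<eta>'_le weights_integral_nonneg[OF Z] by (rule mult_right_mono)
    finally show ?thesis .
  qed
  then show ?thesis by blast
qed

lemma block_split: "block X a (q * k) \<omega> = (\<Sum>j<k. block X (a + q * j) q \<omega>)"
proof (induction k)
  case (Suc k)
  have "{a + 1..a + q * Suc k} = {a + 1..a + q * k} \<union> {a + q * k + 1..a + q * k + q}" by auto
  then have "block X a (q * Suc k) \<omega> = block X a (q * k) \<omega> + block X (a + q * k) q \<omega>"
    unfolding block_def by (simp add: sum.union_disjoint)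
  then show ?case using Suc by simp
qed (simp add: block_def)

lemma block_append: "block X a (p + r) \<omega> = block X a p \<omega> + block X (a + p) r \<omega>"
proof -
  have "{a + 1..a + (p + r)} = {a + 1..a + p} \<union> {a + p + 1..a + p + r}" by auto
  then show ?thesis unfolding block_def by (simp add: sum.union_disjoint)
qed

text \<open>Young's inequality 2 x y <= d x^2 + y^2 / d, in both directions. A perturbation whose
  second moment is of order d^2 thus changes the second moment only by order
  \<open>d\<close>.\<close>

lemma weight_square_add:
  assumes Z: "Z \<in> weights a" and L: "A \<in> Linf M" "A' \<in> Linf M" and d: "d > 0"
  shows "(\<integral>\<omega>. Z \<omega> * (A \<omega> + A' \<omega>)\<^sup>2 \<partial>M)
      \<le> (1 + d) * (\<integral>\<omega>. Z \<omega> * (A \<omega>)\<^sup>2 \<partial>M) + (1 + 1 / d) * (\<integral>\<omega>. Z \<omega> * (A' \<omega>)\<^sup>2 \<partial>M)"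
    and "(1 - d) * (\<integral>\<omega>. Z \<omega> * (A \<omega>)\<^sup>2 \<partial>M) - 1 / d * (\<integral>\<omega>. Z \<omega> * (A' \<omega>)\<^sup>2 \<partial>M)
      \<le> (\<integral>\<omega>. Z \<omega> * (A \<omega> + A' \<omega>)\<^sup>2 \<partial>M)"
proof -
  have L2: "(\<lambda>\<omega>. (A \<omega>)\<^sup>2) \<in> Linf M" "(\<lambda>\<omega>. (A' \<omega>)\<^sup>2) \<in> Linf M" "(\<lambda>\<omega>. (A \<omega> + A' \<omega>)\<^sup>2) \<in> Linf M"
    using L by auto
  have sq: "2 * x * y \<le> d * x\<^sup>2 + 1 / d * y\<^sup>2" "- (2 * x * y) \<le> d * x\<^sup>2 + 1 / d * y\<^sup>2" for x y :: real
  proof -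
    have "0 \<le> (d * x - y)\<^sup>2 / d" "0 \<le> (d * x + y)\<^sup>2 / d" using d by auto
    moreover have "(d * x - y)\<^sup>2 / d = d * x\<^sup>2 + 1 / d * y\<^sup>2 - 2 * x * y"
      "(d * x + y)\<^sup>2 / d = d * x\<^sup>2 + 1 / d * y\<^sup>2 + 2 * x * y"
      using d by (auto simp: power2_eq_square field_simps)
    ultimately show "2 * x * y \<le> d * x\<^sup>2 + 1 / d * y\<^sup>2" "- (2 * x * y) \<le> d * x\<^sup>2 + 1 / d * y\<^sup>2"
      by linarith+
  qed
  have "(\<integral>\<omega>. Z \<omega> * (A \<omega> + A' \<omega>)\<^sup>2 \<partial>M) \<le> (\<integral>\<omega>. Z \<omega> * ((1 + d) * (A \<omega>)\<^sup>2 + (1 + 1 / d) * (A' \<omega>)\<^sup>2) \<partial>M)"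
  proof (rule weight_integral_mono[OF Z])
    show "AE \<omega> in M. (A \<omega> + A' \<omega>)\<^sup>2 \<le> (1 + d) * (A \<omega>)\<^sup>2 + (1 + 1 / d) * (A' \<omega>)\<^sup>2"
    proof (rule AE_I2)
      fix \<omega>
      show "(A \<omega> + A' \<omega>)\<^sup>2 \<le> (1 + d) * (A \<omega>)\<^sup>2 + (1 + 1 / d) * (A' \<omega>)\<^sup>2"
        using sq(1)[of "A \<omega>" "A' \<omega>"] unfolding power2_sum distrib_right by linarith
    qed
  qed (use L2 in auto)
  also have "\<dots> = (\<integral>\<omega>. Z \<omega> * ((1 + d) * (A \<omega>)\<^sup>2) \<partial>M) + (\<integral>\<omega>. Z \<omega> * ((1 + 1 / d) * (A' \<omega>)\<^sup>2) \<partial>M)"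
    using L2 by (intro weight_integral_add[OF Z]) auto
  finally show "(\<integral>\<omega>. Z \<omega> * (A \<omega> + A' \<omega>)\<^sup>2 \<partial>M)
      \<le> (1 + d) * (\<integral>\<omega>. Z \<omega> * (A \<omega>)\<^sup>2 \<partial>M) + (1 + 1 / d) * (\<integral>\<omega>. Z \<omega> * (A' \<omega>)\<^sup>2 \<partial>M)"
    unfolding weight_integral_cmult .
  have "(\<integral>\<omega>. Z \<omega> * ((1 - d) * (A \<omega>)\<^sup>2) \<partial>M) - (\<integral>\<omega>. Z \<omega> * (1 / d * (A' \<omega>)\<^sup>2) \<partial>M)
      = (\<integral>\<omega>. Z \<omega> * ((1 - d) * (A \<omega>)\<^sup>2 - 1 / d * (A' \<omega>)\<^sup>2) \<partial>M)"
    using L2 by (intro weight_integral_diff[OF Z, symmetric]) auto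
  also have "\<dots> \<le> (\<integral>\<omega>. Z \<omega> * (A \<omega> + A' \<omega>)\<^sup>2 \<partial>M)"
  proof (rule weight_integral_mono[OF Z])
    show "AE \<omega> in M. (1 - d) * (A \<omega>)\<^sup>2 - 1 / d * (A' \<omega>)\<^sup>2 \<le> (A \<omega> + A' \<omega>)\<^sup>2"
    proof (rule AE_I2)
      fix \<omega>
      show "(1 - d) * (A \<omega>)\<^sup>2 - 1 / d * (A' \<omega>)\<^sup>2 \<le> (A \<omega> + A' \<omega>)\<^sup>2"
        using sq(2)[of "A \<omega>" "A' \<omega>"] zero_le_power2[of "A' \<omega>"]
        unfolding power2_sum left_diff_distrib by linarith
    qed
  qed (use L2 in auto)
  finally show "(1 - d) * (\<integral>\<omega>. Z \<omega> * (A \<omega>)\<^sup>2 \<partial>M) - 1 / d * (\<integral>\<omega>. Z \<omega> * (A' \<omega>)\<^sup>2 \<partial>M)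
      \<le> (\<integral>\<omega>. Z \<omega> * (A \<omega> + A' \<omega>)\<^sup>2 \<partial>M)"
    unfolding weight_integral_cmult .
qed

text \<open>The block of length \<open>m\<close> is cut into blocks of fixed length \<open>q\<close>, only finitely many of which
  see the initial condition.\<close>

lemma block_square_bounds:
  assumes q: "q \<ge> 1" and m: "m \<ge> q"
    and d: "0 < d" "d \<le> 1"
    and bc: "\<bar>bcov q / real q - sigma2\<bar> \<le> d" and tq: "tau q \<le> d"
    and i0: "\<forall>i\<ge>i0. \<forall>a. \<forall>Z\<in>weights a.
      \<bar>(\<integral>\<omega>. Z \<omega> * (block X (a + i) q \<omega>)\<^sup>2 \<partial>M) - bcov q * (\<integral>\<omega>. Z \<omega> \<partial>M)\<bar> \<le> d * (\<integral>\<omega>. Z \<omega> \<partial>M)"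
    and m1: "2 * (b * real q)\<^sup>2 \<le> d\<^sup>2 * real m"
    and m2: "real i0 * ((b * real q)\<^sup>2 + \<bar>bcov q\<bar>) \<le> d * real m"
    and m3: "real q * sigma2 \<le> d * real m"
    and Z: "Z \<in> weights a"
  shows "\<bar>(\<integral>\<omega>. Z \<omega> * (block X a m \<omega>)\<^sup>2 \<partial>M) - real m * sigma2 * (\<integral>\<omega>. Z \<omega> \<partial>M)\<bar>
      \<le> d * (sigma2 + 1400) * real m * (\<integral>\<omega>. Z \<omega> \<partial>M)"
proof -
  define k where "k = m div q"
  \<comment> \<open>Crude error bound for a short block that starts before the threshold
    \<open>i0\<close>. There are at most \<open>i0\<close> such blocks, whatever \<open>m\<close>
    is.\<close>
  define C0 where "C0 = (b * real q)\<^sup>2 + \<bar>bcov q\<bar>"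
  define I where "I = (\<integral>\<omega>. Z \<omega> \<partial>M)"
  have I: "I \<ge> 0" unfolding I_def by (rule weights_integral_nonneg[OF Z])
  have k: "k \<ge> 1" unfolding k_def using m q by (simp add: div_greater_zero_iff Suc_le_eq)
  have C0: "C0 \<ge> 0" unfolding C0_def by simp
  have kq: "q * k \<le> m" "m < q * k + q"
    using mult_div_mod_eq[of q m] mod_less_divisor[of q m] q unfolding k_def by linarith+
  have kqr: "real q * real k \<le> real m" "real m \<le> real q * real k + real q"
    using kq unfolding of_nat_mult[symmetric] of_nat_add[symmetric] of_nat_le_iff by auto
  have km: "real k \<le> real m"
    using kqr(1) q mult_right_mono[of 1 "real q" "real k"] by simp
  have block_int: "\<bar>(\<integral>\<omega>. Z \<omega> * (block X (a + q * j) q \<omega>)\<^sup>2 \<partial>M) - bcov q * I\<bar>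
      \<le> (d + (if j < i0 then C0 else 0)) * I" for j
  proof (cases "j < i0")
    case False
    then have "q * j \<ge> i0" using q by (metis le_trans linorder_not_less mult_le_mono1 nat_mult_1)
    then show ?thesis using i0 Z False unfolding I_def by auto
  next
    case True
    have "(block X (a + q * j) q \<omega>)\<^sup>2 \<le> (b * real q)\<^sup>2" for \<omega>
      using block_bound[of "a + q * j" q \<omega>] by (metis abs_ge_zero power2_abs power_mono)
    then have "\<bar>\<integral>\<omega>. Z \<omega> * (block X (a + q * j) q \<omega>)\<^sup>2 \<partial>M\<bar> \<le> (b * real q)\<^sup>2 * I"
      unfolding I_def by (intro weight_integral_bound[OF Z] Linf_power2 block_LinfM) auto
    moreover have "\<bar>bcov q * I\<bar> = \<bar>bcov q\<bar> * I" using I by (simp add: abs_mult)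
    moreover have "0 \<le> d * I" using d I by simp
    ultimately show ?thesis using True unfolding C0_def by (simp add: distrib_right)
  qed
  have sumC0: "(\<Sum>j<k. d + (if j < i0 then C0 else 0)) \<le> real k * d + real i0 * C0"
  proof -
    have "(\<Sum>j<k. if j < i0 then C0 else 0) = (\<Sum>j\<in>{j\<in>{..<k}. j < i0}. C0)"
      by (rule sum.inter_filter[symmetric]) simp
    also have "\<dots> \<le> (\<Sum>j\<in>{..<i0}. C0)" using C0 by (intro sum_mono2) auto
    finally show ?thesis by (simp add: sum.distrib)
  qed
  define T where "T = (\<integral>\<omega>. Z \<omega> * (\<Sum>j<k. fluct (a + q * j) q \<omega>)\<^sup>2 \<partial>M)"
  define S where "S = (\<Sum>j<k. \<integral>\<omega>. Z \<omega> * (block X (a + q * j) q \<omega>)\<^sup>2 \<partial>M)"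
  have S: "\<bar>S - real k * bcov q * I\<bar> \<le> 2 * d * real m * I"
  proof -
    have "\<bar>S - real k * bcov q * I\<bar>
        = \<bar>\<Sum>j<k. (\<integral>\<omega>. Z \<omega> * (block X (a + q * j) q \<omega>)\<^sup>2 \<partial>M) - bcov q * I\<bar>"
      unfolding S_def sum_subtractf by simp
    also have "\<dots> \<le> (\<Sum>j<k. (d + (if j < i0 then C0 else 0)) * I)"
      by (intro order_trans[OF sum_abs] sum_mono block_int)
    also have "\<dots> = (\<Sum>j<k. d + (if j < i0 then C0 else 0)) * I"
      by (rule sum_distrib_right[symmetric])
    also have "\<dots> \<le> (2 * d * real m) * I"
    proof (rule mult_right_mono[OF _ I])
      have "real k * d \<le> d * real m" using km d by simp
      then show "(\<Sum>j<k. d + (if j < i0 then C0 else 0)) \<le> 2 * d * real m"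
        using sumC0 m2 unfolding C0_def by linarith
    qed
    finally show ?thesis .
  qed
  have bq: "\<bar>bcov q - real q * sigma2\<bar> \<le> real q * d"
  proof -
    have "bcov q - real q * sigma2 = real q * (bcov q / real q - sigma2)"
      using q by (simp add: field_simps)
    then show ?thesis using bc by (simp add: abs_mult mult_left_mono)
  qed
  have kb: "\<bar>real k * bcov q - real m * sigma2\<bar> \<le> 2 * d * real m"
  proof -
    have "\<bar>real k * (bcov q - real q * sigma2)\<bar> \<le> real k * (real q * d)"
      unfolding abs_mult using bq by (intro mult_mono) auto
    also have "\<dots> \<le> real m * d" using kqr(1) d mult_right_mono[of "real q * real k" "real m" d] by (simp add: mult_ac)
    finally have 1: "\<bar>real k * bcov q - real k * (real q * sigma2)\<bar> \<le> real m * d"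
      by (simp add: right_diff_distrib)
    have "real k * (real q * sigma2) \<le> real m * sigma2"
      using mult_right_mono[OF kqr(1), of sigma2] sigma2_pos by (simp add: mult_ac)
    moreover have "real m * sigma2 \<le> real k * (real q * sigma2) + real q * sigma2"
      using mult_right_mono[OF kqr(2), of sigma2] sigma2_pos by (simp add: algebra_simps)
    moreover have "0 \<le> d * real m" using d by simp
    ultimately have 2: "\<bar>real k * (real q * sigma2) - real m * sigma2\<bar> \<le> d * real m"
      using m3 by (intro abs_leI) simp_all
    show ?thesis using 1 2 mult.commute[of d "real m"] by linarith
  qed
  have SI: "\<bar>S - real m * sigma2 * I\<bar> \<le> 4 * d * real m * I"
  proof -
    have "\<bar>real k * bcov q * I - real m * sigma2 * I\<bar> = \<bar>real k * bcov q - real m * sigma2\<bar> * I"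
      using I by (simp add: abs_mult left_diff_distrib[symmetric])
    also have "\<dots> \<le> 2 * d * real m * I" using kb I by (rule mult_right_mono)
    finally show ?thesis using S by linarith
  qed
  have tau2: "(tau q)\<^sup>2 \<le> d\<^sup>2" using tq tau_nonneg by (rule power_mono)
  have d2: "d\<^sup>2 \<le> d" using d by (simp add: power2_eq_square mult_left_le)
  have T_up: "T \<le> S"
    unfolding T_def S_def fluct_orthogonal[OF Z]
    by (intro sum_mono fluct_square(1) q weights_mono[OF _ Z]) auto
  have T_lo: "S - d * real m * I \<le> T"
  proof -
    have "S - (\<Sum>j<k. real q * (tau q)\<^sup>2 * I) \<le> T"
      unfolding T_def S_def fluct_orthogonal[OF Z] sum_subtractf[symmetric] I_def
      by (intro sum_mono fluct_square(2) q weights_mono[OF _ Z]) auto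
    moreover have "(\<Sum>j<k. real q * (tau q)\<^sup>2 * I) \<le> d * real m * I"
    proof -
      have "real q * real k * (tau q)\<^sup>2 \<le> real m * d"
        using kqr(1) tau2 d2 d by (intro mult_mono) auto
      then show ?thesis using I mult_right_mono[of "real q * real k * (tau q)\<^sup>2" "real m * d" I] by (simp add: mult_ac)
    qed
    ultimately show ?thesis by linarith
  qed
  define R where "R \<omega> = (\<Sum>j<k. block_drift X (a + q * j) q \<omega>)" for \<omega>
  define r where "r \<omega> = block X (a + q * k) (m - q * k) \<omega>" for \<omega>
  \<comment> \<open>Orthogonal fluctuations carry the variance; the sum \<open>R\<close> of the
    short drifts is small by the dyadic bound, and \<open>r\<close> is the incomplete last
    block.\<close>
  have decomp: "block X a m \<omega> = (\<Sum>j<k. fluct (a + q * j) q \<omega>) + (R \<omega> + r \<omega>)" for \<omega>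
    using block_append[of a "q * k" "m - q * k" \<omega>] kq(1)
    unfolding block_split r_def R_def fluct_def sum_subtractf by simp
  have LR: "R \<in> Linf M" unfolding R_def using block_drift_LinfM by auto
  have Lr: "r \<in> Linf M" unfolding r_def using block_LinfM by simp
  have LA: "(\<lambda>\<omega>. \<Sum>j<k. fluct (a + q * j) q \<omega>) \<in> Linf M" using fluct_LinfM by auto
  have R2: "(\<integral>\<omega>. Z \<omega> * (R \<omega>)\<^sup>2 \<partial>M) \<le> 324 * d\<^sup>2 * real m * I"
  proof -
    have "(\<integral>\<omega>. Z \<omega> * (R \<omega>)\<^sup>2 \<partial>M) \<le> 36 * (3 * sqrt (real (q * k)) * tau q)\<^sup>2 * I"
      unfolding I_def R_def
      using subgauss_block_drift[OF q k, of a] LR q k tau_pos[OF q] Z unfolding R_def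
      by (intro subgauss_second_moment) auto
    also have "36 * (3 * sqrt (real (q * k)) * tau q)\<^sup>2 = 324 * ((real q * real k) * (tau q)\<^sup>2)"
      by (simp add: power_mult_distrib)
    also have "\<dots> \<le> 324 * (real m * d\<^sup>2)"
      using kqr(1) tau2 by (intro mult_left_mono mult_mono) auto
    finally have "(\<integral>\<omega>. Z \<omega> * (R \<omega>)\<^sup>2 \<partial>M) \<le> 324 * (real m * d\<^sup>2) * I"
      using I by (simp add: mult_right_mono)
    then show ?thesis by (simp only: mult_ac)
  qed
  have r2: "(\<integral>\<omega>. Z \<omega> * (r \<omega>)\<^sup>2 \<partial>M) \<le> (b * real q)\<^sup>2 * I"
  proof -
    have "\<bar>r \<omega>\<bar> \<le> b * real q" for \<omega>
    proof -
      have "\<bar>r \<omega>\<bar> \<le> b * real (m - q * k)" unfolding r_def by (rule block_bound)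
      also have "\<dots> \<le> b * real q" using kq b_nonneg by (intro mult_left_mono of_nat_mono) simp_all
      finally show ?thesis .
    qed
    then have "(r \<omega>)\<^sup>2 \<le> (b * real q)\<^sup>2" for \<omega> by (metis abs_ge_zero power2_abs power_mono)
    then have "\<bar>\<integral>\<omega>. Z \<omega> * (r \<omega>)\<^sup>2 \<partial>M\<bar> \<le> (b * real q)\<^sup>2 * I"
      unfolding I_def using Lr by (intro weight_integral_bound[OF Z]) auto
    then show ?thesis by simp
  qed
  \<comment> \<open>Here 324 = 36 * 3^2 joins the second-moment constant with the scale of
    \<open>subgauss_block_drift\<close>, and 649 = 2 * 324 + 1, the last unit paying for the
    incomplete block through \<open>m1\<close>.\<close>
  have Rr: "(\<integral>\<omega>. Z \<omega> * (R \<omega> + r \<omega>)\<^sup>2 \<partial>M) \<le> 649 * d\<^sup>2 * real m * I"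
  proof -
    have "(\<integral>\<omega>. Z \<omega> * (R \<omega> + r \<omega>)\<^sup>2 \<partial>M) \<le> 2 * (\<integral>\<omega>. Z \<omega> * (R \<omega>)\<^sup>2 \<partial>M) + 2 * (\<integral>\<omega>. Z \<omega> * (r \<omega>)\<^sup>2 \<partial>M)"
      using weight_square_add(1)[OF Z LR Lr, of 1] by simp
    moreover have "2 * (b * real q)\<^sup>2 * I \<le> d\<^sup>2 * real m * I" using m1 I by (rule mult_right_mono)
    ultimately show ?thesis using R2 r2 by linarith
  qed
  have "1 / d * (649 * d\<^sup>2 * real m * I) = 649 * d * real m * I"
    using d by (simp add: power2_eq_square)
  then have Rd: "1 / d * (\<integral>\<omega>. Z \<omega> * (R \<omega> + r \<omega>)\<^sup>2 \<partial>M) \<le> 649 * d * real m * I"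
    using Rr d mult_left_mono[OF Rr, of "1 / d"] by simp
  have mI: "0 \<le> real m * I" using I by simp
  have dd: "d\<^sup>2 * (real m * I) \<le> d * (real m * I)" using d2 mI by (rule mult_right_mono)
  have expand: "(1 + d) * (real m * sigma2 * I + 4 * d * real m * I)
      = real m * sigma2 * I + 4 * d * (real m * I) + d * sigma2 * (real m * I) + 4 * (d\<^sup>2 * (real m * I))"
    by (simp add: algebra_simps power2_eq_square)
  have "(\<integral>\<omega>. Z \<omega> * (block X a m \<omega>)\<^sup>2 \<partial>M) \<le> (1 + d) * T + (1 + 1 / d) * (\<integral>\<omega>. Z \<omega> * (R \<omega> + r \<omega>)\<^sup>2 \<partial>M)"
    unfolding decomp T_def using LA LR Lr d by (intro weight_square_add(1)[OF Z]) auto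
  also have "(1 + d) * T \<le> (1 + d) * (real m * sigma2 * I + 4 * d * real m * I)"
    using T_up SI d by (intro mult_left_mono) (auto simp: abs_le_iff)
  also have "(1 + 1 / d) * (\<integral>\<omega>. Z \<omega> * (R \<omega> + r \<omega>)\<^sup>2 \<partial>M) \<le> 649 * (d\<^sup>2 * (real m * I)) + 649 * (d * (real m * I))"
    using Rr Rd by (simp add: distrib_right mult.assoc)
  finally have upper: "(\<integral>\<omega>. Z \<omega> * (block X a m \<omega>)\<^sup>2 \<partial>M)
      \<le> real m * sigma2 * I + (1306 * d * (real m * I) + d * sigma2 * (real m * I))"
    using dd unfolding expand by linarith
  have expand': "(1 - d) * (real m * sigma2 * I - 5 * d * real m * I)
      = real m * sigma2 * I - 5 * d * (real m * I) - d * sigma2 * (real m * I) + 5 * (d\<^sup>2 * (real m * I))"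
    by (simp add: algebra_simps power2_eq_square)
  have "(1 - d) * (real m * sigma2 * I - 5 * d * real m * I) \<le> (1 - d) * T"
    using T_lo SI d by (intro mult_left_mono) (auto simp: abs_le_iff)
  moreover have "(1 - d) * T - 1 / d * (\<integral>\<omega>. Z \<omega> * (R \<omega> + r \<omega>)\<^sup>2 \<partial>M) \<le> (\<integral>\<omega>. Z \<omega> * (block X a m \<omega>)\<^sup>2 \<partial>M)"
    unfolding decomp T_def using LA LR Lr d by (intro weight_square_add(2)[OF Z]) auto
  moreover have "0 \<le> d\<^sup>2 * (real m * I)" using mI by simp
  ultimately have lower: "real m * sigma2 * I - (654 * d * (real m * I) + d * sigma2 * (real m * I))
      \<le> (\<integral>\<omega>. Z \<omega> * (block X a m \<omega>)\<^sup>2 \<partial>M)"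
    using Rd unfolding expand' by linarith
  \<comment> \<open>The upper error 1306 = 4 + 4 + 649 + 649 and the lower error 654 = 5 + 649 are
    both covered by 1400.\<close>
  have "0 \<le> d * (real m * I)" using d mI by simp
  moreover have "d * (sigma2 + 1400) * real m * I = d * sigma2 * (real m * I) + 1400 * (d * (real m * I))"
    by (simp add: algebra_simps)
  ultimately have "\<bar>(\<integral>\<omega>. Z \<omega> * (block X a m \<omega>)\<^sup>2 \<partial>M) - real m * sigma2 * I\<bar>
      \<le> d * (sigma2 + 1400) * real m * I"
    using upper lower unfolding abs_le_iff by linarith
  then show ?thesis unfolding I_def .
qed

text \<open>The order of choices matters: \<open>d\<close> from the required precision, then the
  short length \<open>q\<close> from \<open>d\<close>, then the threshold \<open>i0\<close> from
  \<open>q\<close>, and \<open>m\<close> last. All costs of \<open>q\<close> and \<open>i0\<close>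
  are then negligible against \<open>m\<close>.\<close>

proposition block_square_uniform:
  assumes "\<epsilon> > 0"
  shows "\<exists>m0. \<forall>m\<ge>m0. \<forall>a. \<forall>Z\<in>weights a.
    \<bar>(\<integral>\<omega>. Z \<omega> * (block X a m \<omega>)\<^sup>2 \<partial>M) - real m * sigma2 * (\<integral>\<omega>. Z \<omega> \<partial>M)\<bar> \<le> \<epsilon> * real m * (\<integral>\<omega>. Z \<omega> \<partial>M)"
proof -
  define d where "d = min 1 (\<epsilon> / (sigma2 + 1400))"
  have s: "sigma2 + 1400 > 0" using sigma2_pos by simp
  have d: "0 < d" "d \<le> 1" using assms s by (auto simp: d_def)
  have d\<epsilon>: "d * (sigma2 + 1400) \<le> \<epsilon>"
  proof -
    have "d * (sigma2 + 1400) \<le> \<epsilon> / (sigma2 + 1400) * (sigma2 + 1400)"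
      using s by (intro mult_right_mono) (auto simp: d_def)
    then show ?thesis using s by simp
  qed
  have "\<forall>\<^sub>F q in sequentially. \<bar>bcov q / real q - sigma2\<bar> < d"
    using tendstoD[OF bcov_tendsto d(1)] by (simp add: dist_real_def)
  moreover have "\<forall>\<^sub>F q in sequentially. tau q < d"
    using order_tendstoD(2)[OF tau_tendsto_0 d(1)] .
  ultimately have "\<forall>\<^sub>F q in sequentially. \<bar>bcov q / real q - sigma2\<bar> < d \<and> tau q < d \<and> q \<ge> 1"
    using eventually_ge_at_top[of 1] by eventually_elim auto
  then obtain q where q: "\<bar>bcov q / real q - sigma2\<bar> < d" "tau q < d" "q \<ge> 1"
    by (auto dest: eventually_happens)
  obtain i0 where i0: "\<forall>i\<ge>i0. \<forall>a. \<forall>Z\<in>weights a.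
      \<bar>(\<integral>\<omega>. Z \<omega> * (block X (a + i) q \<omega>)\<^sup>2 \<partial>M) - bcov q * (\<integral>\<omega>. Z \<omega> \<partial>M)\<bar> \<le> d * (\<integral>\<omega>. Z \<omega> \<partial>M)"
    using block_square_limit[OF d(1), of q] by blast
  have big: "\<forall>\<^sub>F m in sequentially. x \<le> y * real m" if "y > 0" for x y :: real
  proof -
    have "\<forall>\<^sub>F m in sequentially. x / y \<le> real m"
      using filterlim_real_sequentially unfolding filterlim_at_top by blast
    then show ?thesis by eventually_elim (use that in \<open>simp add: divide_le_eq mult.commute\<close>)
  qed
  have "\<forall>\<^sub>F m in sequentially. m \<ge> q \<and> 2 * (b * real q)\<^sup>2 \<le> d\<^sup>2 * real m
      \<and> real i0 * ((b * real q)\<^sup>2 + \<bar>bcov q\<bar>) \<le> d * real m \<and> real q * sigma2 \<le> d * real m"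
    using d by (intro eventually_conj big eventually_ge_at_top) auto
  then obtain m0 where m0: "\<And>m. m \<ge> m0 \<Longrightarrow> m \<ge> q \<and> 2 * (b * real q)\<^sup>2 \<le> d\<^sup>2 * real m
      \<and> real i0 * ((b * real q)\<^sup>2 + \<bar>bcov q\<bar>) \<le> d * real m \<and> real q * sigma2 \<le> d * real m"
    unfolding eventually_sequentially by blast
  show ?thesis
  proof (intro exI[of _ m0] allI impI ballI)
    fix m a Z assume m: "m \<ge> m0" and Z: "Z \<in> weights a"
    have "\<bar>(\<integral>\<omega>. Z \<omega> * (block X a m \<omega>)\<^sup>2 \<partial>M) - real m * sigma2 * (\<integral>\<omega>. Z \<omega> \<partial>M)\<bar>
        \<le> d * (sigma2 + 1400) * real m * (\<integral>\<omega>. Z \<omega> \<partial>M)"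
      using q d m0[OF m] by (intro block_square_bounds[OF _ _ _ _ _ _ i0 _ _ _ Z]) auto
    also have "\<dots> \<le> \<epsilon> * real m * (\<integral>\<omega>. Z \<omega> \<partial>M)"
      using d\<epsilon> weights_integral_nonneg[OF Z] by (intro mult_right_mono) auto
    finally show "\<bar>(\<integral>\<omega>. Z \<omega> * (block X a m \<omega>)\<^sup>2 \<partial>M) - real m * sigma2 * (\<integral>\<omega>. Z \<omega> \<partial>M)\<bar>
        \<le> \<epsilon> * real m * (\<integral>\<omega>. Z \<omega> \<partial>M)" .
  qed
qed

end

section \<open>Exponential moments of block sums\<close>

context covariance_process
begin

text \<open>Subtracting the drift changes the second moment by at most m * tau(m)^2, which is
  o(m).\<close>

lemma fluct_square_uniform:
  assumes "\<epsilon> > 0"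
  shows "\<exists>m0. \<forall>m\<ge>m0. \<forall>a. \<forall>Z\<in>weights a.
    \<bar>(\<integral>\<omega>. Z \<omega> * (fluct a m \<omega>)\<^sup>2 \<partial>M) - real m * sigma2 * (\<integral>\<omega>. Z \<omega> \<partial>M)\<bar> \<le> \<epsilon> * real m * (\<integral>\<omega>. Z \<omega> \<partial>M)"
proof -
  obtain m0 where m0: "\<forall>m\<ge>m0. \<forall>a. \<forall>Z\<in>weights a.
    \<bar>(\<integral>\<omega>. Z \<omega> * (block X a m \<omega>)\<^sup>2 \<partial>M) - real m * sigma2 * (\<integral>\<omega>. Z \<omega> \<partial>M)\<bar> \<le> \<epsilon> / 2 * real m * (\<integral>\<omega>. Z \<omega> \<partial>M)"
    using block_square_uniform[of "\<epsilon> / 2"] assms by auto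
  have "(\<lambda>m. (tau m)\<^sup>2) \<longlonglongrightarrow> 0" using tendsto_power[OF tau_tendsto_0, of 2] by simp
  from order_tendstoD(2)[OF this, of "\<epsilon> / 2"]
  have "\<forall>\<^sub>F m in sequentially. (tau m)\<^sup>2 < \<epsilon> / 2" using assms by simp
  then obtain m1 where m1: "\<And>m. m \<ge> m1 \<Longrightarrow> (tau m)\<^sup>2 < \<epsilon> / 2" unfolding eventually_sequentially by blast
  have "\<bar>(\<integral>\<omega>. Z \<omega> * (fluct a m \<omega>)\<^sup>2 \<partial>M) - real m * sigma2 * (\<integral>\<omega>. Z \<omega> \<partial>M)\<bar> \<le> \<epsilon> * real m * (\<integral>\<omega>. Z \<omega> \<partial>M)"
    if m: "m \<ge> max (max m0 m1) 1" and Z: "Z \<in> weights a" for m a Z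
  proof -
    let ?I = "\<integral>\<omega>. Z \<omega> \<partial>M" and ?B = "\<integral>\<omega>. Z \<omega> * (block X a m \<omega>)\<^sup>2 \<partial>M"
    have b: "\<bar>?B - real m * sigma2 * ?I\<bar> \<le> \<epsilon> / 2 * real m * ?I" using m0 m Z by auto
    have I: "0 \<le> real m * ?I" using weights_integral_nonneg[OF Z] by simp
    have "real m * (tau m)\<^sup>2 * ?I = (tau m)\<^sup>2 * (real m * ?I)" by simp
    also have "\<dots> \<le> \<epsilon> / 2 * (real m * ?I)" using m1[of m] m by (intro mult_right_mono I) auto
    finally have t: "real m * (tau m)\<^sup>2 * ?I \<le> \<epsilon> / 2 * real m * ?I" by (simp add: mult.assoc)
    have "0 \<le> \<epsilon> / 2 * real m * ?I" using I assms by (simp add: mult.assoc)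
    moreover have "\<epsilon> * real m * ?I = \<epsilon> / 2 * real m * ?I + \<epsilon> / 2 * real m * ?I" by simp
    ultimately show ?thesis
      using fluct_square[OF Z, of m] m b t by (intro abs_leI) linarith+
  qed
  then show ?thesis by blast
qed

text \<open>The linear term has conditional mean zero, and since the exponent is at most \<eta> in
  absolute value, the cubic remainder is at most the fraction \<eta> of the quadratic term. The
  lower bound is left as 1 + y, because 1 + y <= exp y points the wrong way there.\<close>

lemma fluct_exp_step:
  assumes var: "\<bar>(\<integral>\<omega>. Z \<omega> * (fluct a m \<omega>)\<^sup>2 \<partial>M) - real m * sigma2 * (\<integral>\<omega>. Z \<omega> \<partial>M)\<bar> \<le> \<epsilon> * real m * (\<integral>\<omega>. Z \<omega> \<partial>M)"
    and small: "2 * b * real m * \<bar>t\<bar> \<le> \<eta>" "\<eta> \<le> 1" and Z: "Z \<in> weights a"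
  shows "(\<integral>\<omega>. Z \<omega> * exp (t * fluct a m \<omega>) \<partial>M)
      \<le> exp (t\<^sup>2 * real m * (sigma2 + \<epsilon>) * (1 + \<eta>) / 2) * (\<integral>\<omega>. Z \<omega> \<partial>M)" (is ?upper)
    and "(1 + t\<^sup>2 * real m * (sigma2 - \<epsilon>) * (1 - \<eta>) / 2) * (\<integral>\<omega>. Z \<omega> \<partial>M)
      \<le> (\<integral>\<omega>. Z \<omega> * exp (t * fluct a m \<omega>) \<partial>M)" (is ?lower)
proof -
  let ?I = "\<integral>\<omega>. Z \<omega> \<partial>M" and ?D = "fluct a m" and ?V = "\<integral>\<omega>. Z \<omega> * (fluct a m \<omega>)\<^sup>2 \<partial>M"
  have LD: "?D \<in> Linf M" by (rule fluct_LinfM)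
  have I: "?I \<ge> 0" by (rule weights_integral_nonneg[OF Z])
  have \<eta>: "\<eta> \<ge> 0" using small(1) b_nonneg
    by (meson abs_ge_zero mult_nonneg_nonneg of_nat_0_le_iff order_trans zero_le_numeral)
  have taylor: "\<bar>exp (t * x) - (1 + t * x + t\<^sup>2 * x\<^sup>2 / 2)\<bar> \<le> \<eta> * (t\<^sup>2 * x\<^sup>2 / 2)"
    if "\<bar>x\<bar> \<le> 2 * b * real m" for x
  proof -
    have "\<bar>t * x\<bar> = \<bar>x\<bar> * \<bar>t\<bar>" by (simp add: abs_mult)
    also have "\<dots> \<le> 2 * b * real m * \<bar>t\<bar>" using that by (intro mult_right_mono) auto
    finally have tx: "\<bar>t * x\<bar> \<le> \<eta>" using small by linarith
    have "\<bar>t * x\<bar> ^ 3 = \<bar>t * x\<bar> * (t * x)\<^sup>2" by (simp add: power3_eq_cube power2_eq_square)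
    also have "\<dots> \<le> \<eta> * (t * x)\<^sup>2" using tx by (intro mult_right_mono) auto
    finally have "\<bar>t * x\<bar> ^ 3 / 2 \<le> \<eta> * (t\<^sup>2 * x\<^sup>2 / 2)" by (simp add: power_mult_distrib)
    then show ?thesis using exp_Taylor2[of "t * x"] tx small(2)
      by (simp only: power_mult_distrib) linarith
  qed
  have lin: "(\<integral>\<omega>. Z \<omega> * (1 + (t * ?D \<omega> + s * (?D \<omega>)\<^sup>2)) \<partial>M) = ?I + s * ?V" for s
  proof -
    have "(\<integral>\<omega>. Z \<omega> * (1 + (t * ?D \<omega> + s * (?D \<omega>)\<^sup>2)) \<partial>M)
        = (\<integral>\<omega>. Z \<omega> * 1 \<partial>M) + (\<integral>\<omega>. Z \<omega> * (t * ?D \<omega> + s * (?D \<omega>)\<^sup>2) \<partial>M)"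
      by (rule weight_integral_add[OF Z]) (use LD in auto)
    also have "(\<integral>\<omega>. Z \<omega> * (t * ?D \<omega> + s * (?D \<omega>)\<^sup>2) \<partial>M)
        = (\<integral>\<omega>. Z \<omega> * (t * ?D \<omega>) \<partial>M) + (\<integral>\<omega>. Z \<omega> * (s * (?D \<omega>)\<^sup>2) \<partial>M)"
      by (rule weight_integral_add[OF Z]) (use LD in auto)
    finally show ?thesis
      using fluct_mean_zero[OF weights_Linf[OF Z], of m] by (simp add: weight_integral_cmult)
  qed
  have "(\<integral>\<omega>. Z \<omega> * exp (t * ?D \<omega>) \<partial>M)
      \<le> (\<integral>\<omega>. Z \<omega> * (1 + (t * ?D \<omega> + (t\<^sup>2 * (1 + \<eta>) / 2) * (?D \<omega>)\<^sup>2)) \<partial>M)"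
  proof (rule weight_integral_mono[OF Z])
    show "AE \<omega> in M. exp (t * ?D \<omega>) \<le> 1 + (t * ?D \<omega> + (t\<^sup>2 * (1 + \<eta>) / 2) * (?D \<omega>)\<^sup>2)"
      using fluct_bound[of a m]
    proof eventually_elim
      fix \<omega> assume "\<bar>?D \<omega>\<bar> \<le> 2 * b * real m"
      from taylor[OF this] show "exp (t * ?D \<omega>) \<le> 1 + (t * ?D \<omega> + (t\<^sup>2 * (1 + \<eta>) / 2) * (?D \<omega>)\<^sup>2)"
        by (simp add: field_simps)
    qed
  qed (use LD in auto)
  also have "\<dots> = ?I + (t\<^sup>2 * (1 + \<eta>) / 2) * ?V" by (rule lin)
  also have "\<dots> \<le> ?I + (t\<^sup>2 * (1 + \<eta>) / 2) * (real m * (sigma2 + \<epsilon>) * ?I)"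
    using var \<eta> by (intro add_left_mono mult_left_mono) (auto simp: abs_le_iff algebra_simps)
  also have "\<dots> = (1 + t\<^sup>2 * real m * (sigma2 + \<epsilon>) * (1 + \<eta>) / 2) * ?I" by (simp add: field_simps)
  also have "\<dots> \<le> exp (t\<^sup>2 * real m * (sigma2 + \<epsilon>) * (1 + \<eta>) / 2) * ?I"
    using I by (intro mult_right_mono exp_ge_add_one_self)
  finally show ?upper .
  have V: "real m * (sigma2 - \<epsilon>) * ?I \<le> ?V" using var by (simp add: abs_le_iff algebra_simps)
  have c: "0 \<le> t\<^sup>2 * (1 - \<eta>) / 2" using small(2) by simp
  have "(1 + t\<^sup>2 * real m * (sigma2 - \<epsilon>) * (1 - \<eta>) / 2) * ?I
      = ?I + (t\<^sup>2 * (1 - \<eta>) / 2) * (real m * (sigma2 - \<epsilon>) * ?I)" by (simp add: field_simps)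
  also have "\<dots> \<le> ?I + (t\<^sup>2 * (1 - \<eta>) / 2) * ?V"
    by (intro add_left_mono mult_left_mono V c)
  also have "\<dots> = (\<integral>\<omega>. Z \<omega> * (1 + (t * ?D \<omega> + (t\<^sup>2 * (1 - \<eta>) / 2) * (?D \<omega>)\<^sup>2)) \<partial>M)"
    by (rule lin[symmetric])
  also have "\<dots> \<le> (\<integral>\<omega>. Z \<omega> * exp (t * ?D \<omega>) \<partial>M)"
  proof (rule weight_integral_mono[OF Z])
    show "AE \<omega> in M. 1 + (t * ?D \<omega> + (t\<^sup>2 * (1 - \<eta>) / 2) * (?D \<omega>)\<^sup>2) \<le> exp (t * ?D \<omega>)"
      using fluct_bound[of a m]
    proof eventually_elim
      fix \<omega> assume "\<bar>?D \<omega>\<bar> \<le> 2 * b * real m"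
      from taylor[OF this] show "1 + (t * ?D \<omega> + (t\<^sup>2 * (1 - \<eta>) / 2) * (?D \<omega>)\<^sup>2) \<le> exp (t * ?D \<omega>)"
        by (simp add: field_simps)
    qed
  qed (use LD in auto)
  finally show ?lower .
qed

text \<open>Iterates the one-step bounds along blocks, starting from the weight 1. The condition on
  \<epsilon> keeps the factor of the lower iteration non-negative.\<close>

lemma fluct_sum_laplace:
  assumes var: "\<And>a Z. Z \<in> weights a \<Longrightarrow>
      \<bar>(\<integral>\<omega>. Z \<omega> * (fluct a m \<omega>)\<^sup>2 \<partial>M) - real m * sigma2 * (\<integral>\<omega>. Z \<omega> \<partial>M)\<bar> \<le> \<epsilon> * real m * (\<integral>\<omega>. Z \<omega> \<partial>M)"
    and small: "2 * b * real m * \<bar>t\<bar> \<le> \<eta>" "\<eta> \<le> 1" and "\<epsilon> \<le> sigma2"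
  shows "(\<integral>\<omega>. exp (t * (\<Sum>j<k. fluct (m * j) m \<omega>)) \<partial>M)
      \<le> exp (t\<^sup>2 * real m * (sigma2 + \<epsilon>) * (1 + \<eta>) / 2) ^ k"
    and "(1 + t\<^sup>2 * real m * (sigma2 - \<epsilon>) * (1 - \<eta>) / 2) ^ k
      \<le> (\<integral>\<omega>. exp (t * (\<Sum>j<k. fluct (m * j) m \<omega>)) \<partial>M)"
proof -
  have L: "(\<lambda>\<omega>. t * fluct (m * j) m \<omega>) \<in> Linf (F (m * Suc j))" for j
    using fluct_Linf[of "m * j" m "m * Suc j"] by auto
  note step = fluct_exp_step[OF var small]
  have "(\<integral>\<omega>. 1 * exp (\<Sum>j<k. t * fluct (m * j) m \<omega>) \<partial>M)
      \<le> exp (t\<^sup>2 * real m * (sigma2 + \<epsilon>) * (1 + \<eta>) / 2) ^ k * (\<integral>\<omega>. 1 \<partial>M)"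
    by (rule weight_exp_sum_le[where g = "\<lambda>j. m * j"]) (use L step weights_one in auto)
  then show "(\<integral>\<omega>. exp (t * (\<Sum>j<k. fluct (m * j) m \<omega>)) \<partial>M)
      \<le> exp (t\<^sup>2 * real m * (sigma2 + \<epsilon>) * (1 + \<eta>) / 2) ^ k"
    by (simp add: sum_distrib_left prob_space)
  have "0 \<le> t\<^sup>2 * real m * (sigma2 - \<epsilon>) * (1 - \<eta>) / 2" using assms(3,4) small by simp
  then have "(1 + t\<^sup>2 * real m * (sigma2 - \<epsilon>) * (1 - \<eta>) / 2) ^ k * (\<integral>\<omega>. 1 \<partial>M)
      \<le> (\<integral>\<omega>. 1 * exp (\<Sum>j<k. t * fluct (m * j) m \<omega>) \<partial>M)"
    by (intro weight_exp_sum_ge[where g = "\<lambda>j. m * j"]) (use L step weights_one in auto)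
  then show "(1 + t\<^sup>2 * real m * (sigma2 - \<epsilon>) * (1 - \<eta>) / 2) ^ k
      \<le> (\<integral>\<omega>. exp (t * (\<Sum>j<k. fluct (m * j) m \<omega>)) \<partial>M)"
    by (simp add: sum_distrib_left prob_space)
qed

text \<open>For squares the first-order term already carries the answer: with y = t S^2 between 0
  and \<eta>, the second-order correction y^2 is at most \<eta> y. The negative tilt is needed for
  the lower tail of the sum of squares.\<close>

lemma block_square_exp_step:
  assumes var: "\<bar>(\<integral>\<omega>. Z \<omega> * (block X a m \<omega>)\<^sup>2 \<partial>M) - real m * sigma2 * (\<integral>\<omega>. Z \<omega> \<partial>M)\<bar> \<le> \<epsilon> * real m * (\<integral>\<omega>. Z \<omega> \<partial>M)"
    and t: "t \<ge> 0" and small: "t * (b * real m)\<^sup>2 \<le> \<eta>" "\<eta> \<le> 1" and Z: "Z \<in> weights a"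
  shows "(\<integral>\<omega>. Z \<omega> * exp (t * (block X a m \<omega>)\<^sup>2) \<partial>M)
      \<le> exp (t * real m * (sigma2 + \<epsilon>) * (1 + \<eta>)) * (\<integral>\<omega>. Z \<omega> \<partial>M)" (is ?upper)
    and "(\<integral>\<omega>. Z \<omega> * exp (- t * (block X a m \<omega>)\<^sup>2) \<partial>M)
      \<le> exp (- (t * real m * (sigma2 - \<epsilon>) * (1 - \<eta>))) * (\<integral>\<omega>. Z \<omega> \<partial>M)" (is ?lower)
proof -
  let ?I = "\<integral>\<omega>. Z \<omega> \<partial>M" and ?S = "block X a m" and ?V = "\<integral>\<omega>. Z \<omega> * (block X a m \<omega>)\<^sup>2 \<partial>M"
  have LS: "?S \<in> Linf M" by (rule block_LinfM)
  have I: "?I \<ge> 0" by (rule weights_integral_nonneg[OF Z])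
  have "0 \<le> t * (b * real m)\<^sup>2" using t by simp
  then have \<eta>: "\<eta> \<ge> 0" using small(1) by linarith
  have x: "0 \<le> t * (?S \<omega>)\<^sup>2" "t * (?S \<omega>)\<^sup>2 \<le> \<eta>" for \<omega>
  proof -
    have "(?S \<omega>)\<^sup>2 \<le> (b * real m)\<^sup>2"
      using block_bound[of a m \<omega>] by (metis abs_ge_zero power2_abs power_mono)
    then have "t * (?S \<omega>)\<^sup>2 \<le> t * (b * real m)\<^sup>2" using t by (rule mult_left_mono)
    then show "t * (?S \<omega>)\<^sup>2 \<le> \<eta>" using small(1) by linarith
  qed (use t in simp)
  have up: "exp y \<le> 1 + (1 + \<eta>) * y" and lo: "exp (- y) \<le> 1 - (1 - \<eta>) * y"
    if y: "0 \<le> y" "y \<le> \<eta>" for y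
  proof -
    have y2: "y\<^sup>2 \<le> \<eta> * y" unfolding power2_eq_square using y by (intro mult_right_mono)
    have "exp y \<le> 1 + y + y\<^sup>2" using y small(2) by (intro exp_bound) auto
    then show "exp y \<le> 1 + (1 + \<eta>) * y" using y2 by (simp add: algebra_simps)
    have "\<bar>-y\<bar> ^ 3 \<le> y\<^sup>2"
      using y small(2) mult_left_mono[of y 1 "y\<^sup>2"] by (simp add: power2_eq_square power3_eq_cube)
    then have "exp (- y) \<le> 1 - y + y\<^sup>2"
      using exp_Taylor2[of "- y"] y small(2) by (simp only: power2_minus) linarith
    then show "exp (- y) \<le> 1 - (1 - \<eta>) * y" using y2 by (simp add: algebra_simps)
  qed
  have lin: "(\<integral>\<omega>. Z \<omega> * (1 + s * (?S \<omega>)\<^sup>2) \<partial>M) = ?I + s * ?V" for s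
  proof -
    have "(\<lambda>\<omega>. s * (?S \<omega>)\<^sup>2) \<in> Linf M" using LS by auto
    from weight_integral_add[OF Z Linf_const[of 1] this] show ?thesis
      by (simp add: weight_integral_cmult)
  qed
  have "(\<integral>\<omega>. Z \<omega> * exp (t * (?S \<omega>)\<^sup>2) \<partial>M) \<le> (\<integral>\<omega>. Z \<omega> * (1 + ((1 + \<eta>) * t) * (?S \<omega>)\<^sup>2) \<partial>M)"
    using LS up[OF x] by (intro weight_integral_mono[OF Z]) (auto simp: mult.assoc)
  also have "\<dots> = ?I + ((1 + \<eta>) * t) * ?V" by (rule lin)
  also have "\<dots> \<le> ?I + ((1 + \<eta>) * t) * (real m * (sigma2 + \<epsilon>) * ?I)"
    using var \<eta> t by (intro add_left_mono mult_left_mono) (auto simp: abs_le_iff algebra_simps)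
  also have "\<dots> = (1 + t * real m * (sigma2 + \<epsilon>) * (1 + \<eta>)) * ?I" by (simp add: algebra_simps)
  also have "\<dots> \<le> exp (t * real m * (sigma2 + \<epsilon>) * (1 + \<eta>)) * ?I"
    using I by (intro mult_right_mono exp_ge_add_one_self)
  finally show ?upper .
  have V: "real m * (sigma2 - \<epsilon>) * ?I \<le> ?V" using var by (simp add: abs_le_iff algebra_simps)
  have c: "0 \<le> (1 - \<eta>) * t" using small(2) t by simp
  have "(\<integral>\<omega>. Z \<omega> * exp (- t * (?S \<omega>)\<^sup>2) \<partial>M) \<le> (\<integral>\<omega>. Z \<omega> * (1 + (- ((1 - \<eta>) * t)) * (?S \<omega>)\<^sup>2) \<partial>M)"
    using LS lo[OF x] by (intro weight_integral_mono[OF Z]) (auto simp: mult.assoc)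
  also have "\<dots> = ?I + (- ((1 - \<eta>) * t)) * ?V" by (rule lin)
  also have "\<dots> = ?I - ((1 - \<eta>) * t) * ?V" by simp
  also have "\<dots> \<le> ?I - ((1 - \<eta>) * t) * (real m * (sigma2 - \<epsilon>) * ?I)"
    by (intro diff_left_mono mult_left_mono V c)
  also have "\<dots> = (1 + - (t * real m * (sigma2 - \<epsilon>) * (1 - \<eta>))) * ?I" by (simp add: algebra_simps)
  also have "\<dots> \<le> exp (- (t * real m * (sigma2 - \<epsilon>) * (1 - \<eta>))) * ?I"
    using I by (intro mult_right_mono exp_ge_add_one_self)
  finally show ?lower .
qed

lemma block_square_sum_laplace:
  assumes var: "\<And>a Z. Z \<in> weights a \<Longrightarrow>
      \<bar>(\<integral>\<omega>. Z \<omega> * (block X a m \<omega>)\<^sup>2 \<partial>M) - real m * sigma2 * (\<integral>\<omega>. Z \<omega> \<partial>M)\<bar> \<le> \<epsilon> * real m * (\<integral>\<omega>. Z \<omega> \<partial>M)"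
    and t: "t \<ge> 0" and small: "t * (b * real m)\<^sup>2 \<le> \<eta>" "\<eta> \<le> 1"
  shows "(\<integral>\<omega>. exp (t * (\<Sum>j<k. (block X (m * j) m \<omega>)\<^sup>2)) \<partial>M)
      \<le> exp (t * real m * (sigma2 + \<epsilon>) * (1 + \<eta>)) ^ k"
    and "(\<integral>\<omega>. exp (- t * (\<Sum>j<k. (block X (m * j) m \<omega>)\<^sup>2)) \<partial>M)
      \<le> exp (- (t * real m * (sigma2 - \<epsilon>) * (1 - \<eta>))) ^ k"
proof -
  have L: "(\<lambda>\<omega>. s * (block X (m * j) m \<omega>)\<^sup>2) \<in> Linf (F (m * Suc j))" for j s
    using block_Linf[of "m * j" m "m * Suc j"] by auto
  note step = block_square_exp_step[OF var t small]
  have "(\<integral>\<omega>. 1 * exp (\<Sum>j<k. t * (block X (m * j) m \<omega>)\<^sup>2) \<partial>M)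
      \<le> exp (t * real m * (sigma2 + \<epsilon>) * (1 + \<eta>)) ^ k * (\<integral>\<omega>. 1 \<partial>M)"
    by (rule weight_exp_sum_le[where g = "\<lambda>j. m * j"]) (use L step weights_one in auto)
  then show "(\<integral>\<omega>. exp (t * (\<Sum>j<k. (block X (m * j) m \<omega>)\<^sup>2)) \<partial>M)
      \<le> exp (t * real m * (sigma2 + \<epsilon>) * (1 + \<eta>)) ^ k"
    by (simp add: sum_distrib_left prob_space)
  have "(\<integral>\<omega>. 1 * exp (\<Sum>j<k. - t * (block X (m * j) m \<omega>)\<^sup>2) \<partial>M)
      \<le> exp (- (t * real m * (sigma2 - \<epsilon>) * (1 - \<eta>))) ^ k * (\<integral>\<omega>. 1 \<partial>M)"
    by (rule weight_exp_sum_le[where g = "\<lambda>j. m * j"]) (use L[of "- t"] step(2) weights_one in auto)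
  then show "(\<integral>\<omega>. exp (- t * (\<Sum>j<k. (block X (m * j) m \<omega>)\<^sup>2)) \<partial>M)
      \<le> exp (- (t * real m * (sigma2 - \<epsilon>) * (1 - \<eta>))) ^ k"
    by (simp add: sum_distrib_left prob_space)
qed

text \<open>The hypothesis on \<open>E\<close> compares \<open>t * x\<close> with
  \<open>t * A\<close>, so negative \<open>t\<close> is allowed and lower tails are covered as
  well.\<close>

lemma Chernoff:
  assumes "A \<in> Linf M" "(\<integral>\<omega>. exp (t * A \<omega>) \<partial>M) \<le> K" "\<And>\<omega>. \<omega> \<in> E \<Longrightarrow> t * x \<le> t * A \<omega>" "E \<in> events"
  shows "prob E \<le> exp (- (t * x)) * K"
proof -
  have "prob E = (\<integral>\<omega>. indicator E \<omega> \<partial>M)" using assms(4) by simp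
  also have "\<dots> \<le> (\<integral>\<omega>. exp (- (t * x)) * exp (t * A \<omega>) \<partial>M)"
  proof (rule integral_mono)
    show "integrable M (\<lambda>\<omega>. exp (- (t * x)) * exp (t * A \<omega>))"
      using assms(1) by (intro Linf_integrable) auto
    show "integrable M (indicator E :: 'a \<Rightarrow> real)"
      using assms(4) by (intro integrable_real_indicator) (auto simp: emeasure_eq_measure)
    show "indicator E \<omega> \<le> exp (- (t * x)) * exp (t * A \<omega>)" for \<omega>
      using assms(3)[of \<omega>] unfolding exp_add[symmetric] by (auto simp: indicator_def)
  qed
  also have "\<dots> = exp (- (t * x)) * (\<integral>\<omega>. exp (t * A \<omega>) \<partial>M)" by simp
  also have "\<dots> \<le> exp (- (t * x)) * K" using assms(2) by (intro mult_left_mono) auto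
  finally show ?thesis .
qed

end

section \<open>Laplace asymptotics\<close>

text \<open>Any constant factor, such as one from a union bound, is absorbed by an arbitrarily small
  loss in the exponential rate.\<close>

lemma eventually_exp_dominates:
  fixes s :: "nat \<Rightarrow> real"
  assumes s: "filterlim s at_top sequentially" and "c < d"
  shows "\<forall>\<^sub>F n in sequentially. r * exp (- (s n * d)) \<le> exp (- (s n * c))"
proof -
  have "\<forall>\<^sub>F n in sequentially. s n \<ge> ln (max r 1) / (d - c)"
    using s unfolding filterlim_at_top by blast
  then show ?thesis
  proof eventually_elim
    fix n assume "s n \<ge> ln (max r 1) / (d - c)"
    then have "ln (max r 1) \<le> s n * (d - c)" using assms(2) by (simp add: divide_le_eq)
    then have "exp (ln (max r 1)) \<le> exp (s n * (d - c))" by (simp only: exp_le_cancel_iff)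
    then have "r \<le> exp (s n * (d - c))" by simp
    then have "r * exp (- (s n * d)) \<le> exp (s n * (d - c)) * exp (- (s n * d))"
      by (rule mult_right_mono) simp
    also have "\<dots> = exp (- (s n * c))" unfolding exp_add[symmetric] by (simp add: algebra_simps)
    finally show "r * exp (- (s n * d)) \<le> exp (- (s n * c))" .
  qed
qed

section \<open>Tail and local bounds from a quadratic Laplace limit\<close>

context prob_space
begin

text \<open>Chernoff with the tilt t = x / v, which minimises t^2 v / 2 - t x and gives the value -
  x^2 / (2 v).\<close>

lemma quadratic_Laplace_upper_tail:
  fixes Z :: "nat \<Rightarrow> 'a \<Rightarrow> real"
  assumes Z: "\<And>n. Z n \<in> borel_measurable M"
    and int: "\<And>n t. integrable M (\<lambda>\<omega>. exp (t * Z n \<omega>))"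
    and s: "\<forall>\<^sub>F n in sequentially. s n > 0"
    and upper: "\<And>t \<epsilon>. \<epsilon> > 0 \<Longrightarrow>
      \<forall>\<^sub>F n in sequentially. (\<integral>\<omega>. exp (t * s n * Z n \<omega>) \<partial>M) \<le> exp (s n * (t\<^sup>2 * v / 2 + \<epsilon>))"
    and "v > 0" "x > 0" "\<epsilon> > 0"
  shows "\<forall>\<^sub>F n in sequentially. prob {\<omega> \<in> space M. x \<le> Z n \<omega>} \<le> exp (- (s n * (x\<^sup>2 / (2 * v) - \<epsilon>)))"
  using s upper[of \<epsilon> "x / v", OF \<open>\<epsilon> > 0\<close>]
proof eventually_elim
  fix n assume sn: "s n > 0"
    and up: "(\<integral>\<omega>. exp (x / v * s n * Z n \<omega>) \<partial>M) \<le> exp (s n * ((x / v)\<^sup>2 * v / 2 + \<epsilon>))"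
  let ?t = "x / v * s n" and ?E = "{\<omega> \<in> space M. x \<le> Z n \<omega>}"
  note [measurable] = Z
  have t: "?t \<ge> 0" using sn assms by simp
  have "prob ?E = (\<integral>\<omega>. indicator ?E \<omega> \<partial>M)" by simp
  also have "\<dots> \<le> (\<integral>\<omega>. exp (- (?t * x)) * exp (?t * Z n \<omega>) \<partial>M)"
  proof (rule integral_mono)
    show "integrable M (indicator ?E :: 'a \<Rightarrow> real)"
      by (intro integrable_real_indicator) (auto simp: emeasure_eq_measure)
    show "indicator ?E \<omega> \<le> exp (- (?t * x)) * exp (?t * Z n \<omega>)" for \<omega>
      unfolding exp_add[symmetric] using mult_left_mono[OF _ t, of x "Z n \<omega>"]
      by (auto simp: indicator_def)
  qed (use int[of "x / v * s n" n] in simp)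
  also have "\<dots> = exp (- (?t * x)) * (\<integral>\<omega>. exp (?t * Z n \<omega>) \<partial>M)" by simp
  also have "\<dots> \<le> exp (- (?t * x)) * exp (s n * ((x / v)\<^sup>2 * v / 2 + \<epsilon>))"
    using up by (intro mult_left_mono) auto
  also have "\<dots> = exp (- (s n * (x\<^sup>2 / (2 * v) - \<epsilon>)))"
    unfolding exp_add[symmetric] using \<open>v > 0\<close> by (simp add: power2_eq_square field_simps)
  finally show "prob ?E \<le> exp (- (s n * (x\<^sup>2 / (2 * v) - \<epsilon>)))" .
qed

text \<open>The tilting argument: under the weight \<open>exp (s x Z / v)\<close> the mass outside the
  \<open>\<delta>\<close>-neighbourhood of \<open>x\<close> is exponentially small, by the upper Laplace bound at two nearby tilts.\<close>

lemma quadratic_Laplace_local_lower: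
  fixes Z :: "nat \<Rightarrow> 'a \<Rightarrow> real"
  assumes Z: "\<And>n. Z n \<in> borel_measurable M"
    and int: "\<And>n t. integrable M (\<lambda>\<omega>. exp (t * Z n \<omega>))"
    and s: "filterlim s at_top sequentially"
    and upper: "\<And>t \<epsilon>. \<epsilon> > 0 \<Longrightarrow>
      \<forall>\<^sub>F n in sequentially. (\<integral>\<omega>. exp (t * s n * Z n \<omega>) \<partial>M) \<le> exp (s n * (t\<^sup>2 * v / 2 + \<epsilon>))"
    and lower: "\<And>t \<epsilon>. \<epsilon> > 0 \<Longrightarrow>
      \<forall>\<^sub>F n in sequentially. exp (s n * (t\<^sup>2 * v / 2 - \<epsilon>)) \<le> (\<integral>\<omega>. exp (t * s n * Z n \<omega>) \<partial>M)"
    and "v > 0" "\<delta> > 0"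
  shows "\<forall>\<^sub>F n in sequentially. exp (- (s n * (x\<^sup>2 / (2 * v) + \<bar>x / v\<bar> * \<delta> + \<delta>\<^sup>2 / (4 * v))))
    \<le> prob {\<omega> \<in> space M. \<bar>Z n \<omega> - x\<bar> < \<delta>}"
proof -
  \<comment> \<open>\<open>t\<close> is the tilt that centres the mass at \<open>x\<close>. The
    extra tilt \<open>h\<close> minimises h^2 v / 2 - h \<delta>, with minimum - \<delta>^2 / (2 v)
    = - 4 e. Since each use of a Laplace bound costs \<open>e\<close>, the outside mass has exponent
    \<open>c - 3 * e\<close> against at least \<open>c - e\<close> for the total.\<close>
  define t h e where "t = x / v" and "h = \<delta> / v" and "e = \<delta>\<^sup>2 / (8 * v)"
  have e: "e > 0" and h: "h > 0" using assms by (auto simp: e_def h_def)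
  define c where "c = t\<^sup>2 * v / 2"
  have tilt: "(t + h)\<^sup>2 * v / 2 - h * (x + \<delta>) = c - 4 * e" "(t - h)\<^sup>2 * v / 2 + h * (x - \<delta>) = c - 4 * e"
    unfolding c_def t_def h_def e_def using \<open>v > 0\<close> by (simp_all add: power2_eq_square field_simps)
  \<comment> \<open>The first domination lets the two outer parts take at most half of the total
    mass; the second shows that the remaining half is still at least exp(s (c - 2 e)).\<close>
  have dom: "\<forall>\<^sub>F n in sequentially. 4 * exp (- (s n * (3 * e - c))) \<le> exp (- (s n * (e - c)))"
    "\<forall>\<^sub>F n in sequentially. 2 * exp (- (s n * (2 * e - c))) \<le> exp (- (s n * (e - c)))"
    using e by (intro eventually_exp_dominates[OF s]; simp)+
  have "\<forall>\<^sub>F n in sequentially. s n > 0" using s by (simp add: filterlim_at_top_dense)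
  then show ?thesis
    using upper[of e "t + h", OF e] upper[of e "t - h", OF e] lower[of e t, OF e] dom
  proof eventually_elim
    case (elim n)
    note [measurable] = Z
    let ?E = "{\<omega> \<in> space M. \<bar>Z n \<omega> - x\<bar> < \<delta>}"
    let ?K = "exp (s n * (t * x + \<bar>t\<bar> * \<delta>))"
    let ?up = "\<lambda>\<omega>. exp (- (s n * h * (x + \<delta>))) * exp ((t + h) * s n * Z n \<omega>)"
    let ?lo = "\<lambda>\<omega>. exp (s n * h * (x - \<delta>)) * exp ((t - h) * s n * Z n \<omega>)"
    have sn: "s n > 0" using elim by simp
    \<comment> \<open>Near \<open>x\<close> the tilting factor is at most \<open>?K\<close>. On
      either outer side an additional factor of tilt \<open>h\<close>, which is at least 1 there, is
      inserted.\<close>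
    have pw: "exp (t * s n * Z n \<omega>) \<le> ?K * indicator ?E \<omega> + (?up \<omega> + ?lo \<omega>)" if \<omega>: "\<omega> \<in> space M" for \<omega>
    proof -
      consider "\<bar>Z n \<omega> - x\<bar> < \<delta>" | "Z n \<omega> \<ge> x + \<delta>" | "Z n \<omega> \<le> x - \<delta>" by linarith
      then show ?thesis
      proof cases
        case 1
        have "t * (Z n \<omega> - x) \<le> \<bar>t\<bar> * \<delta>"
          using 1 mult_mono[of "\<bar>t\<bar>" "\<bar>t\<bar>" "\<bar>Z n \<omega> - x\<bar>" \<delta>] abs_ge_self[of "t * (Z n \<omega> - x)"]
          by (simp add: abs_mult)
        then have "t * Z n \<omega> \<le> t * x + \<bar>t\<bar> * \<delta>" by (simp add: algebra_simps)
        then have "exp (s n * (t * Z n \<omega>)) \<le> ?K" using sn by simp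
        then have "exp (t * s n * Z n \<omega>) \<le> ?K * indicator ?E \<omega>" using 1 \<omega> by (simp add: mult_ac)
        moreover have "0 \<le> ?up \<omega> + ?lo \<omega>" by simp
        ultimately show ?thesis by linarith
      next
        case 2
        then have "s n * h * (x + \<delta>) \<le> s n * h * Z n \<omega>" using sn h by (intro mult_left_mono) auto
        then have "exp (t * s n * Z n \<omega>) \<le> ?up \<omega>"
          unfolding exp_add[symmetric] by (simp add: algebra_simps)
        moreover have "0 \<le> ?K * indicator ?E \<omega>" "0 \<le> ?lo \<omega>" by simp_all
        ultimately show ?thesis by linarith
      next
        case 3
        then have "s n * h * Z n \<omega> \<le> s n * h * (x - \<delta>)" using sn h by (intro mult_left_mono) auto
        then have "exp (t * s n * Z n \<omega>) \<le> ?lo \<omega>"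
          unfolding exp_add[symmetric] by (simp add: algebra_simps)
        moreover have "0 \<le> ?K * indicator ?E \<omega>" "0 \<le> ?up \<omega>" by simp_all
        ultimately show ?thesis by linarith
      qed
    qed
    have iE: "integrable M (indicator ?E :: 'a \<Rightarrow> real)"
      by (intro integrable_real_indicator) (auto simp: emeasure_eq_measure)
    have "exp (s n * (c - e)) \<le> (\<integral>\<omega>. exp (t * s n * Z n \<omega>) \<partial>M)" using elim unfolding c_def by blast
    also have "\<dots> \<le> (\<integral>\<omega>. ?K * indicator ?E \<omega> + (?up \<omega> + ?lo \<omega>) \<partial>M)"
      by (rule integral_mono) (use int iE pw in \<open>auto intro!: Bochner_Integration.integrable_add integrable_mult_right\<close>)
    also have "\<dots> = (\<integral>\<omega>. ?K * indicator ?E \<omega> \<partial>M) + ((\<integral>\<omega>. ?up \<omega> \<partial>M) + (\<integral>\<omega>. ?lo \<omega> \<partial>M))"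
      using int iE by (subst Bochner_Integration.integral_add, simp, simp)
        (subst Bochner_Integration.integral_add, auto)
    also have "(\<integral>\<omega>. ?K * indicator ?E \<omega> \<partial>M) = ?K * prob ?E" using iE by simp
    also have "(\<integral>\<omega>. ?up \<omega> \<partial>M) \<le> exp (- (s n * h * (x + \<delta>))) * exp (s n * ((t + h)\<^sup>2 * v / 2 + e))"
      using elim by simp
    also have "\<dots> = exp (s n * ((t + h)\<^sup>2 * v / 2 - h * (x + \<delta>) + e))"
      unfolding exp_add[symmetric] by (simp add: algebra_simps)
    also have "\<dots> = exp (s n * (c - 3 * e))" unfolding tilt by simp
    also have "(\<integral>\<omega>. ?lo \<omega> \<partial>M) \<le> exp (s n * h * (x - \<delta>)) * exp (s n * ((t - h)\<^sup>2 * v / 2 + e))"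
      using elim by simp
    also have "\<dots> = exp (s n * ((t - h)\<^sup>2 * v / 2 + h * (x - \<delta>) + e))"
      unfolding exp_add[symmetric] by (simp add: algebra_simps)
    also have "\<dots> = exp (s n * (c - 3 * e))" unfolding tilt by simp
    finally have main: "exp (s n * (c - e)) \<le> ?K * prob ?E + 2 * exp (s n * (c - 3 * e))" by simp
    have 4: "4 * exp (s n * (c - 3 * e)) \<le> exp (s n * (c - e))" and 2: "2 * exp (s n * (c - 2 * e)) \<le> exp (s n * (c - e))"
      using elim by (simp_all add: algebra_simps)
    have "exp (s n * (c - 2 * e)) \<le> ?K * prob ?E" using main 4 2 by linarith
    then have "exp (s n * (c - 2 * e)) / ?K \<le> prob ?E" by (simp add: divide_le_eq mult.commute)
    also have "exp (s n * (c - 2 * e)) / ?K = exp (s n * (c - 2 * e) - s n * (t * x + \<bar>t\<bar> * \<delta>))"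
      by (rule exp_diff[symmetric])
    also have "s n * (c - 2 * e) - s n * (t * x + \<bar>t\<bar> * \<delta>)
        = - (s n * (x\<^sup>2 / (2 * v) + \<bar>x / v\<bar> * \<delta> + \<delta>\<^sup>2 / (4 * v)))"
    proof -
      have "c - t * x = - (x\<^sup>2 / (2 * v))" "2 * e = \<delta>\<^sup>2 / (4 * v)"
        unfolding c_def t_def e_def using \<open>v > 0\<close> by (simp_all add: power2_eq_square field_simps)
      then have "c - 2 * e - (t * x + \<bar>t\<bar> * \<delta>) = - (x\<^sup>2 / (2 * v) + \<bar>x / v\<bar> * \<delta> + \<delta>\<^sup>2 / (4 * v))"
        unfolding t_def by linarith
      then show ?thesis by (metis mult_minus_right right_diff_distrib)
    qed
    finally show ?case .
  qed
qed

end

text \<open>Replaces explicit error arithmetic: a strict inequality that holds with all errors equal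
  to 0 persists, by continuity, for some small positive error \<open>d\<close>.\<close>

lemma obtain_small:
  fixes g :: "real \<Rightarrow> real"
  assumes "isCont g 0" "g 0 < y" "u > 0"
  obtains d where "0 < d" "d < u" "g d < y"
proof -
  have "\<forall>\<^sub>F d in at 0. g d < y" using assms(1,2) unfolding isCont_def by (rule order_tendstoD(2))
  then obtain r where r: "r > 0" "\<And>d. d \<noteq> 0 \<Longrightarrow> dist d 0 < r \<Longrightarrow> g d < y"
    unfolding eventually_at by blast
  show thesis using that[of "min r u / 2"] r assms(3) by (auto simp: dist_real_def min_def)
qed

section \<open>Asymptotics on the moderate deviation scale\<close>

locale block_scaling = covariance_process +
  fixes m :: "nat \<Rightarrow> nat" and a :: "nat \<Rightarrow> real"
  assumes m_range: "n \<ge> 1 \<Longrightarrow> 1 \<le> m n \<and> m n \<le> n"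
    and m_at_top: "filterlim m at_top sequentially"
    and sqrt_over_m: "filterlim (\<lambda>n. sqrt (real n) / real (m n)) at_top sequentially"
    and a_tendsto_0: "a \<longlonglongrightarrow> 0"
    and a_sqrt_over_m: "filterlim (\<lambda>n. a n * sqrt (real n) / real (m n)) at_top sequentially"
begin

definition speed :: "nat \<Rightarrow> real" where "speed n = 1 / (a n)\<^sup>2"

definition mart :: "nat \<Rightarrow> 'a \<Rightarrow> real" where
  "mart n \<omega> = (\<Sum>j<n div m n. fluct (m n * j) (m n) \<omega>)"

definition drift :: "nat \<Rightarrow> 'a \<Rightarrow> real" where
  "drift n \<omega> = (\<Sum>j<n div m n. block_drift X (m n * j) (m n) \<omega>)"

definition quad :: "nat \<Rightarrow> 'a \<Rightarrow> real" where
  "quad n \<omega> = (\<Sum>j<n div m n. (block X (m n * j) (m n) \<omega>)\<^sup>2)"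

lemma mart_LinfM: "mart n \<in> Linf M"
  unfolding mart_def using fluct_LinfM by auto

lemma drift_LinfM: "drift n \<in> Linf M"
  unfolding drift_def using block_drift_LinfM by auto

lemma quad_LinfM: "quad n \<in> Linf M"
  unfolding quad_def using block_LinfM by auto

lemma eventually_a_pos: "\<forall>\<^sub>F n in sequentially. a n > 0"
proof -
  have "\<forall>\<^sub>F n in sequentially. a n * sqrt (real n) / real (m n) > 0"
    using a_sqrt_over_m by (simp add: filterlim_at_top_dense)
  then show ?thesis
    by eventually_elim (auto simp: zero_less_divide_iff zero_less_mult_iff)
qed

lemma speed_at_top: "filterlim speed at_top sequentially"
proof -
  have "(\<lambda>n. (a n)\<^sup>2) \<longlonglongrightarrow> 0" using tendsto_power[OF a_tendsto_0, of 2] by simp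
  moreover have "\<forall>\<^sub>F n in sequentially. (a n)\<^sup>2 > 0"
    using eventually_a_pos by eventually_elim simp
  ultimately have "filterlim (\<lambda>n. inverse ((a n)\<^sup>2)) at_top sequentially"
    by (rule filterlim_inverse_at_top)
  then show ?thesis unfolding speed_def[abs_def] inverse_eq_divide .
qed

text \<open>The relevant tilt is t / (a sqrt n) and a block is of size O(m), so this is the
  statement that the exponent contributed by a single block vanishes. Here the growth condition on
  \<open>a n * sqrt n / m n\<close> enters.\<close>

lemma small_tilt: "(\<lambda>n. t * real (m n) / (a n * sqrt (real n))) \<longlonglongrightarrow> 0"
proof -
  have "(\<lambda>n. inverse (a n * sqrt (real n) / real (m n))) \<longlonglongrightarrow> 0"
    by (rule tendsto_inverse_0_at_top[OF a_sqrt_over_m])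
  from tendsto_mult_left[OF this, of t] show ?thesis by simp
qed

lemma total_le: "real (n div m n) * real (m n) \<le> real n"
  by (metis div_times_less_eq_dividend of_nat_le_iff of_nat_mult)

lemma eventually_total_ge:
  assumes "d > 0"
  shows "\<forall>\<^sub>F n in sequentially. (1 - d) * real n \<le> real (n div m n) * real (m n)"
proof -
  have "\<forall>\<^sub>F n in sequentially. sqrt (real n) / real (m n) \<ge> 1 / d"
    using sqrt_over_m unfolding filterlim_at_top by blast
  then show ?thesis using eventually_ge_at_top[of 1]
  proof eventually_elim
    fix n :: nat assume *: "1 / d \<le> sqrt (real n) / real (m n)" and n: "n \<ge> 1"
    then have mn: "m n \<ge> 1" using m_range by blast
    have "real (m n) \<le> d * sqrt (real n)" using * mn assms by (simp add: field_simps)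
    also have "\<dots> \<le> d * real n"
    proof -
      have "sqrt (real n) * 1 \<le> sqrt (real n) * sqrt (real n)" using n by (intro mult_left_mono) auto
      then show ?thesis using assms by simp
    qed
    finally have md: "real (m n) \<le> d * real n" .
    have "real n = real (n div m n) * real (m n) + real (n mod m n)"
      by (metis div_mult_mod_eq of_nat_add of_nat_mult)
    moreover have "real (n mod m n) \<le> real (m n)" using mn by (simp add: less_imp_le)
    ultimately show "(1 - d) * real n \<le> real (n div m n) * real (m n)"
      using md by (simp add: algebra_simps)
  qed
qed

lemma eventually_m: "eventually P sequentially \<Longrightarrow> \<forall>\<^sub>F n in sequentially. P (m n)"
  by (rule eventually_compose_filterlim[OF _ m_at_top])

lemma eventually_fluct_var:
  assumes "\<epsilon> > 0"
  shows "\<forall>\<^sub>F n in sequentially. \<forall>i. \<forall>Z\<in>weights i.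
    \<bar>(\<integral>\<omega>. Z \<omega> * (fluct i (m n) \<omega>)\<^sup>2 \<partial>M) - real (m n) * sigma2 * (\<integral>\<omega>. Z \<omega> \<partial>M)\<bar>
      \<le> \<epsilon> * real (m n) * (\<integral>\<omega>. Z \<omega> \<partial>M)"
  using eventually_m[of "\<lambda>m. \<forall>i. \<forall>Z\<in>weights i.
    \<bar>(\<integral>\<omega>. Z \<omega> * (fluct i m \<omega>)\<^sup>2 \<partial>M) - real m * sigma2 * (\<integral>\<omega>. Z \<omega> \<partial>M)\<bar> \<le> \<epsilon> * real m * (\<integral>\<omega>. Z \<omega> \<partial>M)"]
    fluct_square_uniform[OF assms] unfolding eventually_sequentially by blast

lemma eventually_block_var:
  assumes "\<epsilon> > 0"
  shows "\<forall>\<^sub>F n in sequentially. \<forall>i. \<forall>Z\<in>weights i.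
    \<bar>(\<integral>\<omega>. Z \<omega> * (block X i (m n) \<omega>)\<^sup>2 \<partial>M) - real (m n) * sigma2 * (\<integral>\<omega>. Z \<omega> \<partial>M)\<bar>
      \<le> \<epsilon> * real (m n) * (\<integral>\<omega>. Z \<omega> \<partial>M)"
  using eventually_m[of "\<lambda>m. \<forall>i. \<forall>Z\<in>weights i.
    \<bar>(\<integral>\<omega>. Z \<omega> * (block X i m \<omega>)\<^sup>2 \<partial>M) - real m * sigma2 * (\<integral>\<omega>. Z \<omega> \<partial>M)\<bar> \<le> \<epsilon> * real m * (\<integral>\<omega>. Z \<omega> \<partial>M)"]
    block_square_uniform[OF assms] unfolding eventually_sequentially by blast

text \<open>After rescaling, the tilt is \<open>?th\<close> = t / (a sqrt n), so that n * th^2 =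
  speed * t^2. A single \<open>d\<close> bounds both the relative variance error and the Taylor
  error; the blocks cover at most \<open>n\<close> indices.\<close>

lemma mart_Laplace_upper:
  assumes "\<epsilon> > 0"
  shows "\<forall>\<^sub>F n in sequentially. (\<integral>\<omega>. exp (t * speed n * (a n * mart n \<omega> / sqrt (real n))) \<partial>M)
    \<le> exp (speed n * (t\<^sup>2 * sigma2 / 2 + \<epsilon>))"
proof -
  obtain d where d: "0 < d" "d < min 1 sigma2" "t\<^sup>2 * ((sigma2 + d) * (1 + d) / 2) < t\<^sup>2 * sigma2 / 2 + \<epsilon>"
  proof (rule obtain_small)
    show "isCont (\<lambda>d. t\<^sup>2 * ((sigma2 + d) * (1 + d) / 2)) 0" by (intro continuous_intros) auto
    show "t\<^sup>2 * ((sigma2 + 0) * (1 + 0) / 2) < t\<^sup>2 * sigma2 / 2 + \<epsilon>" using assms by simp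
    show "min 1 sigma2 > 0" using sigma2_pos by simp
  qed
  have "\<forall>\<^sub>F n in sequentially. \<bar>2 * b * \<bar>t\<bar> * real (m n) / (a n * sqrt (real n))\<bar> < d"
    using tendstoD[OF small_tilt[of "2 * b * \<bar>t\<bar>"] d(1)] by (simp add: dist_real_def)
  then show ?thesis using eventually_fluct_var[OF d(1)] eventually_a_pos eventually_ge_at_top[of 1]
  proof eventually_elim
    case (elim n)
    let ?th = "t / (a n * sqrt (real n))" and ?m = "real (m n)" and ?k = "real (n div m n)"
    have n: "real n > 0" "a n > 0" using elim by auto
    have small: "2 * b * ?m * \<bar>?th\<bar> \<le> d"
    proof -
      have "2 * b * ?m * \<bar>?th\<bar> = \<bar>2 * b * \<bar>t\<bar> * ?m / (a n * sqrt (real n))\<bar>"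
        using b_nonneg by (simp add: abs_mult)
      then show ?thesis using elim by linarith
    qed
    have th: "t * speed n * (a n * mart n \<omega> / sqrt (real n)) = ?th * mart n \<omega>" for \<omega>
      unfolding speed_def using n by (simp add: power2_eq_square)
    have "(\<integral>\<omega>. exp (?th * mart n \<omega>) \<partial>M) \<le> exp (?th\<^sup>2 * ?m * (sigma2 + d) * (1 + d) / 2) ^ (n div m n)"
      unfolding mart_def using elim small d by (intro fluct_sum_laplace(1)) auto
    also have "\<dots> = exp ((?k * ?m) * (?th\<^sup>2 * ((sigma2 + d) * (1 + d) / 2)))"
      unfolding exp_of_nat_mult[symmetric] by (simp add: mult_ac)
    also have "\<dots> \<le> exp (real n * (?th\<^sup>2 * ((sigma2 + d) * (1 + d) / 2)))"
      using total_le[of n] sigma2_pos d unfolding exp_le_cancel_iff by (intro mult_right_mono) auto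
    also have "real n * (?th\<^sup>2 * ((sigma2 + d) * (1 + d) / 2)) = speed n * (t\<^sup>2 * ((sigma2 + d) * (1 + d) / 2))"
      unfolding speed_def using n by (simp add: power_divide power_mult_distrib)
    also have "exp \<dots> \<le> exp (speed n * (t\<^sup>2 * sigma2 / 2 + \<epsilon>))"
      unfolding exp_le_cancel_iff using d(3) by (intro mult_left_mono) (auto simp: speed_def)
    finally show ?case unfolding th .
  qed
qed

text \<open>Two losses do not occur in the upper bound: the blocks may miss a fraction
  \<open>d\<close> of the indices, and each factor 1 + y has to be turned into an exponential,
  through ln (1 + y) >= y - y^2 >= (1 - d) y for y <= d.\<close>

lemma mart_Laplace_lower:
  assumes "\<epsilon> > 0"
  shows "\<forall>\<^sub>F n in sequentially. exp (speed n * (t\<^sup>2 * sigma2 / 2 - \<epsilon>))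
    \<le> (\<integral>\<omega>. exp (t * speed n * (a n * mart n \<omega> / sqrt (real n))) \<partial>M)"
proof -
  let ?g = "\<lambda>d. (sigma2 - d) * (1 - d) / 2"
  obtain d where d: "0 < d" "d < min 1 sigma2"
    "- ((1 - d) * (1 - d) * (t\<^sup>2 * ?g d)) < - (t\<^sup>2 * sigma2 / 2 - \<epsilon>)"
  proof (rule obtain_small)
    show "isCont (\<lambda>d. - ((1 - d) * (1 - d) * (t\<^sup>2 * ?g d))) 0" by (intro continuous_intros) auto
    show "- ((1 - 0) * (1 - 0) * (t\<^sup>2 * ?g 0)) < - (t\<^sup>2 * sigma2 / 2 - \<epsilon>)" using assms by simp
    show "min 1 sigma2 > 0" using sigma2_pos by simp
  qed
  have g0: "?g d \<ge> 0" using d by simp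
  \<comment> \<open>Chosen so that th^2 m <= d' implies y <= d. As m >= 1, th^2 m is at most (th
    m)^2, which tends to 0 by \<open>small_tilt\<close>. The 1 in the denominator avoids a case
    distinction when \<open>?g d\<close> vanishes.\<close>
  define d' where "d' = min d (d / (1 + ?g d))"
  have "0 < d / (1 + ?g d)" using d(1) g0 by (intro divide_pos_pos) linarith+
  then have d': "0 < d'" "d' \<le> d" using d(1) by (auto simp: d'_def)
  have d'g: "d' * ?g d \<le> d"
  proof -
    have "d' * ?g d \<le> d / (1 + ?g d) * ?g d" using g0 by (intro mult_right_mono) (auto simp: d'_def)
    also have "\<dots> = d * (?g d / (1 + ?g d))" by simp
    also have "\<dots> \<le> d * 1"
    proof (rule mult_left_mono)
      have "x / (1 + x) \<le> 1" if "x \<ge> 0" for x :: real using that by (simp add: divide_le_eq_1)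
      then show "?g d / (1 + ?g d) \<le> 1" using g0 by blast
    qed (use d in simp)
    finally show ?thesis by simp
  qed
  have "\<forall>\<^sub>F n in sequentially. \<bar>2 * b * \<bar>t\<bar> * real (m n) / (a n * sqrt (real n))\<bar> < d"
    using tendstoD[OF small_tilt[of "2 * b * \<bar>t\<bar>"] d(1)] by (simp add: dist_real_def)
  moreover have "\<forall>\<^sub>F n in sequentially. \<bar>t * real (m n) / (a n * sqrt (real n))\<bar> < d'"
    using tendstoD[OF small_tilt[of t] d'(1)] by (simp add: dist_real_def)
  ultimately show ?thesis
    using eventually_fluct_var[OF d(1)] eventually_a_pos eventually_ge_at_top[of 1] eventually_total_ge[OF d(1)]
  proof eventually_elim
    case (elim n)
    let ?th = "t / (a n * sqrt (real n))" and ?m = "real (m n)" and ?k = "real (n div m n)"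
    have n: "real n > 0" "a n > 0" using elim by auto
    have m1: "?m \<ge> 1" using m_range[of n] elim by simp
    have small: "2 * b * ?m * \<bar>?th\<bar> \<le> d"
    proof -
      have "2 * b * ?m * \<bar>?th\<bar> = \<bar>2 * b * \<bar>t\<bar> * ?m / (a n * sqrt (real n))\<bar>"
        using b_nonneg by (simp add: abs_mult)
      then show ?thesis using elim by linarith
    qed
    have th: "t * speed n * (a n * mart n \<omega> / sqrt (real n)) = ?th * mart n \<omega>" for \<omega>
      unfolding speed_def using n by (simp add: power2_eq_square)
    define y where "y = ?th\<^sup>2 * ?m * (sigma2 - d) * (1 - d) / 2"
    have y0: "y \<ge> 0" unfolding y_def using d by simp
    have yd: "y \<le> d"
    proof -
      have "x\<^sup>2 * y \<le> (x * y)\<^sup>2" if "y \<ge> 1" for x y :: real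
      proof -
        have "y \<le> y\<^sup>2" using that by (simp add: power2_eq_square)
        then show ?thesis unfolding power_mult_distrib by (rule mult_left_mono) simp
      qed
      from this[OF m1] have "?th\<^sup>2 * ?m \<le> (?th * ?m)\<^sup>2" .
      also have "\<dots> = \<bar>t * ?m / (a n * sqrt (real n))\<bar>\<^sup>2" unfolding power2_abs by simp
      also have "\<dots> \<le> d' * 1" unfolding power2_eq_square
      proof (rule mult_mono)
        show "\<bar>t * ?m / (a n * sqrt (real n))\<bar> \<le> d'" using elim(2) by linarith
        then show "\<bar>t * ?m / (a n * sqrt (real n))\<bar> \<le> 1" using d' d by linarith
      qed (use d' in auto)
      finally have "?th\<^sup>2 * ?m \<le> d'" by simp
      then have "?th\<^sup>2 * ?m * ?g d \<le> d' * ?g d" using g0 by (rule mult_right_mono)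
      also have "?th\<^sup>2 * ?m * ?g d = y" unfolding y_def by simp
      finally show ?thesis using d'g by linarith
    qed
    have ln: "(1 - d) * y \<le> ln (1 + y)"
    proof -
      have "y - y\<^sup>2 \<le> ln (1 + y)" using y0 yd d by (intro ln_one_plus_pos_lower_bound) auto
      moreover have "y\<^sup>2 \<le> d * y" unfolding power2_eq_square using yd y0 by (rule mult_right_mono)
      ultimately show ?thesis by (simp add: algebra_simps)
    qed
    have "speed n * (t\<^sup>2 * sigma2 / 2 - \<epsilon>) \<le> speed n * ((1 - d) * (1 - d) * (t\<^sup>2 * ?g d))"
      using d(3) by (intro mult_left_mono) (auto simp: speed_def)
    also have "\<dots> = ((1 - d) * real n) * ((1 - d) * (?th\<^sup>2 * ?g d))"
      unfolding speed_def using n by (simp add: power_divide power_mult_distrib)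
    also have "\<dots> \<le> (?k * ?m) * ((1 - d) * (?th\<^sup>2 * ?g d))"
      using elim d g0 by (intro mult_right_mono) auto
    also have "\<dots> = ?k * ((1 - d) * y)" unfolding y_def by (simp add: mult_ac)
    also have "\<dots> \<le> ?k * ln (1 + y)" using ln by (rule mult_left_mono) simp
    finally have "exp (speed n * (t\<^sup>2 * sigma2 / 2 - \<epsilon>)) \<le> exp (?k * ln (1 + y))" by simp
    also have "\<dots> = (1 + y) ^ (n div m n)"
      unfolding exp_of_nat_mult using y0 by (simp add: exp_ln)
    also have "\<dots> \<le> (\<integral>\<omega>. exp (?th * mart n \<omega>) \<partial>M)"
      unfolding mart_def y_def using elim small d by (intro fluct_sum_laplace(2)) auto
    finally show ?case unfolding th .
  qed
qed

text \<open>\<open>c\<close> is fixed while \<open>tau (m n)\<close> tends to 0, so at tilt c / (a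
  sqrt n) the sub-Gaussian cost is eventually below one unit of speed, whereas the gain is any
  prescribed multiple of the speed.\<close>

lemma drift_negligible:
  assumes "\<epsilon> > 0"
  shows "\<forall>\<^sub>F n in sequentially. prob {\<omega> \<in> space M. \<epsilon> \<le> \<bar>a n * drift n \<omega> / sqrt (real n)\<bar>}
    \<le> exp (- (speed n * A))"
proof -
  \<comment> \<open>The gain is speed * (|A| + 3). One unit pays for the sub-Gaussian cost, and the
    surplus over \<open>A\<close> absorbs the factor 2 e coming from the two tails and the constant
    1 in \<open>subgauss\<close>.\<close>
  define c where "c = (\<bar>A\<bar> + 3) / \<epsilon>"
  have c: "c > 0" using assms by (simp add: c_def)
  have "\<forall>\<^sub>F n in sequentially. 9 * (c * tau (m n))\<^sup>2 < 1"
  proof (rule eventually_m)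
    have "(\<lambda>n. 9 * (c * tau n)\<^sup>2) \<longlonglongrightarrow> 9 * (c * 0)\<^sup>2"
      by (intro tendsto_intros tau_tendsto_0)
    then show "\<forall>\<^sub>F n in sequentially. 9 * (c * tau n)\<^sup>2 < 1" by (rule order_tendstoD(2)) simp
  qed
  moreover have "\<forall>\<^sub>F n in sequentially. 2 * exp 1 * exp (- (speed n * (\<bar>A\<bar> + 2))) \<le> exp (- (speed n * A))"
    by (rule eventually_exp_dominates[OF speed_at_top]) simp
  ultimately show ?thesis
    using eventually_a_pos eventually_ge_at_top[of 1]
  proof eventually_elim
    case (elim n)
    let ?m = "m n" and ?k = "n div m n" and ?E = "{\<omega> \<in> space M. \<epsilon> \<le> \<bar>a n * drift n \<omega> / sqrt (real n)\<bar>}"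
    define u where "u = c / (a n * sqrt (real n))"
    have n: "real n > 0" "a n > 0" "?m \<ge> 1" "?m \<le> n" using elim m_range[of n] by auto
    have k: "?k \<ge> 1" using n by (simp add: div_greater_zero_iff Suc_le_eq)
    have sg: "subgauss 0 (3 * sqrt (real (?m * ?k)) * tau ?m) (drift n)"
      using subgauss_block_drift[OF n(3) k, of 0] unfolding drift_def by simp
    have lap: "(\<integral>\<omega>. exp (u' * drift n \<omega>) \<partial>M) \<le> exp (1 + speed n)" if "u'\<^sup>2 = u\<^sup>2" for u'
    proof -
      have "(\<integral>\<omega>. exp (u' * drift n \<omega>) \<partial>M) \<le> exp (1 + u\<^sup>2 * (3 * sqrt (real (?m * ?k)) * tau ?m)\<^sup>2)"
        using subgaussD[OF sg weights_one, of u'] that by (simp add: prob_space)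
      also have "u\<^sup>2 * (3 * sqrt (real (?m * ?k)) * tau ?m)\<^sup>2 = u\<^sup>2 * (9 * (tau ?m)\<^sup>2) * (real ?k * real ?m)"
        by (simp add: power_mult_distrib)
      also have "\<dots> \<le> u\<^sup>2 * (9 * (tau ?m)\<^sup>2) * real n"
        using total_le[of n] by (intro mult_left_mono) auto
      also have "\<dots> = speed n * (9 * (c * tau ?m)\<^sup>2)"
        unfolding u_def speed_def using n by (simp add: power_divide power_mult_distrib)
      also have "\<dots> \<le> speed n * 1" using elim by (intro mult_left_mono) (auto simp: speed_def)
      finally show ?thesis by simp
    qed
    define y where "y = \<epsilon> * sqrt (real n) / a n"
    have uy: "u * y = speed n * (\<bar>A\<bar> + 3)"
      unfolding u_def y_def speed_def c_def using n assms by (simp add: power2_eq_square)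
    have u: "u \<ge> 0" unfolding u_def using c n by simp
    have meas: "drift n \<in> borel_measurable M" using drift_LinfM by (rule Linf_measurable)
    note [measurable] = meas
    have E: "?E \<subseteq> {\<omega> \<in> space M. y \<le> drift n \<omega>} \<union> {\<omega> \<in> space M. y \<le> - drift n \<omega>}"
      using n by (auto simp: y_def field_simps abs_if split: if_splits)
    have "prob ?E \<le> prob ({\<omega> \<in> space M. y \<le> drift n \<omega>} \<union> {\<omega> \<in> space M. y \<le> - drift n \<omega>})"
      by (rule finite_measure_mono[OF E]) measurable
    also have "\<dots> \<le> prob {\<omega> \<in> space M. y \<le> drift n \<omega>} + prob {\<omega> \<in> space M. y \<le> - drift n \<omega>}"
      by (rule measure_Un_le) measurable
    also have "prob {\<omega> \<in> space M. y \<le> drift n \<omega>} \<le> exp (- (u * y)) * exp (1 + speed n)"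
      using u drift_LinfM lap by (intro Chernoff[where A = "drift n"]) (auto intro: mult_left_mono)
    also have "prob {\<omega> \<in> space M. y \<le> - drift n \<omega>} \<le> exp (- (u * y)) * exp (1 + speed n)"
      using drift_LinfM lap[of "- u"] mult_left_mono[OF _ u, of y "- drift n _"]
      by (intro Chernoff[where A = "\<lambda>\<omega>. - drift n \<omega>"]) auto
    also have "exp (- (u * y)) * exp (1 + speed n) = exp 1 * exp (- (speed n * (\<bar>A\<bar> + 2)))"
      unfolding uy exp_add[symmetric] by (simp add: algebra_simps)
    finally have "prob ?E \<le> 2 * exp 1 * exp (- (speed n * (\<bar>A\<bar> + 2)))" by simp
    also have "\<dots> \<le> exp (- (speed n * A))" using elim by simp
    finally show ?case .
  qed
qed

text \<open>The tilt is of order speed / n, and a squared block is O(m^2), so the exponents per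
  block are of order (m / (a sqrt n))^2 and vanish. Deviations from the mean therefore cost an
  arbitrary multiple of the speed.\<close>

lemma quad_concentration:
  assumes "\<epsilon> > 0"
  shows "\<forall>\<^sub>F n in sequentially. prob {\<omega> \<in> space M. \<epsilon> \<le> \<bar>quad n \<omega> / real n - sigma2\<bar>} \<le> exp (- (speed n * A))"
proof -
  \<comment> \<open>The first entry bounds the Laplace exponent of the upper tail. The second,
    reflected at \<open>sigma2\<close>, states that the exponent of the lower tail is above sigma2 -
    \<epsilon> / 2, including the fraction of indices missed by the blocks.\<close>
  let ?g = "\<lambda>d. max ((sigma2 + d) * (1 + d)) (2 * sigma2 - (1 - d) * ((sigma2 - d) * (1 - d)))"
  obtain d where d: "0 < d" "d < min 1 sigma2" "?g d < sigma2 + \<epsilon> / 2"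
  proof (rule obtain_small)
    show "isCont ?g 0" by (intro continuous_intros)
    show "?g 0 < sigma2 + \<epsilon> / 2" using assms by simp
    show "min 1 sigma2 > 0" using sigma2_pos by simp
  qed
  \<comment> \<open>Half of \<epsilon> is spent on the errors of the Laplace bounds; the other half
    yields u * n * \<epsilon> / 2 = speed * (|A| + 1).\<close>
  define c where "c = 2 * (\<bar>A\<bar> + 1) / \<epsilon>"
  have c: "c > 0" using assms by (simp add: c_def)
  have "(\<lambda>n. c * b\<^sup>2 * (1 * real (m n) / (a n * sqrt (real n)))\<^sup>2) \<longlonglongrightarrow> c * b\<^sup>2 * 0\<^sup>2"
    by (intro tendsto_intros small_tilt)
  then have "\<forall>\<^sub>F n in sequentially. c * b\<^sup>2 * (1 * real (m n) / (a n * sqrt (real n)))\<^sup>2 < d"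
    by (rule order_tendstoD(2)) (use d in simp)
  moreover have "\<forall>\<^sub>F n in sequentially. 2 * exp (- (speed n * (\<bar>A\<bar> + 1))) \<le> exp (- (speed n * A))"
    by (rule eventually_exp_dominates[OF speed_at_top]) simp
  ultimately show ?thesis
    using eventually_block_var[OF d(1)] eventually_a_pos eventually_ge_at_top[of 1] eventually_total_ge[OF d(1)]
  proof eventually_elim
    case (elim n)
    let ?m = "real (m n)" and ?k = "real (n div m n)" and ?E = "{\<omega> \<in> space M. \<epsilon> \<le> \<bar>quad n \<omega> / real n - sigma2\<bar>}"
    define u where "u = c * speed n / real n"
    have n: "real n > 0" "a n > 0" using elim by auto
    have u: "u \<ge> 0" unfolding u_def speed_def using c n by simp
    have small: "u * (b * ?m)\<^sup>2 \<le> d"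
    proof -
      have "u * (b * ?m)\<^sup>2 = c * b\<^sup>2 * (1 * ?m / (a n * sqrt (real n)))\<^sup>2"
        unfolding u_def speed_def using n by (simp add: power_divide power_mult_distrib)
      then show ?thesis using elim by linarith
    qed
    have un: "u * real n * (\<epsilon> / 2) = speed n * (\<bar>A\<bar> + 1)"
      unfolding u_def c_def using n assms by simp
    have meas: "quad n \<in> borel_measurable M" using quad_LinfM by (rule Linf_measurable)
    note [measurable] = meas
    let ?up = "{\<omega> \<in> space M. real n * (sigma2 + \<epsilon>) \<le> quad n \<omega>}" and ?lo = "{\<omega> \<in> space M. quad n \<omega> \<le> real n * (sigma2 - \<epsilon>)}"
    have E: "?E \<subseteq> ?up \<union> ?lo"
      using n by (auto simp: field_simps abs_if split: if_splits)
    have "prob ?up \<le> exp (- (u * (real n * (sigma2 + \<epsilon>)))) * exp (u * ?m * (sigma2 + d) * (1 + d)) ^ (n div m n)"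
    proof (rule Chernoff[OF quad_LinfM[of n]])
      show "(\<integral>\<omega>. exp (u * quad n \<omega>) \<partial>M) \<le> exp (u * ?m * (sigma2 + d) * (1 + d)) ^ (n div m n)"
        unfolding quad_def using elim u small d by (intro block_square_sum_laplace(1)) auto
    qed (use u in \<open>auto intro: mult_left_mono\<close>)
    also have "exp (u * ?m * (sigma2 + d) * (1 + d)) ^ (n div m n) = exp ((?k * ?m) * (u * ((sigma2 + d) * (1 + d))))"
      unfolding exp_of_nat_mult[symmetric] by (simp add: mult_ac)
    also have "\<dots> \<le> exp (real n * (u * ((sigma2 + d) * (1 + d))))"
      unfolding exp_le_cancel_iff using total_le[of n] u d sigma2_pos by (intro mult_right_mono) auto
    also have "\<dots> \<le> exp (real n * (u * (sigma2 + \<epsilon> / 2)))"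
      unfolding exp_le_cancel_iff using d(3) u by (intro mult_left_mono) auto
    also have "exp (- (u * (real n * (sigma2 + \<epsilon>)))) * exp (real n * (u * (sigma2 + \<epsilon> / 2))) = exp (- (speed n * (\<bar>A\<bar> + 1)))"
      unfolding un[symmetric] exp_add[symmetric] by (simp add: field_simps)
    finally have up: "prob ?up \<le> exp (- (speed n * (\<bar>A\<bar> + 1)))" by simp
    have "prob ?lo \<le> exp (- (- u * (real n * (sigma2 - \<epsilon>)))) * exp (- (u * ?m * (sigma2 - d) * (1 - d))) ^ (n div m n)"
    proof (rule Chernoff[OF quad_LinfM[of n]])
      show "(\<integral>\<omega>. exp (- u * quad n \<omega>) \<partial>M) \<le> exp (- (u * ?m * (sigma2 - d) * (1 - d))) ^ (n div m n)"
        unfolding quad_def using elim u small d by (intro block_square_sum_laplace(2)) auto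
    qed (use u in \<open>auto intro: mult_left_mono\<close>)
    also have "exp (- (u * ?m * (sigma2 - d) * (1 - d))) ^ (n div m n)
        = exp (- ((?k * ?m) * (u * ((sigma2 - d) * (1 - d)))))"
      unfolding exp_of_nat_mult[symmetric] by (simp add: mult_ac)
    also have "\<dots> \<le> exp (- (((1 - d) * real n) * (u * ((sigma2 - d) * (1 - d)))))"
      unfolding exp_le_cancel_iff neg_le_iff_le using elim u d by (intro mult_right_mono) auto
    also have "((1 - d) * real n) * (u * ((sigma2 - d) * (1 - d))) = (real n * u) * ((1 - d) * ((sigma2 - d) * (1 - d)))"
      by (simp add: mult_ac)
    also have "exp (- ((real n * u) * ((1 - d) * ((sigma2 - d) * (1 - d))))) \<le> exp (- ((real n * u) * (sigma2 - \<epsilon> / 2)))"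
      unfolding exp_le_cancel_iff neg_le_iff_le using d(3) u by (intro mult_left_mono) auto
    also have "exp (- (- u * (real n * (sigma2 - \<epsilon>)))) * exp (- ((real n * u) * (sigma2 - \<epsilon> / 2))) = exp (- (speed n * (\<bar>A\<bar> + 1)))"
      unfolding un[symmetric] exp_add[symmetric] by (simp add: field_simps)
    finally have lo: "prob ?lo \<le> exp (- (speed n * (\<bar>A\<bar> + 1)))" by simp
    have "prob ?E \<le> prob (?up \<union> ?lo)" by (rule finite_measure_mono[OF E]) measurable
    also have "\<dots> \<le> prob ?up + prob ?lo" by (rule measure_Un_le) measurable
    also have "\<dots> \<le> 2 * exp (- (speed n * (\<bar>A\<bar> + 1)))" using up lo by simp
    also have "\<dots> \<le> exp (- (speed n * A))" using elim by simp
    finally show ?case .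
  qed
qed

end

section \<open>Moderate deviations of self-normalized block sums\<close>

lemma eln_lower:
  assumes "a > 0" "exp (- (1 / a\<^sup>2 * c)) \<le> p"
  shows "ereal (- c) \<le> ereal (a\<^sup>2) * eln p"
proof -
  have p: "p > 0" using assms(2) exp_gt_zero[of "- (1 / a\<^sup>2 * c)"] by linarith
  then have "- (1 / a\<^sup>2 * c) \<le> ln p" using assms(2) by (simp add: ln_ge_iff)
  then have "a\<^sup>2 * (- (1 / a\<^sup>2 * c)) \<le> a\<^sup>2 * ln p" by (rule mult_left_mono) simp
  then show ?thesis using assms(1) p by (simp add: eln_def)
qed

lemma eln_upper:
  assumes "a > 0" "p \<le> exp (- (1 / a\<^sup>2 * c))" "p \<ge> 0"
  shows "ereal (a\<^sup>2) * eln p \<le> ereal (- c)"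
proof (cases "p = 0")
  case True
  then show ?thesis using assms(1) by (simp add: eln_def)
next
  case False
  then have p: "p > 0" using assms(3) by simp
  then have "ln p \<le> ln (exp (- (1 / a\<^sup>2 * c)))" using assms(2) by (subst ln_le_cancel_iff) auto
  then have "a\<^sup>2 * ln p \<le> a\<^sup>2 * (- (1 / a\<^sup>2 * c))" by (intro mult_left_mono) auto
  then show ?thesis using assms(1) p by (simp add: eln_def)
qed

context prob_space
begin

text \<open>The rate function increases with the absolute value. For the upper bound a set is
  therefore replaced by the two half-lines outside the largest admissible interval around 0; for the
  lower bound a small ball around one interior point is enough.\<close>

lemma moderate_deviations_of_tails:
  fixes W :: "nat \<Rightarrow> 'a \<Rightarrow> real" and a :: "nat \<Rightarrow> real"
  assumes W: "\<And>n. W n \<in> borel_measurable M"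
    and a: "\<forall>\<^sub>F n in sequentially. a n > 0"
    and s: "filterlim (\<lambda>n. 1 / (a n)\<^sup>2) at_top sequentially"
    and upper: "\<And>x \<epsilon>. x > 0 \<Longrightarrow> \<epsilon> > 0 \<Longrightarrow> \<forall>\<^sub>F n in sequentially.
        prob {\<omega> \<in> space M. x \<le> W n \<omega>} \<le> exp (- (1 / (a n)\<^sup>2 * (x\<^sup>2 / 2 - \<epsilon>)))"
    and upper': "\<And>x \<epsilon>. x > 0 \<Longrightarrow> \<epsilon> > 0 \<Longrightarrow> \<forall>\<^sub>F n in sequentially.
        prob {\<omega> \<in> space M. x \<le> - W n \<omega>} \<le> exp (- (1 / (a n)\<^sup>2 * (x\<^sup>2 / 2 - \<epsilon>)))"
    and lower: "\<And>x \<delta> \<epsilon>. \<delta> > 0 \<Longrightarrow> \<epsilon> > 0 \<Longrightarrow> \<forall>\<^sub>F n in sequentially.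
        exp (- (1 / (a n)\<^sup>2 * (x\<^sup>2 / 2 + \<epsilon>))) \<le> prob {\<omega> \<in> space M. \<bar>W n \<omega> - x\<bar> < \<delta>}"
    and B: "B \<in> sets borel"
  shows "- (INF x\<in>interior B. ereal (x\<^sup>2 / 2))
      \<le> liminf (\<lambda>n. ereal ((a n)\<^sup>2) * eln (prob {\<omega> \<in> space M. W n \<omega> \<in> B}))" (is "- ?Ii \<le> liminf ?L")
    and "limsup (\<lambda>n. ereal ((a n)\<^sup>2) * eln (prob {\<omega> \<in> space M. W n \<omega> \<in> B}))
      \<le> - (INF x\<in>closure B. ereal (x\<^sup>2 / 2))" (is "_ \<le> - ?Ic")
proof -
  note [measurable] = W B
  have "- liminf ?L \<le> ereal (x\<^sup>2 / 2)" if x: "x \<in> interior B" for x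
  proof -
    obtain \<delta> where \<delta>: "\<delta> > 0" "ball x \<delta> \<subseteq> B" using x by (auto simp: mem_interior)
    have "ereal (- (x\<^sup>2 / 2)) \<le> liminf ?L"
    proof (rule ereal_le_epsilon2)
      fix \<epsilon> :: real assume \<epsilon>: "\<epsilon> > 0"
      have "\<forall>\<^sub>F n in sequentially. ereal (- (x\<^sup>2 / 2 + \<epsilon>)) \<le> ?L n"
        using lower[OF \<delta>(1) \<epsilon>, of x] a
      proof eventually_elim
        case (elim n)
        have "prob {\<omega> \<in> space M. \<bar>W n \<omega> - x\<bar> < \<delta>} \<le> prob {\<omega> \<in> space M. W n \<omega> \<in> B}"
          using \<delta>(2) by (intro finite_measure_mono) (auto simp: subset_eq dist_real_def abs_minus_commute)
        then show ?case using elim by (intro eln_lower) auto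
      qed
      then have "ereal (- (x\<^sup>2 / 2 + \<epsilon>)) \<le> liminf ?L" by (rule Liminf_bounded)
      then have "ereal (- (x\<^sup>2 / 2 + \<epsilon>)) + ereal \<epsilon> \<le> liminf ?L + ereal \<epsilon>" by (rule add_right_mono)
      then show "ereal (- (x\<^sup>2 / 2)) \<le> liminf ?L + ereal \<epsilon>" by simp
    qed
    then show ?thesis using ereal_uminus_le_reorder by fastforce
  qed
  then have "- liminf ?L \<le> ?Ii" by (rule INF_greatest)
  then show "- ?Ii \<le> liminf ?L" by (simp add: ereal_uminus_le_reorder)
  have L0: "limsup ?L \<le> 0"
  proof (rule Limsup_bounded)
    show "\<forall>\<^sub>F n in sequentially. ?L n \<le> 0"
      using a
    proof eventually_elim
      case (elim n)
      then show ?case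
        using eln_upper[of "a n" "prob {\<omega> \<in> space M. W n \<omega> \<in> B}" 0] by (simp add: zero_ereal_def)
    qed
  qed
  \<comment> \<open>For \<open>c\<close> strictly below the infimum, every point of \<open>B\<close>
    lies beyond sqrt (2 c) in absolute value. The union bound then costs only a factor 2, which is
    paid from \<epsilon>.\<close>
  have Lc: "limsup ?L \<le> ereal (- c)" if c: "c > 0" "ereal c < ?Ic" for c
  proof (rule ereal_le_epsilon2)
    fix \<epsilon> :: real assume \<epsilon>: "\<epsilon> > 0"
    define x where "x = sqrt (2 * c)"
    have x: "x > 0" "x\<^sup>2 / 2 = c" using c by (auto simp: x_def)
    have Bx: "x \<le> y \<or> x \<le> - y" if "y \<in> B" for y
    proof -
      have "?Ic \<le> ereal (y\<^sup>2 / 2)" using that closure_subset by (intro INF_lower) auto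
      then have "ereal c < ereal (y\<^sup>2 / 2)" using c(2) by (rule less_le_trans[rotated])
      then have "x\<^sup>2 < \<bar>y\<bar>\<^sup>2" using x by simp
      then have "x < \<bar>y\<bar>" by (rule power2_less_imp_less) simp
      then show ?thesis by linarith
    qed
    have "\<forall>\<^sub>F n in sequentially. 2 * exp (- (1 / (a n)\<^sup>2 * (c - \<epsilon> / 2))) \<le> exp (- (1 / (a n)\<^sup>2 * (c - \<epsilon>)))"
      using \<epsilon> by (intro eventually_exp_dominates[OF s]) simp
    then have "\<forall>\<^sub>F n in sequentially. ?L n \<le> ereal (- (c - \<epsilon>))"
      using upper[OF x(1) half_gt_zero[OF \<epsilon>]] upper'[OF x(1) half_gt_zero[OF \<epsilon>]] a
    proof eventually_elim
      case (elim n)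
      have "prob {\<omega> \<in> space M. W n \<omega> \<in> B}
          \<le> prob ({\<omega> \<in> space M. x \<le> W n \<omega>} \<union> {\<omega> \<in> space M. x \<le> - W n \<omega>})"
        using Bx by (intro finite_measure_mono) auto
      also have "\<dots> \<le> prob {\<omega> \<in> space M. x \<le> W n \<omega>} + prob {\<omega> \<in> space M. x \<le> - W n \<omega>}"
        by (rule measure_Un_le) measurable
      also have "\<dots> \<le> exp (- (1 / (a n)\<^sup>2 * (c - \<epsilon>)))"
        using elim unfolding x(2) by linarith
      finally show ?case using elim by (intro eln_upper) auto
    qed
    then have "limsup ?L \<le> ereal (- (c - \<epsilon>))" by (rule Limsup_bounded)
    then show "limsup ?L \<le> ereal (- c) + ereal \<epsilon>" by simp
  qed
  \<comment> \<open>Passing through a real \<open>c\<close> between the two sides covers an infinite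
    infimum, as for empty \<open>B\<close>; \<open>L0\<close> guarantees that this \<open>c\<close>
    is positive, also when the infimum is 0 or small.\<close>
  show "limsup ?L \<le> - ?Ic"
  proof (rule ccontr)
    assume "\<not> limsup ?L \<le> - ?Ic"
    then have "- limsup ?L < ?Ic" by (simp add: not_le ereal_uminus_less_reorder)
    then obtain c where c: "- limsup ?L < ereal c" "ereal c < ?Ic" using ereal_dense2 by blast
    have "0 \<le> - limsup ?L" using L0 by (simp add: ereal_uminus_le_reorder)
    then have "0 < ereal c" using c(1) by (rule le_less_trans)
    then have "limsup ?L \<le> ereal (- c)" using Lc c(2) by simp
    then have "- ereal (- c) \<le> - limsup ?L" by (subst ereal_minus_le_minus)
    then have "ereal c \<le> - limsup ?L" by simp
    then show False using c(1) by simp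
  qed
qed

end

section \<open>From the martingale and the sum of squares to the ratio\<close>

context block_scaling
begin

definition ratio :: "nat \<Rightarrow> 'a \<Rightarrow> real" where
  "ratio n \<omega> = (if quad n \<omega> = 0 then 0 else (mart n \<omega> + drift n \<omega>) / sqrt (quad n \<omega>))"

lemma ratio_measurable: "ratio n \<in> borel_measurable M"
proof -
  note [measurable] = mart_LinfM[THEN Linf_measurable] drift_LinfM[THEN Linf_measurable]
    quad_LinfM[THEN Linf_measurable]
  show ?thesis unfolding ratio_def[abs_def] by measurable
qed

lemma ratio_eq:
  assumes "n \<ge> 1" "quad n \<omega> / real n > 0"
  shows "a n * ratio n \<omega> = (a n * mart n \<omega> / sqrt (real n) + a n * drift n \<omega> / sqrt (real n))
    / sqrt (quad n \<omega> / real n)"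
proof -
  have "quad n \<omega> > 0" using assms by (simp add: zero_less_divide_iff)
  moreover have "sqrt (real n) > 0" using assms(1) by simp
  ultimately show ?thesis by (simp add: ratio_def real_sqrt_divide field_simps)
qed

lemma scaled_mart_measurable: "(\<lambda>\<omega>. r * (a n * mart n \<omega> / sqrt (real n))) \<in> borel_measurable M"
  by (rule Linf_measurable) (use mart_LinfM in auto)

lemma scaled_mart_integrable: "integrable M (\<lambda>\<omega>. exp (t * (r * (a n * mart n \<omega> / sqrt (real n)))))"
  by (rule Linf_integrable) (use mart_LinfM in auto)

text \<open>The sign \<open>r\<close> treats both tails at once. If the drift is below \<rho> and
  the normalised sum of squares is within \<rho> of \<open>sigma2\<close>, a large ratio forces the
  martingale above x sqrt (sigma2 - \<rho>) - \<rho>; the exceptional events are negligible at this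
  speed.\<close>

lemma ratio_upper_tail:
  assumes "x > 0" "\<epsilon> > 0" and r: "r\<^sup>2 = 1"
  shows "\<forall>\<^sub>F n in sequentially.
    prob {\<omega> \<in> space M. x \<le> r * (a n * ratio n \<omega>)} \<le> exp (- (speed n * (x\<^sup>2 / 2 - \<epsilon>)))"
proof -
  have r1: "\<bar>r\<bar> = 1" using r power2_eq_1_iff by fastforce
  \<comment> \<open>\<open>?y\<close> is the level left for the martingale. Negativity of the
    maximum below packs two requirements: this level is positive, and its rate is within \<epsilon>
    / 4 of x^2 / 2.\<close>
  let ?y = "\<lambda>\<rho>. x * sqrt (sigma2 - \<rho>) - \<rho>"
  obtain \<rho> where \<rho>: "0 < \<rho>" "\<rho> < sigma2" "max (- ?y \<rho>) (x\<^sup>2 / 2 - (?y \<rho>)\<^sup>2 / (2 * sigma2) - \<epsilon> / 4) < 0"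
  proof (rule obtain_small)
    show "isCont (\<lambda>\<rho>. max (- ?y \<rho>) (x\<^sup>2 / 2 - (?y \<rho>)\<^sup>2 / (2 * sigma2) - \<epsilon> / 4)) 0"
      using sigma2_pos by (intro continuous_intros) auto
    show "max (- ?y 0) (x\<^sup>2 / 2 - (?y 0)\<^sup>2 / (2 * sigma2) - \<epsilon> / 4) < 0"
      using assms sigma2_pos by (simp add: power_mult_distrib)
  qed (rule sigma2_pos)
  define y where "y = ?y \<rho>"
  have y: "y > 0" "x\<^sup>2 / 2 - \<epsilon> / 4 < y\<^sup>2 / (2 * sigma2)" using \<rho>(3) unfolding y_def by auto
  have "\<forall>\<^sub>F n in sequentially. prob {\<omega> \<in> space M. y \<le> r * (a n * mart n \<omega> / sqrt (real n))}
      \<le> exp (- (speed n * (y\<^sup>2 / (2 * sigma2) - \<epsilon> / 4)))"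
  proof (rule quadratic_Laplace_upper_tail[OF scaled_mart_measurable scaled_mart_integrable])
    show "\<forall>\<^sub>F n in sequentially. speed n > 0" using speed_at_top by (simp add: filterlim_at_top_dense)
    fix t e :: real assume "e > 0"
    then show "\<forall>\<^sub>F n in sequentially. (\<integral>\<omega>. exp (t * speed n * (r * (a n * mart n \<omega> / sqrt (real n)))) \<partial>M)
        \<le> exp (speed n * (t\<^sup>2 * sigma2 / 2 + e))"
      using mart_Laplace_upper[of e "t * r"] r by (simp add: power_mult_distrib mult_ac)
  qed (use y sigma2_pos assms in auto)
  moreover have "\<forall>\<^sub>F n in sequentially. 3 * exp (- (speed n * (x\<^sup>2 / 2 - \<epsilon> / 2))) \<le> exp (- (speed n * (x\<^sup>2 / 2 - \<epsilon>)))"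
    using assms by (intro eventually_exp_dominates[OF speed_at_top]) simp
  ultimately show ?thesis
    using drift_negligible[OF \<rho>(1), of "x\<^sup>2 / 2 - \<epsilon> / 2"] quad_concentration[OF \<rho>(1), of "x\<^sup>2 / 2 - \<epsilon> / 2"]
      eventually_ge_at_top[of 1]
  proof eventually_elim
    case (elim n)
    note [measurable] = mart_LinfM[THEN Linf_measurable] drift_LinfM[THEN Linf_measurable]
      quad_LinfM[THEN Linf_measurable]
    let ?Z = "\<lambda>\<omega>. a n * mart n \<omega> / sqrt (real n)" and ?R = "\<lambda>\<omega>. a n * drift n \<omega> / sqrt (real n)"
      and ?Q = "\<lambda>\<omega>. quad n \<omega> / real n"
    let ?A = "{\<omega> \<in> space M. y \<le> r * ?Z \<omega>}" and ?B = "{\<omega> \<in> space M. \<rho> \<le> \<bar>?R \<omega>\<bar>}"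
      and ?C = "{\<omega> \<in> space M. \<rho> \<le> \<bar>?Q \<omega> - sigma2\<bar>}"
    have "{\<omega> \<in> space M. x \<le> r * (a n * ratio n \<omega>)} \<subseteq> ?A \<union> (?B \<union> ?C)"
    proof
      fix \<omega> assume \<omega>: "\<omega> \<in> {\<omega> \<in> space M. x \<le> r * (a n * ratio n \<omega>)}"
      show "\<omega> \<in> ?A \<union> (?B \<union> ?C)"
      proof (rule ccontr)
        assume "\<omega> \<notin> ?A \<union> (?B \<union> ?C)"
        then have *: "r * ?Z \<omega> < y" "\<bar>?R \<omega>\<bar> < \<rho>" "\<bar>?Q \<omega> - sigma2\<bar> < \<rho>" using \<omega> by auto
        have Q: "?Q \<omega> > 0" "sqrt (sigma2 - \<rho>) \<le> sqrt (?Q \<omega>)" using * \<rho> by auto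
        have "x * sqrt (sigma2 - \<rho>) \<le> x * sqrt (?Q \<omega>)" using Q(2) assms by (intro mult_left_mono) auto
        also have "\<dots> \<le> r * (a n * ratio n \<omega>) * sqrt (?Q \<omega>)" using \<omega> Q by (intro mult_right_mono) auto
        also have "\<dots> = r * ?Z \<omega> + r * ?R \<omega>"
        proof -
          have aux: "r * ((z + w) / s) * s = r * z + r * w" if "s > 0" for z w s :: real
            using that by (simp add: field_simps)
          show ?thesis unfolding ratio_eq[OF elim(5) Q(1)] by (rule aux) (use Q(1) in simp)
        qed
        also have "r * ?R \<omega> \<le> \<rho>"
        proof -
          have "r * ?R \<omega> \<le> \<bar>r\<bar> * \<bar>?R \<omega>\<bar>" by (metis abs_ge_self abs_mult)
          then show ?thesis using * r1 by simp
        qed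
        finally show False using *(1) unfolding y_def by linarith
      qed
    qed
    then have "prob {\<omega> \<in> space M. x \<le> r * (a n * ratio n \<omega>)} \<le> prob (?A \<union> (?B \<union> ?C))"
      by (rule finite_measure_mono) measurable
    also have "\<dots> \<le> prob ?A + prob (?B \<union> ?C)" by (rule measure_Un_le) measurable
    also have "prob (?B \<union> ?C) \<le> prob ?B + prob ?C" by (rule measure_Un_le) measurable
    also have "prob ?A \<le> exp (- (speed n * (x\<^sup>2 / 2 - \<epsilon> / 2)))"
    proof -
      have "speed n * (x\<^sup>2 / 2 - \<epsilon> / 2) \<le> speed n * (y\<^sup>2 / (2 * sigma2) - \<epsilon> / 4)"
        using y(2) by (intro mult_left_mono) (auto simp: speed_def)
      then have "exp (- (speed n * (y\<^sup>2 / (2 * sigma2) - \<epsilon> / 4))) \<le> exp (- (speed n * (x\<^sup>2 / 2 - \<epsilon> / 2)))" by simp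
      then show ?thesis using elim by linarith
    qed
    finally show ?case using elim by linarith
  qed
qed

text \<open>The ratio is a function of martingale, drift and sum of squares that is continuous at (x
  sqrt sigma2, 0, sigma2). Localising the martingale thus localises the ratio, except on events
  whose probability is negligible.\<close>

lemma ratio_local_lower:
  assumes "\<delta> > 0" "\<epsilon> > 0"
  shows "\<forall>\<^sub>F n in sequentially.
    exp (- (speed n * (x\<^sup>2 / 2 + \<epsilon>))) \<le> prob {\<omega> \<in> space M. \<bar>a n * ratio n \<omega> - x\<bar> < \<delta>}"
proof -
  define x' where "x' = x * sqrt sigma2"
  let ?F = "\<lambda>p :: real \<times> real \<times> real. (fst p + fst (snd p)) / sqrt (snd (snd p))"
  have F0: "?F (x', 0, sigma2) = x" unfolding x'_def using sigma2_pos by simp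
  have "isCont ?F (x', 0, sigma2)" using sigma2_pos by (intro continuous_intros) auto
  then obtain d where d: "d > 0" "\<And>p. dist p (x', 0, sigma2) < d \<Longrightarrow> dist (?F p) x < \<delta>"
    unfolding continuous_at_eps_delta F0 using assms(1) by blast
  have close: "\<bar>(z + r) / sqrt w - x\<bar> < \<delta>" if "\<bar>z - x'\<bar> < d / 3" "\<bar>r\<bar> < d / 3" "\<bar>w - sigma2\<bar> < d / 3" for z r w
  proof -
    have "dist (z, r, w) (x', 0, sigma2) \<le> \<bar>z - x'\<bar> + dist (r, w) (0, sigma2)"
      using sqrt_sum_squares_le_sum[of "\<bar>z - x'\<bar>" "dist (r, w) (0, sigma2)"]
      by (simp add: dist_prod_def dist_real_def)
    also have "dist (r, w) (0, sigma2) \<le> \<bar>r\<bar> + \<bar>w - sigma2\<bar>"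
      using sqrt_sum_squares_le_sum[of "\<bar>r\<bar>" "\<bar>w - sigma2\<bar>"]
      by (simp add: dist_prod_def dist_real_def)
    finally have "dist (z, r, w) (x', 0, sigma2) < d" using that by linarith
    from d(2)[OF this] show ?thesis by (simp add: dist_real_def)
  qed
  obtain \<rho> where \<rho>: "0 < \<rho>" "\<rho> < min (d / 3) sigma2"
      "\<bar>x' / sigma2\<bar> * \<rho> + \<rho>\<^sup>2 / (4 * sigma2) < \<epsilon> / 2"
  proof (rule obtain_small)
    show "isCont (\<lambda>\<rho>. \<bar>x' / sigma2\<bar> * \<rho> + \<rho>\<^sup>2 / (4 * sigma2)) 0"
      using sigma2_pos by (intro continuous_intros) auto
    show "\<bar>x' / sigma2\<bar> * 0 + 0\<^sup>2 / (4 * sigma2) < \<epsilon> / 2" using assms by simp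
    show "min (d / 3) sigma2 > 0" using d sigma2_pos by simp
  qed
  have x'2: "x'\<^sup>2 / (2 * sigma2) = x\<^sup>2 / 2" unfolding x'_def using sigma2_pos by (simp add: power_mult_distrib)
  have "\<forall>\<^sub>F n in sequentially. exp (- (speed n * (x'\<^sup>2 / (2 * sigma2) + \<bar>x' / sigma2\<bar> * \<rho> + \<rho>\<^sup>2 / (4 * sigma2))))
      \<le> prob {\<omega> \<in> space M. \<bar>a n * mart n \<omega> / sqrt (real n) - x'\<bar> < \<rho>}"
  proof (rule quadratic_Laplace_local_lower[OF _ _ speed_at_top mart_Laplace_upper mart_Laplace_lower sigma2_pos \<rho>(1)])
    show "(\<lambda>\<omega>. a n * mart n \<omega> / sqrt (real n)) \<in> borel_measurable M" for n
      using scaled_mart_measurable[of 1 n] by simp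
    show "integrable M (\<lambda>\<omega>. exp (t * (a n * mart n \<omega> / sqrt (real n))))" for n t
      using scaled_mart_integrable[of t 1 n] by simp
  qed
  \<comment> \<open>Of the factor 3, two parts pay for the two exceptional events and one remains as
    the lower bound.\<close>
  moreover have "\<forall>\<^sub>F n in sequentially. 3 * exp (- (speed n * (x\<^sup>2 / 2 + \<epsilon>))) \<le> exp (- (speed n * (x\<^sup>2 / 2 + \<epsilon> / 2)))"
    using assms by (intro eventually_exp_dominates[OF speed_at_top]) simp
  ultimately show ?thesis
    using drift_negligible[OF \<rho>(1), of "x\<^sup>2 / 2 + \<epsilon>"] quad_concentration[OF \<rho>(1), of "x\<^sup>2 / 2 + \<epsilon>"]
      eventually_ge_at_top[of 1]
  proof eventually_elim
    case (elim n)
    note [measurable] = mart_LinfM[THEN Linf_measurable] drift_LinfM[THEN Linf_measurable]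
      quad_LinfM[THEN Linf_measurable] ratio_measurable
    let ?Z = "\<lambda>\<omega>. a n * mart n \<omega> / sqrt (real n)" and ?R = "\<lambda>\<omega>. a n * drift n \<omega> / sqrt (real n)"
      and ?Q = "\<lambda>\<omega>. quad n \<omega> / real n"
    let ?A = "{\<omega> \<in> space M. \<bar>a n * ratio n \<omega> - x\<bar> < \<delta>}" and ?B = "{\<omega> \<in> space M. \<rho> \<le> \<bar>?R \<omega>\<bar>}"
      and ?C = "{\<omega> \<in> space M. \<rho> \<le> \<bar>?Q \<omega> - sigma2\<bar>}"
    have "{\<omega> \<in> space M. \<bar>?Z \<omega> - x'\<bar> < \<rho>} \<subseteq> ?A \<union> (?B \<union> ?C)"
    proof
      fix \<omega> assume \<omega>: "\<omega> \<in> {\<omega> \<in> space M. \<bar>?Z \<omega> - x'\<bar> < \<rho>}"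
      show "\<omega> \<in> ?A \<union> (?B \<union> ?C)"
      proof (cases "\<omega> \<in> ?B \<union> ?C")
        case False
        then have *: "\<bar>?R \<omega>\<bar> < \<rho>" "\<bar>?Q \<omega> - sigma2\<bar> < \<rho>" using \<omega> by auto
        have Q: "?Q \<omega> > 0" using * \<rho> by auto
        have "\<bar>(?Z \<omega> + ?R \<omega>) / sqrt (?Q \<omega>) - x\<bar> < \<delta>" 
        proof (rule close)
          show "\<bar>?Z \<omega> - x'\<bar> < d / 3" "\<bar>?R \<omega>\<bar> < d / 3" "\<bar>?Q \<omega> - sigma2\<bar> < d / 3"
            using * \<rho>(2) \<omega> by (simp_all only: min_less_iff_conj mem_Collect_eq) linarith+
        qed
        then show ?thesis using ratio_eq[OF elim(5) Q] \<omega> by simp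
      qed simp
    qed
    then have "prob {\<omega> \<in> space M. \<bar>?Z \<omega> - x'\<bar> < \<rho>} \<le> prob (?A \<union> (?B \<union> ?C))"
      by (rule finite_measure_mono) measurable
    also have "\<dots> \<le> prob ?A + prob (?B \<union> ?C)" by (rule measure_Un_le) measurable
    also have "prob (?B \<union> ?C) \<le> prob ?B + prob ?C" by (rule measure_Un_le) measurable
    finally have "prob {\<omega> \<in> space M. \<bar>?Z \<omega> - x'\<bar> < \<rho>} \<le> prob ?A + 2 * exp (- (speed n * (x\<^sup>2 / 2 + \<epsilon>)))"
      using elim by linarith
    moreover have "exp (- (speed n * (x\<^sup>2 / 2 + \<epsilon> / 2))) \<le> prob {\<omega> \<in> space M. \<bar>?Z \<omega> - x'\<bar> < \<rho>}"
    proof -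
      have "speed n * (x'\<^sup>2 / (2 * sigma2) + \<bar>x' / sigma2\<bar> * \<rho> + \<rho>\<^sup>2 / (4 * sigma2)) \<le> speed n * (x\<^sup>2 / 2 + \<epsilon> / 2)"
        using \<rho>(3) unfolding x'2 by (intro mult_left_mono) (auto simp: speed_def)
      then have "exp (- (speed n * (x\<^sup>2 / 2 + \<epsilon> / 2)))
          \<le> exp (- (speed n * (x'\<^sup>2 / (2 * sigma2) + \<bar>x' / sigma2\<bar> * \<rho> + \<rho>\<^sup>2 / (4 * sigma2))))" by simp
      then show ?thesis using elim by linarith
    qed
    ultimately show ?case using elim by linarith
  qed
qed

lemma block_self_normalized_eq: "block_self_normalized (\<lambda>i. X i \<omega>) (m n) n = ratio n \<omega>"
proof -
  have "block_sum (\<lambda>i. X i \<omega>) (m n) (Suc j) = block X (m n * j) (m n) \<omega>" for j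
    unfolding block_sum_def block_def by (simp add: add.commute)
  moreover have "(\<Sum>j=1..n div m n. g j) = (\<Sum>j<n div m n. g (Suc j))" for g :: "nat \<Rightarrow> real"
    using sum.atLeast1_atMost_eq[of g "n div m n"] by simp
  ultimately have 1: "(\<Sum>j=1..n div m n. block_sum (\<lambda>i. X i \<omega>) (m n) j) = mart n \<omega> + drift n \<omega>"
    and 2: "block_norm (\<lambda>i. X i \<omega>) (m n) n = sqrt (quad n \<omega>)"
    unfolding block_norm_def mart_def drift_def quad_def fluct_def by (simp_all add: sum_subtractf)
  show ?thesis unfolding block_self_normalized_def 1 2 ratio_def by simp
qed

theorem block_moderate_deviations:
  assumes "B \<in> sets borel"
  shows "- (INF x\<in>interior B. ereal (x\<^sup>2 / 2))
      \<le> liminf (\<lambda>n. ereal ((a n)\<^sup>2) * eln (prob {\<omega> \<in> space M. a n * block_self_normalized (\<lambda>i. X i \<omega>) (m n) n \<in> B}))"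
    and "limsup (\<lambda>n. ereal ((a n)\<^sup>2) * eln (prob {\<omega> \<in> space M. a n * block_self_normalized (\<lambda>i. X i \<omega>) (m n) n \<in> B}))
      \<le> - (INF x\<in>closure B. ereal (x\<^sup>2 / 2))"
proof -
  have meas: "(\<lambda>\<omega>. a n * ratio n \<omega>) \<in> borel_measurable M" for n using ratio_measurable by auto
  note tails = ratio_upper_tail[where r = 1, simplified] ratio_upper_tail[where r = "- 1", simplified]
    ratio_local_lower
  note MDP = moderate_deviations_of_tails[OF meas eventually_a_pos speed_at_top[unfolded speed_def[abs_def]]
      tails[unfolded speed_def] assms]
  show "- (INF x\<in>interior B. ereal (x\<^sup>2 / 2))
      \<le> liminf (\<lambda>n. ereal ((a n)\<^sup>2) * eln (prob {\<omega> \<in> space M. a n * block_self_normalized (\<lambda>i. X i \<omega>) (m n) n \<in> B}))"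
    unfolding block_self_normalized_eq by (rule MDP(1))
  show "limsup (\<lambda>n. ereal ((a n)\<^sup>2) * eln (prob {\<omega> \<in> space M. a n * block_self_normalized (\<lambda>i. X i \<omega>) (m n) n \<in> B}))
      \<le> - (INF x\<in>closure B. ereal (x\<^sup>2 / 2))"
    unfolding block_self_normalized_eq by (rule MDP(2))
qed

end

section \<open>Stationary Markov chains\<close>

text \<open>Bounded everywhere and not only almost everywhere: kernel integrals then exist at every
  point, and the class is stable under the kernels.\<close>

definition bounded_borel :: "(real \<Rightarrow> real) set" where
  "bounded_borel = {u \<in> borel_measurable borel. \<exists>B. \<forall>x. \<bar>u x\<bar> \<le> B}"

lemma bounded_borelI: "u \<in> borel_measurable borel \<Longrightarrow> (\<And>x. \<bar>u x\<bar> \<le> B) \<Longrightarrow> u \<in> bounded_borel"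
  unfolding bounded_borel_def by auto

lemma bounded_borel_measurable: "u \<in> bounded_borel \<Longrightarrow> u \<in> borel_measurable borel"
  unfolding bounded_borel_def by auto

lemma bounded_borel_bound:
  assumes "u \<in> bounded_borel"
  obtains B where "B \<ge> 0" "\<And>x. \<bar>u x\<bar> \<le> B"
proof -
  obtain B where B: "\<And>x. \<bar>u x\<bar> \<le> B" using assms unfolding bounded_borel_def by auto
  have "B \<ge> 0" using B[of 0] by linarith
  then show thesis using that B by blast
qed

lemma bounded_borel_const [intro!]: "(\<lambda>_. c) \<in> bounded_borel"
  by (rule bounded_borelI[where B = "\<bar>c\<bar>"]) auto

lemma bounded_borel_add [intro!]:
  assumes "u \<in> bounded_borel" "v \<in> bounded_borel" shows "(\<lambda>x. u x + v x) \<in> bounded_borel"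
proof -
  obtain B B' where B: "\<And>x. \<bar>u x\<bar> \<le> B" "\<And>x. \<bar>v x\<bar> \<le> B'"
    using bounded_borel_bound[OF assms(1)] bounded_borel_bound[OF assms(2)] by metis
  have "\<bar>u x + v x\<bar> \<le> B + B'" for x using B[of x] by linarith
  then show ?thesis using assms[THEN bounded_borel_measurable] by (intro bounded_borelI) auto
qed

lemma bounded_borel_mult [intro!]:
  assumes "u \<in> bounded_borel" "v \<in> bounded_borel" shows "(\<lambda>x. u x * v x) \<in> bounded_borel"
proof -
  obtain B B' where B: "\<And>x. \<bar>u x\<bar> \<le> B" "B \<ge> 0" "\<And>x. \<bar>v x\<bar> \<le> B'"
    using bounded_borel_bound[OF assms(1)] bounded_borel_bound[OF assms(2)] by metis
  have "\<bar>u x * v x\<bar> \<le> B * B'" for x unfolding abs_mult using B by (intro mult_mono) auto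
  then show ?thesis using assms[THEN bounded_borel_measurable] by (intro bounded_borelI) auto
qed

lemma bounded_borel_diff [intro!]:
  assumes "u \<in> bounded_borel" "v \<in> bounded_borel" shows "(\<lambda>x. u x - v x) \<in> bounded_borel"
  using bounded_borel_add[OF assms(1) bounded_borel_mult[OF bounded_borel_const[of "-1"] assms(2)]] by simp

lemma bounded_borel_integrable:
  assumes "prob_space P" "sets P = sets borel" "u \<in> bounded_borel"
  shows "integrable P u"
proof -
  interpret P: prob_space P by fact
  obtain B where "\<And>x. \<bar>u x\<bar> \<le> B" using bounded_borel_bound[OF assms(3)] by blast
  then show ?thesis
    using bounded_borel_measurable[OF assms(3)] measurable_cong_sets[OF assms(2) refl]
    by (intro P.integrable_const_bound[where B = B]) auto
qed

lemma integral_bound_prob: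
  assumes "prob_space P" "sets P = sets borel" "u \<in> bounded_borel" "AE x in P. \<bar>u x\<bar> \<le> B"
  shows "\<bar>\<integral>x. u x \<partial>P\<bar> \<le> B"
proof -
  interpret P: prob_space P by fact
  have i: "integrable P u" by (rule bounded_borel_integrable[OF assms(1-3)])
  have "(\<integral>x. u x \<partial>P) \<le> (\<integral>x. B \<partial>P)" "(\<integral>x. - B \<partial>P) \<le> (\<integral>x. u x \<partial>P)"
    using i assms(4) by (intro integral_mono_AE; auto elim: eventually_mono)+
  then show ?thesis by (simp add: P.prob_space abs_le_iff)
qed

text \<open>Facts about kernel composition and the Markov property are obtained for non-negative
  integrals; adding the bound \<open>B\<close> carries them over to signed functions.\<close>

lemma shifted_nn_integral:
  assumes "prob_space P" "sets P = sets borel" "u \<in> bounded_borel" "\<And>x. \<bar>u x\<bar> \<le> B"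
  shows "(\<integral>\<^sup>+x. ennreal (u x + B) \<partial>P) = ennreal ((\<integral>x. u x \<partial>P) + B)"
proof -
  interpret P: prob_space P by fact
  have i: "integrable P u" by (rule bounded_borel_integrable[OF assms(1-3)])
  have "0 \<le> u x + B" for x using assms(4)[of x] by linarith
  then have "(\<integral>\<^sup>+x. ennreal (u x + B) \<partial>P) = ennreal (\<integral>x. u x + B \<partial>P)"
    using i by (intro nn_integral_eq_integral) auto
  then show ?thesis using i by (simp add: P.prob_space)
qed

lemma square_integral_le:
  assumes "prob_space P" "sets P = sets borel" "u \<in> bounded_borel"
  shows "(\<integral>x. u x \<partial>P)\<^sup>2 \<le> (\<integral>x. (u x)\<^sup>2 \<partial>P)"
proof -
  interpret P: prob_space P by fact
  have "(\<lambda>x. (u x)\<^sup>2) \<in> bounded_borel" unfolding power2_eq_square using assms(3) by auto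
  then have "P.variance u = (\<integral>x. (u x)\<^sup>2 \<partial>P) - (\<integral>x. u x \<partial>P)\<^sup>2"
    using bounded_borel_integrable[OF assms(1,2)] assms(3) by (intro P.variance_eq) auto
  moreover have "0 \<le> P.variance u" by simp
  ultimately show ?thesis by linarith
qed

locale stationary_chain =
  fixes M :: "'w measure" and Y :: "nat \<Rightarrow> 'w \<Rightarrow> real" and \<mu> :: "real measure" and K :: "real \<Rightarrow> real measure"
  assumes chain: "stationary_markov_chain M Y \<mu> K"
begin

section \<open>Natural filtration of the chain\<close>

lemma Y_measurable [measurable]: "Y n \<in> borel_measurable M"
  using chain unfolding stationary_markov_chain_def by auto

lemma natural_generators: "{Y i -` A \<inter> space M | i A. i \<le> n \<and> A \<in> sets borel} \<subseteq> sets M"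
  by auto

lemma sets_natural: "sets (natural_algebra M Y n)
    = sigma_sets (space M) {Y i -` A \<inter> space M | i A. i \<le> n \<and> A \<in> sets borel}"
  unfolding natural_algebra_def using natural_generators sets.sets_into_space
  by (intro sets_measure_of) blast

lemma space_natural: "space (natural_algebra M Y n) = space M"
  unfolding natural_algebra_def by (simp add: space_measure_of_conv)

sublocale filtered_prob_space M "natural_algebra M Y"
proof -
  interpret prob_space M using chain unfolding stationary_markov_chain_def by auto
  show "filtered_prob_space M (natural_algebra M Y)"
  proof unfold_locales
    show "subalgebra M (natural_algebra M Y i)" for i
      unfolding subalgebra_def sets_natural space_natural
      using sets.sigma_sets_subset[OF natural_generators] by auto
    show "sets (natural_algebra M Y i) \<subseteq> sets (natural_algebra M Y j)" if "i \<le> j" for i j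
      unfolding sets_natural using that by (intro sigma_sets_mono') (auto intro: le_trans)
  qed
qed

lemma Y_adapted: "i \<le> n \<Longrightarrow> Y i \<in> borel_measurable (natural_algebra M Y n)"
  by (rule measurableI) (auto simp: space_natural sets_natural intro!: sigma_sets.Basic)

section \<open>Kernels acting on bounded Borel functions\<close>

lemma K_measurable: "K \<in> borel \<rightarrow>\<^sub>M prob_algebra borel"
  using chain unfolding stationary_markov_chain_def by auto

lemma kernel_power_measurable: "kernel_power K n \<in> borel \<rightarrow>\<^sub>M prob_algebra borel"
proof (induction n)
  case 0
  show ?case unfolding kernel_power.simps by (rule measurable_return_prob_space)
next
  case (Suc n)
  then show ?case unfolding kernel_power.simps by (rule measurable_bind_prob_space[OF K_measurable])
qed

lemma kernel_prob: "k \<in> borel \<rightarrow>\<^sub>M prob_algebra borel \<Longrightarrow> prob_space (k x)"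
  for k :: "real \<Rightarrow> real measure"
  using measurable_space[of k borel "prob_algebra borel" x] by (simp add: space_prob_algebra)

lemma kernel_sets: "k \<in> borel \<rightarrow>\<^sub>M prob_algebra borel \<Longrightarrow> sets (k x) = sets borel"
  for k :: "real \<Rightarrow> real measure"
  using measurable_space[of k borel "prob_algebra borel" x] by (simp add: space_prob_algebra)

lemma kernel_integral_bounded_borel:
  fixes k :: "real \<Rightarrow> real measure"
  assumes k: "k \<in> borel \<rightarrow>\<^sub>M prob_algebra borel" and u: "u \<in> bounded_borel"
  shows "(\<lambda>x. \<integral>y. u y \<partial>k x) \<in> bounded_borel"
proof -
  obtain B where B: "\<And>x. \<bar>u x\<bar> \<le> B" using bounded_borel_bound[OF u] by blast
  have "(\<lambda>x. \<integral>y. u y \<partial>k x) \<in> borel_measurable borel"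
    using measurable_compose[OF measurable_prob_algebraD[OF k]
        integral_measurable_subprob_algebra[OF bounded_borel_measurable[OF u]]] .
  moreover have "\<bar>\<integral>y. u y \<partial>k x\<bar> \<le> B" for x
    using B by (intro integral_bound_prob kernel_prob[OF k] kernel_sets[OF k] u) auto
  ultimately show ?thesis by (rule bounded_borelI)
qed

lemma kernel_apply_bounded_borel: "u \<in> bounded_borel \<Longrightarrow> kernel_apply K n u \<in> bounded_borel"
  using kernel_integral_bounded_borel[OF kernel_power_measurable] by (simp add: kernel_apply_def[abs_def])

lemma K_bounded_borel: "u \<in> bounded_borel \<Longrightarrow> (\<lambda>x. \<integral>y. u y \<partial>K x) \<in> bounded_borel"
  by (rule kernel_integral_bounded_borel[OF K_measurable])

lemma kernel_apply_bound:
  assumes "u \<in> bounded_borel" "\<And>x. \<bar>u x\<bar> \<le> B" shows "\<bar>kernel_apply K n u x\<bar> \<le> B"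
  unfolding kernel_apply_def using assms
  by (intro integral_bound_prob kernel_prob[OF kernel_power_measurable] kernel_sets[OF kernel_power_measurable]) auto

lemma kernel_apply_integrable: "u \<in> bounded_borel \<Longrightarrow> integrable (kernel_power K n x) u"
  by (intro bounded_borel_integrable kernel_prob[OF kernel_power_measurable] kernel_sets[OF kernel_power_measurable])

lemma kernel_apply_diff: "u \<in> bounded_borel \<Longrightarrow> v \<in> bounded_borel \<Longrightarrow>
    kernel_apply K n (\<lambda>y. u y - v y) x = kernel_apply K n u x - kernel_apply K n v x"
  unfolding kernel_apply_def by (intro Bochner_Integration.integral_diff kernel_apply_integrable)

lemma kernel_apply_const: "kernel_apply K n (\<lambda>_. c) x = c"
proof -
  interpret P: prob_space "kernel_power K n x" by (rule kernel_prob[OF kernel_power_measurable])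
  show ?thesis unfolding kernel_apply_def by (simp add: P.prob_space)
qed

lemma kernel_apply_0: "u \<in> bounded_borel \<Longrightarrow> kernel_apply K 0 u x = u x"
  unfolding kernel_apply_def by (simp add: integral_return bounded_borel_measurable)

lemma kernel_apply_Suc:
  assumes u: "u \<in> bounded_borel"
  shows "kernel_apply K (Suc n) u x = (\<integral>y. kernel_apply K n u y \<partial>K x)"
proof -
  obtain B where B: "B \<ge> 0" "\<And>x. \<bar>u x\<bar> \<le> B" using bounded_borel_bound[OF u] by blast
  note KP = kernel_power_measurable
  have KA: "kernel_apply K n u \<in> bounded_borel" by (rule kernel_apply_bounded_borel[OF u])
  have KB: "\<bar>kernel_apply K j u y\<bar> \<le> B" for j y by (rule kernel_apply_bound[OF u B(2)])
  have "ennreal (kernel_apply K (Suc n) u x + B) = (\<integral>\<^sup>+y. ennreal (u y + B) \<partial>kernel_power K (Suc n) x)"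
    unfolding kernel_apply_def
    by (rule shifted_nn_integral[OF kernel_prob[OF KP] kernel_sets[OF KP] u B(2), symmetric])
  also have "\<dots> = (\<integral>\<^sup>+z. (\<integral>\<^sup>+y. ennreal (u y + B) \<partial>kernel_power K n z) \<partial>K x)"
    unfolding kernel_power.simps
  proof (rule nn_integral_bind)
    show "(\<lambda>y. ennreal (u y + B)) \<in> borel_measurable borel"
      using bounded_borel_measurable[OF u] by measurable
    show "kernel_power K n \<in> K x \<rightarrow>\<^sub>M subprob_algebra borel"
      using measurable_prob_algebraD[OF KP] measurable_cong_sets[OF kernel_sets[OF K_measurable] refl] by blast
  qed
  also have "\<dots> = (\<integral>\<^sup>+z. ennreal (kernel_apply K n u z + B) \<partial>K x)"
    unfolding kernel_apply_def
    by (intro nn_integral_cong shifted_nn_integral[OF kernel_prob[OF KP] kernel_sets[OF KP] u B(2)])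
  also have "\<dots> = ennreal ((\<integral>y. kernel_apply K n u y \<partial>K x) + B)"
    by (rule shifted_nn_integral[OF kernel_prob[OF K_measurable] kernel_sets[OF K_measurable] KA KB])
  finally have "ennreal (kernel_apply K (Suc n) u x + B) = ennreal ((\<integral>y. kernel_apply K n u y \<partial>K x) + B)" .
  moreover have "0 \<le> kernel_apply K (Suc n) u x + B" using KB[of "Suc n" x] by linarith
  moreover have "\<bar>\<integral>y. kernel_apply K n u y \<partial>K x\<bar> \<le> B"
    using KA KB by (intro integral_bound_prob kernel_prob[OF K_measurable] kernel_sets[OF K_measurable]) auto
  then have "0 \<le> (\<integral>y. kernel_apply K n u y \<partial>K x) + B" by linarith
  ultimately show ?thesis by simp
qed

text \<open>The definition of the chain states the Markov property for indicators only. Linearity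
  and monotone convergence extend it to non-negative functions, where no integrability has to be
  carried along.\<close>

lemma nn_one_step:
  assumes "u \<in> borel_measurable borel" and A: "A \<in> sets (natural_algebra M Y n)"
  shows "(\<integral>\<^sup>+\<omega>. u (Y (Suc n) \<omega>) * indicator A \<omega> \<partial>M) = (\<integral>\<^sup>+\<omega>. (\<integral>\<^sup>+y. u y \<partial>K (Y n \<omega>)) * indicator A \<omega> \<partial>M)"
  using assms(1)
proof (induction u rule: borel_measurable_induct)
  have Am [measurable]: "A \<in> sets M" using A filtration_subalgebra[of n] unfolding subalgebra_def by blast
  have KY [measurable]: "(\<lambda>\<omega>. \<integral>\<^sup>+y. u y \<partial>K (Y n \<omega>)) \<in> borel_measurable M"
    if "u \<in> borel_measurable borel" for u :: "real \<Rightarrow> ennreal"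
    using measurable_compose[OF measurable_compose[OF Y_measurable measurable_prob_algebraD[OF K_measurable]]
        nn_integral_measurable_subprob_algebra[OF that]] .
  have m: "u \<in> borel_measurable (K y)" if "u \<in> borel_measurable borel" for u :: "real \<Rightarrow> ennreal" and y
    using that measurable_cong_sets[OF kernel_sets[OF K_measurable] refl] by blast
  { case (cong f g)
    then have "f = g" by auto
    then show ?case using cong by simp
  next
    case (set S)
    interpret sf: sigma_finite_subalgebra M "natural_algebra M Y n" by (rule sigma_finite_filtration)
    have ind: "(\<lambda>\<omega>. indicator S (Y (Suc n) \<omega>) :: real) \<in> Linf M"
      using set by (intro LinfI[where B = 1]) (auto simp: indicator_def)
    have Kpr: "0 \<le> measure (K y) S \<and> measure (K y) S \<le> 1" for y
      using prob_space.prob_le_1[OF kernel_prob[OF K_measurable]] by auto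
    have KL: "(\<lambda>\<omega>. measure (K (Y n \<omega>)) S) \<in> Linf M"
    proof (rule LinfI[where B = 1])
      show "(\<lambda>\<omega>. measure (K (Y n \<omega>)) S) \<in> borel_measurable M"
        using measurable_compose[OF measurable_compose[OF Y_measurable measurable_prob_algebraD[OF K_measurable]]
            measurable_measure_subprob_algebra] set by auto
    qed (use Kpr in auto)
    have Ai: "(indicator A :: 'w \<Rightarrow> real) \<in> Linf (natural_algebra M Y n)"
      using A by (intro LinfI[where B = 1]) (auto simp: indicator_def)
    have eq: "AE \<omega> in M. cond n (\<lambda>\<omega>. indicator S (Y (Suc n) \<omega>)) \<omega> = measure (K (Y n \<omega>)) S"
      using chain set unfolding stationary_markov_chain_def by auto
    have "(\<integral>\<omega>. indicator A \<omega> * indicator S (Y (Suc n) \<omega>) \<partial>M)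
        = (\<integral>\<omega>. indicator A \<omega> * cond n (\<lambda>\<omega>. indicator S (Y (Suc n) \<omega>)) \<omega> \<partial>M)"
      by (rule cond_integral[OF Ai ind, symmetric])
    also have "\<dots> = (\<integral>\<omega>. indicator A \<omega> * measure (K (Y n \<omega>)) S \<partial>M)"
    proof (rule integral_cong_AE)
      show "AE \<omega> in M. indicator A \<omega> * cond n (\<lambda>\<omega>. indicator S (Y (Suc n) \<omega>)) \<omega>
          = indicator A \<omega> * measure (K (Y n \<omega>)) S"
        using eq by eventually_elim simp
    qed (use KL[THEN Linf_measurable] in measurable)
    finally have R: "(\<integral>\<omega>. indicator A \<omega> * indicator S (Y (Suc n) \<omega>) \<partial>M)
        = (\<integral>\<omega>. indicator A \<omega> * measure (K (Y n \<omega>)) S \<partial>M)" .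
    have iA: "(indicator A :: 'w \<Rightarrow> real) \<in> Linf M" using Ai Linf_filtration by blast
    have "(\<integral>\<^sup>+\<omega>. indicator S (Y (Suc n) \<omega>) * indicator A \<omega> \<partial>M)
        = (\<integral>\<^sup>+\<omega>. ennreal (indicator A \<omega> * indicator S (Y (Suc n) \<omega>)) \<partial>M)"
      by (intro nn_integral_cong) (auto simp: indicator_def)
    also have "\<dots> = ennreal (\<integral>\<omega>. indicator A \<omega> * indicator S (Y (Suc n) \<omega>) \<partial>M)"
      using iA ind by (intro nn_integral_eq_integral Linf_integrable Linf_mult) auto
    also have "\<dots> = (\<integral>\<^sup>+\<omega>. ennreal (indicator A \<omega> * measure (K (Y n \<omega>)) S) \<partial>M)"
      unfolding R using iA KL by (intro nn_integral_eq_integral[symmetric] Linf_integrable Linf_mult) auto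
    also have "\<dots> = (\<integral>\<^sup>+\<omega>. (\<integral>\<^sup>+y. indicator S y \<partial>K (Y n \<omega>)) * indicator A \<omega> \<partial>M)"
    proof (rule nn_integral_cong)
      fix \<omega>
      interpret P: prob_space "K (Y n \<omega>)" by (rule kernel_prob[OF K_measurable])
      have "(\<integral>\<^sup>+y. indicator S y \<partial>K (Y n \<omega>)) = ennreal (measure (K (Y n \<omega>)) S)"
        using set kernel_sets[OF K_measurable] by (simp add: P.emeasure_eq_measure)
      then show "ennreal (indicator A \<omega> * measure (K (Y n \<omega>)) S)
          = (\<integral>\<^sup>+y. indicator S y \<partial>K (Y n \<omega>)) * indicator A \<omega>"
        by (simp add: indicator_def)
    qed
    finally show ?case .
  next
    case (mult u c)
    note [measurable] = mult(2)
    have "(\<integral>\<^sup>+\<omega>. c * u (Y (Suc n) \<omega>) * indicator A \<omega> \<partial>M) = c * (\<integral>\<^sup>+\<omega>. u (Y (Suc n) \<omega>) * indicator A \<omega> \<partial>M)"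
      unfolding mult.assoc by (rule nn_integral_cmult) measurable
    also have "\<dots> = c * (\<integral>\<^sup>+\<omega>. (\<integral>\<^sup>+y. u y \<partial>K (Y n \<omega>)) * indicator A \<omega> \<partial>M)"
      by (simp only: mult.IH)
    also have "\<dots> = (\<integral>\<^sup>+\<omega>. c * ((\<integral>\<^sup>+y. u y \<partial>K (Y n \<omega>)) * indicator A \<omega>) \<partial>M)"
      using KY[OF mult(2)] by (intro nn_integral_cmult[symmetric]) measurable
    also have "\<dots> = (\<integral>\<^sup>+\<omega>. (\<integral>\<^sup>+y. c * u y \<partial>K (Y n \<omega>)) * indicator A \<omega> \<partial>M)"
      unfolding nn_integral_cmult[OF m[OF mult(2)]] mult.assoc ..
    finally show ?case .
  next
    case (add u v)
    note [measurable] = add.hyps(1) add.hyps(3)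
    note KYu = KY[OF add.hyps(1)] and KYv = KY[OF add.hyps(3)]
    have "(\<integral>\<^sup>+\<omega>. (v (Y (Suc n) \<omega>) + u (Y (Suc n) \<omega>)) * indicator A \<omega> \<partial>M)
        = (\<integral>\<^sup>+\<omega>. v (Y (Suc n) \<omega>) * indicator A \<omega> \<partial>M) + (\<integral>\<^sup>+\<omega>. u (Y (Suc n) \<omega>) * indicator A \<omega> \<partial>M)"
      unfolding distrib_right by (rule nn_integral_add) measurable
    also have "\<dots> = (\<integral>\<^sup>+\<omega>. (\<integral>\<^sup>+y. v y \<partial>K (Y n \<omega>)) * indicator A \<omega> \<partial>M)
        + (\<integral>\<^sup>+\<omega>. (\<integral>\<^sup>+y. u y \<partial>K (Y n \<omega>)) * indicator A \<omega> \<partial>M)"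
      by (simp only: add.IH)
    also have "\<dots> = (\<integral>\<^sup>+\<omega>. (\<integral>\<^sup>+y. v y \<partial>K (Y n \<omega>)) * indicator A \<omega>
        + (\<integral>\<^sup>+y. u y \<partial>K (Y n \<omega>)) * indicator A \<omega> \<partial>M)"
      using KYu KYv by (intro nn_integral_add[symmetric]) measurable
    also have "\<dots> = (\<integral>\<^sup>+\<omega>. (\<integral>\<^sup>+y. v y + u y \<partial>K (Y n \<omega>)) * indicator A \<omega> \<partial>M)"
      unfolding nn_integral_add[OF m[OF add.hyps(3)] m[OF add.hyps(1)]] distrib_right ..
    finally show ?case .
  next
    case (seq U)
    note [measurable] = seq.hyps(1)
    have inc: "incseq (\<lambda>i. \<integral>\<^sup>+y. U i y \<partial>K x)" for x
      using seq.hyps(3) by (auto simp: incseq_def le_fun_def intro!: nn_integral_mono)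
    have "(\<integral>\<^sup>+\<omega>. (SUP i. U i) (Y (Suc n) \<omega>) * indicator A \<omega> \<partial>M)
        = (\<integral>\<^sup>+\<omega>. (SUP i. U i (Y (Suc n) \<omega>) * indicator A \<omega>) \<partial>M)"
      by (simp add: SUP_mult_right_ennreal image_comp)
    also have "\<dots> = (SUP i. \<integral>\<^sup>+\<omega>. U i (Y (Suc n) \<omega>) * indicator A \<omega> \<partial>M)"
      using seq.hyps(3) by (intro nn_integral_monotone_convergence_SUP)
        (auto simp: incseq_def le_fun_def intro!: mult_right_mono)
    also have "\<dots> = (SUP i. \<integral>\<^sup>+\<omega>. (\<integral>\<^sup>+y. U i y \<partial>K (Y n \<omega>)) * indicator A \<omega> \<partial>M)"
      using seq.IH by simp
    also have "\<dots> = (\<integral>\<^sup>+\<omega>. (SUP i. (\<integral>\<^sup>+y. U i y \<partial>K (Y n \<omega>)) * indicator A \<omega>) \<partial>M)"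
      using inc KY[OF seq.hyps(1)] by (intro nn_integral_monotone_convergence_SUP[symmetric])
        (auto simp: incseq_def le_fun_def intro!: mult_right_mono)
    also have "\<dots> = (\<integral>\<^sup>+\<omega>. (\<integral>\<^sup>+y. (SUP i. U i) y \<partial>K (Y n \<omega>)) * indicator A \<omega> \<partial>M)"
      using seq.hyps(3) m[OF seq.hyps(1)]
      by (simp add: SUP_mult_right_ennreal nn_integral_monotone_convergence_SUP image_comp)
    finally show ?case .
  }
qed

lemma Y_Linf:
  assumes "u \<in> bounded_borel" "i \<le> n" shows "(\<lambda>\<omega>. u (Y i \<omega>)) \<in> Linf (natural_algebra M Y n)"
proof -
  obtain B where "\<And>x. \<bar>u x\<bar> \<le> B" using bounded_borel_bound[OF assms(1)] by blast
  then show ?thesis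
    using measurable_compose[OF Y_adapted[OF assms(2)] bounded_borel_measurable[OF assms(1)]]
    by (intro LinfI[where B = B]) auto
qed

lemma Y_LinfM: "u \<in> bounded_borel \<Longrightarrow> (\<lambda>\<omega>. u (Y i \<omega>)) \<in> Linf M"
  using Y_Linf[of u i i] Linf_filtration by blast

lemma cond_one_step:
  assumes u: "u \<in> bounded_borel"
  shows "AE \<omega> in M. cond n (\<lambda>\<omega>. u (Y (Suc n) \<omega>)) \<omega> = (\<integral>y. u y \<partial>K (Y n \<omega>))"
proof -
  interpret sf: sigma_finite_subalgebra M "natural_algebra M Y n" by (rule sigma_finite_filtration)
  obtain B where B: "\<And>x. \<bar>u x\<bar> \<le> B" using bounded_borel_bound[OF u] by blast
  let ?Ku = "\<lambda>x. \<integral>y. u y \<partial>K x"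
  have Ku: "?Ku \<in> bounded_borel" by (rule K_bounded_borel[OF u])
  have KuB: "\<bar>?Ku x\<bar> \<le> B" for x
    using B by (intro integral_bound_prob kernel_prob[OF K_measurable] kernel_sets[OF K_measurable] u) auto
  show ?thesis
  proof (rule sf.real_cond_exp_charact)
    fix A assume A: "A \<in> sets (natural_algebra M Y n)"
    then have Am [measurable]: "A \<in> sets M" using filtration_subalgebra[of n] unfolding subalgebra_def by blast
    have iA: "(indicator A :: 'w \<Rightarrow> real) \<in> Linf M" by (intro LinfI[where B = 1]) (auto simp: indicator_def)
    have conv: "(\<integral>\<^sup>+\<omega>. ennreal (v (Y i \<omega>) + B) * indicator A \<omega> \<partial>M) = ennreal (\<integral>\<omega>. (v (Y i \<omega>) + B) * indicator A \<omega> \<partial>M)"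
      "0 \<le> (\<integral>\<omega>. (v (Y i \<omega>) + B) * indicator A \<omega> \<partial>M)"
      "(\<integral>\<omega>. (v (Y i \<omega>) + B) * indicator A \<omega> \<partial>M) = (\<integral>\<omega>\<in>A. v (Y i \<omega>) \<partial>M) + B * measure M A"
      if v: "v \<in> bounded_borel" "\<And>x. \<bar>v x\<bar> \<le> B" for v i
    proof -
      have pos: "0 \<le> v x + B" for x using v(2)[of x] by linarith
      have vL: "(\<lambda>\<omega>. v (Y i \<omega>)) \<in> Linf M" by (rule Y_LinfM[OF v(1)])
      have "(\<integral>\<^sup>+\<omega>. ennreal (v (Y i \<omega>) + B) * indicator A \<omega> \<partial>M) = (\<integral>\<^sup>+\<omega>. ennreal ((v (Y i \<omega>) + B) * indicator A \<omega>) \<partial>M)"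
        by (intro nn_integral_cong) (auto simp: indicator_def)
      also have "\<dots> = ennreal (\<integral>\<omega>. (v (Y i \<omega>) + B) * indicator A \<omega> \<partial>M)"
        using pos vL iA by (intro nn_integral_eq_integral Linf_integrable) auto
      finally show "(\<integral>\<^sup>+\<omega>. ennreal (v (Y i \<omega>) + B) * indicator A \<omega> \<partial>M) = ennreal (\<integral>\<omega>. (v (Y i \<omega>) + B) * indicator A \<omega> \<partial>M)" .
      show "0 \<le> (\<integral>\<omega>. (v (Y i \<omega>) + B) * indicator A \<omega> \<partial>M)" using pos by simp
      have "(\<integral>\<omega>. (v (Y i \<omega>) + B) * indicator A \<omega> \<partial>M) = (\<integral>\<omega>. indicator A \<omega> * v (Y i \<omega>) + B * indicator A \<omega> \<partial>M)"
        by (simp add: algebra_simps)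
      also have "\<dots> = (\<integral>\<omega>. indicator A \<omega> * v (Y i \<omega>) \<partial>M) + (\<integral>\<omega>. B * indicator A \<omega> \<partial>M)"
        using vL iA by (intro Bochner_Integration.integral_add Linf_integrable) auto
      finally show "(\<integral>\<omega>. (v (Y i \<omega>) + B) * indicator A \<omega> \<partial>M) = (\<integral>\<omega>\<in>A. v (Y i \<omega>) \<partial>M) + B * measure M A"
        by (simp add: set_lebesgue_integral_def)
    qed
    have "(\<lambda>y. ennreal (u y + B)) \<in> borel_measurable borel"
      using bounded_borel_measurable[OF u] by measurable
    from nn_one_step[OF this A]
    have "(\<integral>\<^sup>+\<omega>. ennreal (u (Y (Suc n) \<omega>) + B) * indicator A \<omega> \<partial>M)
        = (\<integral>\<^sup>+\<omega>. (\<integral>\<^sup>+y. ennreal (u y + B) \<partial>K (Y n \<omega>)) * indicator A \<omega> \<partial>M)" .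
    also have "\<dots> = (\<integral>\<^sup>+\<omega>. ennreal (?Ku (Y n \<omega>) + B) * indicator A \<omega> \<partial>M)"
      by (simp add: shifted_nn_integral[OF kernel_prob[OF K_measurable] kernel_sets[OF K_measurable] u B])
    finally have "ennreal (\<integral>\<omega>. (u (Y (Suc n) \<omega>) + B) * indicator A \<omega> \<partial>M)
        = ennreal (\<integral>\<omega>. (?Ku (Y n \<omega>) + B) * indicator A \<omega> \<partial>M)"
      unfolding conv(1)[OF u B] conv(1)[OF Ku KuB] .
    then have "(\<integral>\<omega>. (u (Y (Suc n) \<omega>) + B) * indicator A \<omega> \<partial>M)
        = (\<integral>\<omega>. (?Ku (Y n \<omega>) + B) * indicator A \<omega> \<partial>M)"
      by (subst (asm) ennreal_inj[OF conv(2)[OF u B] conv(2)[OF Ku KuB]])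
    then show "(\<integral>\<omega>\<in>A. u (Y (Suc n) \<omega>) \<partial>M) = (\<integral>\<omega>\<in>A. ?Ku (Y n \<omega>) \<partial>M)"
      unfolding conv(3)[OF u B] conv(3)[OF Ku KuB] by simp
  qed (use Y_LinfM[OF u] Y_LinfM[OF Ku] Y_Linf[OF Ku] in \<open>auto intro!: Linf_integrable Linf_measurable\<close>)
qed

lemma cond_cong:
  assumes "A \<in> Linf M" "A' \<in> Linf M" "AE \<omega> in M. A \<omega> = A' \<omega>"
  shows "AE \<omega> in M. cond n A \<omega> = cond n A' \<omega>"
proof -
  interpret sf: sigma_finite_subalgebra M "natural_algebra M Y n" by (rule sigma_finite_filtration)
  show ?thesis using assms Linf_measurable by (intro sf.real_cond_exp_cong) auto
qed

text \<open>Condition first at time a + 1, where \<open>n\<close> steps remain, and then take a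
  single step; this matches the recursion of \<open>kernel_power\<close>, which composes with the
  first step.\<close>

lemma cond_steps:
  assumes u: "u \<in> bounded_borel"
  shows "AE \<omega> in M. cond a (\<lambda>\<omega>. u (Y (a + n) \<omega>)) \<omega> = kernel_apply K n u (Y a \<omega>)"
proof (induction n arbitrary: a)
  case 0
  interpret sf: sigma_finite_subalgebra M "natural_algebra M Y a" by (rule sigma_finite_filtration)
  have "AE \<omega> in M. cond a (\<lambda>\<omega>. u (Y a \<omega>)) \<omega> = u (Y a \<omega>)"
    using Y_LinfM[OF u] Y_Linf[OF u, of a a] Linf_measurable by (intro sf.real_cond_exp_F_meas Linf_integrable) auto
  then show ?case by (simp add: kernel_apply_0[OF u])
next
  case (Suc n)
  have KA: "kernel_apply K n u \<in> bounded_borel" by (rule kernel_apply_bounded_borel[OF u])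
  have uL: "(\<lambda>\<omega>. u (Y (a + Suc n) \<omega>)) \<in> Linf M" by (rule Y_LinfM[OF u])
  have "AE \<omega> in M. cond a (cond (Suc a) (\<lambda>\<omega>. u (Y (a + Suc n) \<omega>))) \<omega> = cond a (\<lambda>\<omega>. kernel_apply K n u (Y (Suc a) \<omega>)) \<omega>"
    using Suc[of "Suc a"] by (intro cond_cong cond_LinfM uL Y_LinfM KA) simp
  with cond_tower[OF uL, of a "Suc a"] cond_one_step[OF KA, of a]
  show ?case by (auto elim!: eventually_elim2 simp: kernel_apply_Suc[OF u])
qed

text \<open>Condition first at time a + i: the earlier factor is known there and comes out, the
  later one becomes a kernel applied at the same time. The product is then a function of one
  observation.\<close>

lemma cond_product:
  assumes u: "u \<in> bounded_borel" and v: "v \<in> bounded_borel"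
  shows "AE \<omega> in M. cond a (\<lambda>\<omega>. u (Y (a + i) \<omega>) * v (Y (a + i + l) \<omega>)) \<omega>
    = kernel_apply K i (\<lambda>y. u y * kernel_apply K l v y) (Y a \<omega>)"
proof -
  interpret sf: sigma_finite_subalgebra M "natural_algebra M Y (a + i)" by (rule sigma_finite_filtration)
  let ?A = "\<lambda>\<omega>. u (Y (a + i) \<omega>) * v (Y (a + i + l) \<omega>)" and ?w = "\<lambda>y. u y * kernel_apply K l v y"
  have w: "?w \<in> bounded_borel" using u kernel_apply_bounded_borel[OF v] by auto
  have AL: "?A \<in> Linf M" using Y_LinfM[OF u] Y_LinfM[OF v] by auto
  have "AE \<omega> in M. cond (a + i) ?A \<omega> = u (Y (a + i) \<omega>) * cond (a + i) (\<lambda>\<omega>. v (Y (a + i + l) \<omega>)) \<omega>"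
    using AL Y_Linf[OF u, of "a + i" "a + i"] Y_LinfM[OF v] Linf_measurable
    by (intro sf.real_cond_exp_mult Linf_integrable) auto
  then have "AE \<omega> in M. cond (a + i) ?A \<omega> = ?w (Y (a + i) \<omega>)"
    using cond_steps[OF v, of "a + i" l] by eventually_elim simp
  then have "AE \<omega> in M. cond a (cond (a + i) ?A) \<omega> = cond a (\<lambda>\<omega>. ?w (Y (a + i) \<omega>)) \<omega>"
    using AL Y_LinfM[OF w] by (intro cond_cong cond_LinfM) auto
  with cond_tower[OF AL le_add1, of a i] cond_steps[OF w, of a i]
  show ?thesis by eventually_elim simp
qed

section \<open>Invariant law and one-dimensional marginals\<close>

lemma mu_prob: "prob_space \<mu>" and mu_sets: "sets \<mu> = sets borel"
  using chain unfolding stationary_markov_chain_def by (auto simp: space_prob_algebra)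

lemma mu_invariant:
  assumes u: "u \<in> bounded_borel" shows "(\<integral>x. (\<integral>y. u y \<partial>K x) \<partial>\<mu>) = (\<integral>x. u x \<partial>\<mu>)"
proof -
  obtain B where B: "\<And>x. \<bar>u x\<bar> \<le> B" using bounded_borel_bound[OF u] by blast
  let ?Ku = "\<lambda>x. \<integral>y. u y \<partial>K x"
  have Ku: "?Ku \<in> bounded_borel" by (rule K_bounded_borel[OF u])
  have KuB: "\<bar>?Ku x\<bar> \<le> B" for x
    using B by (intro integral_bound_prob kernel_prob[OF K_measurable] kernel_sets[OF K_measurable] u) auto
  have mK: "\<mu> \<bind> K = \<mu>" using chain unfolding stationary_markov_chain_def by auto
  have "ennreal ((\<integral>x. u x \<partial>\<mu>) + B) = (\<integral>\<^sup>+y. ennreal (u y + B) \<partial>(\<mu> \<bind> K))"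
    unfolding mK by (rule shifted_nn_integral[OF mu_prob mu_sets u B, symmetric])
  also have "\<dots> = (\<integral>\<^sup>+x. (\<integral>\<^sup>+y. ennreal (u y + B) \<partial>K x) \<partial>\<mu>)"
  proof (rule nn_integral_bind)
    show "(\<lambda>y. ennreal (u y + B)) \<in> borel_measurable borel"
      using bounded_borel_measurable[OF u] by measurable
    show "K \<in> \<mu> \<rightarrow>\<^sub>M subprob_algebra borel"
      using measurable_prob_algebraD[OF K_measurable] measurable_cong_sets[OF mu_sets refl] by blast
  qed
  also have "\<dots> = (\<integral>\<^sup>+x. ennreal (?Ku x + B) \<partial>\<mu>)"
    by (intro nn_integral_cong shifted_nn_integral[OF kernel_prob[OF K_measurable] kernel_sets[OF K_measurable] u B])
  also have "\<dots> = ennreal ((\<integral>x. ?Ku x \<partial>\<mu>) + B)" by (rule shifted_nn_integral[OF mu_prob mu_sets Ku KuB])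
  finally have "ennreal ((\<integral>x. u x \<partial>\<mu>) + B) = ennreal ((\<integral>x. ?Ku x \<partial>\<mu>) + B)" .
  moreover have "0 \<le> (\<integral>x. u x \<partial>\<mu>) + B" "0 \<le> (\<integral>x. ?Ku x \<partial>\<mu>) + B"
    using integral_bound_prob[OF mu_prob mu_sets u, of B] integral_bound_prob[OF mu_prob mu_sets Ku, of B] B KuB
    by (simp_all add: abs_le_iff)
  ultimately show ?thesis by simp
qed

lemma kernel_apply_invariant:
  assumes u: "u \<in> bounded_borel" shows "(\<integral>x. kernel_apply K n u x \<partial>\<mu>) = (\<integral>x. u x \<partial>\<mu>)"
proof (induction n)
  case (Suc n)
  then show ?case
    using mu_invariant[OF kernel_apply_bounded_borel[OF u, of n]] by (simp add: kernel_apply_Suc[OF u])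
qed (simp add: kernel_apply_0[OF u])

lemma Y_law: "distr M borel (Y n) = \<mu>"
proof (induction n)
  case 0
  then show ?case using chain unfolding stationary_markov_chain_def by auto
next
  case (Suc n)
  show ?case
  proof (rule measure_eqI)
    show "sets (distr M borel (Y (Suc n))) = sets \<mu>" by (simp add: mu_sets)
    fix S assume "S \<in> sets (distr M borel (Y (Suc n)))"
    then have S [measurable]: "S \<in> sets borel" by simp
    have ind: "(indicator S :: real \<Rightarrow> ennreal) \<in> borel_measurable borel" by simp
    have mK: "\<mu> \<bind> K = \<mu>" using chain unfolding stationary_markov_chain_def by auto
    have sp: "space M \<in> sets (natural_algebra M Y n)" using sets.top[of "natural_algebra M Y n"] by (simp add: space_natural)
    have "emeasure (distr M borel (Y (Suc n))) S = (\<integral>\<^sup>+x. indicator S x \<partial>distr M borel (Y (Suc n)))" by simp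
    also have "\<dots> = (\<integral>\<^sup>+\<omega>. indicator S (Y (Suc n) \<omega>) \<partial>M)"
      by (rule nn_integral_distr) auto
    also have "\<dots> = (\<integral>\<^sup>+\<omega>. indicator S (Y (Suc n) \<omega>) * indicator (space M) \<omega> \<partial>M)"
      by (intro nn_integral_cong) simp
    also have "\<dots> = (\<integral>\<^sup>+\<omega>. (\<integral>\<^sup>+y. indicator S y \<partial>K (Y n \<omega>)) * indicator (space M) \<omega> \<partial>M)"
      by (rule nn_one_step[OF ind sp])
    also have "\<dots> = (\<integral>\<^sup>+\<omega>. (\<integral>\<^sup>+y. indicator S y \<partial>K (Y n \<omega>)) \<partial>M)"
      by (intro nn_integral_cong) simp
    also have "\<dots> = (\<integral>\<^sup>+x. (\<integral>\<^sup>+y. indicator S y \<partial>K x) \<partial>distr M borel (Y n))"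
      using measurable_compose[OF measurable_prob_algebraD[OF K_measurable] nn_integral_measurable_subprob_algebra[OF ind]]
      by (intro nn_integral_distr[symmetric]) auto
    also have "\<dots> = (\<integral>\<^sup>+x. (\<integral>\<^sup>+y. indicator S y \<partial>K x) \<partial>\<mu>)" unfolding Suc ..
    also have "\<dots> = (\<integral>\<^sup>+y. indicator S y \<partial>(\<mu> \<bind> K))"
      using measurable_prob_algebraD[OF K_measurable] measurable_cong_sets[OF mu_sets refl]
      by (intro nn_integral_bind[symmetric, OF ind]) blast
    also have "\<dots> = emeasure \<mu> S" unfolding mK by (simp add: mu_sets)
    finally show "emeasure (distr M borel (Y (Suc n))) S = emeasure \<mu> S" .
  qed
qed

lemma AE_Y:
  assumes "AE x in \<mu>. P x" shows "AE \<omega> in M. P (Y n \<omega>)"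
proof -
  have "AE x in distr M borel (Y n). P x" unfolding Y_law by (rule assms)
  then show ?thesis by (rule AE_distrD[OF Y_measurable])
qed

end

section \<open>Summability of the autocovariances\<close>

text \<open>If \<open>c\<close> stayed above \<eta>, the series would dominate a multiple of the
  harmonic one, because 1 / sqrt n >= 1 / n. Small values along some indices are enough for monotone
  quantities.\<close>

lemma summable_over_sqrt_small:
  fixes c :: "nat \<Rightarrow> real"
  assumes "summable (\<lambda>n. c n / sqrt (real n))" "\<eta> > 0"
  shows "\<exists>n\<ge>n0. c n < \<eta>"
proof (rule ccontr)
  assume "\<not> ?thesis"
  then have c: "\<And>n. n \<ge> n0 \<Longrightarrow> \<eta> \<le> c n" by (meson not_less)
  have "summable (\<lambda>n. inverse (real n))"
  proof (rule summable_comparison_test)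
    show "summable (\<lambda>n. 1 / \<eta> * (c n / sqrt (real n)))" using assms(1) by (rule summable_mult)
    show "\<exists>N. \<forall>n\<ge>N. norm (inverse (real n)) \<le> 1 / \<eta> * (c n / sqrt (real n))"
    proof (intro exI[of _ "max n0 1"] allI impI)
      fix n assume n: "n \<ge> max n0 1"
      have "sqrt (real n) * 1 \<le> sqrt (real n) * sqrt (real n)" using n by (intro mult_left_mono) auto
      then have "inverse (real n) \<le> 1 / sqrt (real n)" using n by (simp add: inverse_eq_divide frac_le)
      also have "\<dots> \<le> (c n / \<eta>) / sqrt (real n)" using c[of n] n assms(2) by (intro divide_right_mono) auto
      finally show "norm (inverse (real n)) \<le> 1 / \<eta> * (c n / sqrt (real n))" by simp
    qed
  qed
  then show False using not_summable_harmonic[where 'a = real] by simp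
qed

text \<open>The discriminant argument behind Cauchy-Schwarz. In the degenerate case the quadratic is
  affine, and it stays non-negative only if its slope vanishes.\<close>

lemma abs_le_sqrt_of_quadratic_nonneg:
  fixes \<alpha> \<beta> \<gamma> :: real
  assumes "\<And>t. 0 \<le> \<alpha> + 2 * t * \<beta> + t\<^sup>2 * \<gamma>" "\<gamma> \<ge> 0"
  shows "\<bar>\<beta>\<bar> \<le> sqrt \<alpha> * sqrt \<gamma>"
proof -
  have "\<beta>\<^sup>2 \<le> \<alpha> * \<gamma>"
  proof (cases "\<gamma> = 0")
    case True
    have "\<beta> = 0"
    proof (rule ccontr)
      assume "\<beta> \<noteq> 0"
      then have "\<alpha> + 2 * (- (\<alpha> + 1) / (2 * \<beta>)) * \<beta> = - 1" by (simp add: field_simps)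
      then show False using assms(1)[of "- (\<alpha> + 1) / (2 * \<beta>)"] True by simp
    qed
    then show ?thesis using True by simp
  next
    case False
    then have g: "\<gamma> > 0" using assms(2) by simp
    have "\<alpha> + 2 * (- \<beta> / \<gamma>) * \<beta> + (- \<beta> / \<gamma>)\<^sup>2 * \<gamma> = \<alpha> - \<beta>\<^sup>2 / \<gamma>"
      using g by (simp add: power2_eq_square field_simps)
    then have "\<beta>\<^sup>2 / \<gamma> \<le> \<alpha>" using assms(1)[of "- \<beta> / \<gamma>"] by simp
    then show ?thesis using g by (simp add: divide_le_eq)
  qed
  then have "sqrt (\<beta>\<^sup>2) \<le> sqrt (\<alpha> * \<gamma>)" by (rule real_sqrt_le_mono)
  then show ?thesis by (simp add: real_sqrt_mult)
qed

section \<open>Innovations of the stationary chain\<close>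

context stationary_chain
begin

lemma mu_integrable: "u \<in> bounded_borel \<Longrightarrow> integrable \<mu> u"
  by (rule bounded_borel_integrable[OF mu_prob mu_sets])

text \<open>By invariance this is the covariance of the one-step prediction errors u(Y1) - Ku(Y0)
  and v(Y1) - Kv(Y0), hence a positive semidefinite bilinear form.\<close>

definition innov :: "(real \<Rightarrow> real) \<Rightarrow> (real \<Rightarrow> real) \<Rightarrow> real" where
  "innov u v = (\<integral>x. u x * v x \<partial>\<mu>) - (\<integral>x. (\<integral>y. u y \<partial>K x) * (\<integral>y. v y \<partial>K x) \<partial>\<mu>)"

text \<open>Jensen for each \<open>K x\<close>, followed by invariance of
  \<open>\<mu>\<close>.\<close>

lemma innov_nonneg:
  assumes u: "u \<in> bounded_borel" shows "innov u u \<ge> 0"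
proof -
  have u2: "(\<lambda>x. (u x)\<^sup>2) \<in> bounded_borel" unfolding power2_eq_square using u by auto
  have Ku: "(\<lambda>x. \<integral>y. u y \<partial>K x) \<in> bounded_borel" by (rule K_bounded_borel[OF u])
  have "(\<integral>x. (\<integral>y. u y \<partial>K x)\<^sup>2 \<partial>\<mu>) \<le> (\<integral>x. (\<integral>y. (u y)\<^sup>2 \<partial>K x) \<partial>\<mu>)"
  proof (rule integral_mono)
    show "integrable \<mu> (\<lambda>x. (\<integral>y. u y \<partial>K x)\<^sup>2)"
      unfolding power2_eq_square using Ku by (intro mu_integrable) auto
    show "integrable \<mu> (\<lambda>x. \<integral>y. (u y)\<^sup>2 \<partial>K x)" by (intro mu_integrable K_bounded_borel u2)
  qed (intro square_integral_le kernel_prob[OF K_measurable] kernel_sets[OF K_measurable] u)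
  also have "\<dots> = (\<integral>x. (u x)\<^sup>2 \<partial>\<mu>)" by (rule mu_invariant[OF u2])
  finally show ?thesis unfolding innov_def by (simp add: power2_eq_square)
qed

lemma innov_Cauchy_Schwarz:
  assumes u: "u \<in> bounded_borel" and v: "v \<in> bounded_borel"
  shows "\<bar>innov u v\<bar> \<le> sqrt (innov u u) * sqrt (innov v v)"
proof (rule abs_le_sqrt_of_quadratic_nonneg)
  fix t :: real
  let ?Ku = "\<lambda>x. \<integral>y. u y \<partial>K x" and ?Kv = "\<lambda>x. \<integral>y. v y \<partial>K x"
  have b: "?Ku \<in> bounded_borel" "?Kv \<in> bounded_borel" using K_bounded_borel u v by auto
  have tv: "(\<lambda>x. t * v x) \<in> bounded_borel" using v by auto
  have lin: "(\<integral>y. u y + t * v y \<partial>K x) = ?Ku x + t * ?Kv x" for x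
    using Bochner_Integration.integral_add[OF
        bounded_borel_integrable[OF kernel_prob[OF K_measurable] kernel_sets[OF K_measurable] u]
        bounded_borel_integrable[OF kernel_prob[OF K_measurable] kernel_sets[OF K_measurable] tv]]
    by simp
  have quad: "(\<integral>x. (r x + t * s x) * (r x + t * s x) \<partial>\<mu>)
      = (\<integral>x. r x * r x \<partial>\<mu>) + 2 * t * (\<integral>x. r x * s x \<partial>\<mu>) + t\<^sup>2 * (\<integral>x. s x * s x \<partial>\<mu>)"
    if "r \<in> bounded_borel" "s \<in> bounded_borel" for r s
  proof -
    have i: "integrable \<mu> (\<lambda>x. r x * r x)" "integrable \<mu> (\<lambda>x. 2 * t * (r x * s x))" "integrable \<mu> (\<lambda>x. t\<^sup>2 * (s x * s x))"
      using that by (auto intro!: mu_integrable)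
    have "(\<integral>x. (r x + t * s x) * (r x + t * s x) \<partial>\<mu>) = (\<integral>x. (r x * r x + 2 * t * (r x * s x)) + t\<^sup>2 * (s x * s x) \<partial>\<mu>)"
      by (simp add: algebra_simps power2_eq_square)
    also have "\<dots> = ((\<integral>x. r x * r x \<partial>\<mu>) + (\<integral>x. 2 * t * (r x * s x) \<partial>\<mu>)) + (\<integral>x. t\<^sup>2 * (s x * s x) \<partial>\<mu>)"
      using i by (simp only: Bochner_Integration.integral_add Bochner_Integration.integrable_add)
    finally show ?thesis by (simp add: mult.assoc)
  qed
  have "0 \<le> innov (\<lambda>x. u x + t * v x) (\<lambda>x. u x + t * v x)" using u tv by (intro innov_nonneg) auto
  also have "\<dots> = innov u u + 2 * t * innov u v + t\<^sup>2 * innov v v"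
    unfolding innov_def lin quad[OF u v] quad[OF b] by (simp add: algebra_simps)
  finally show "0 \<le> innov u u + 2 * t * innov u v + t\<^sup>2 * innov v v" .
qed (rule innov_nonneg[OF v])

text \<open>Hannan's argument: \<open>p i\<close> is the norm of the \<open>i\<close>-th projection of the observable onto an innovation.
  Its summability follows from \<open>(e i)\<^sup>2 - (e (i + 1))\<^sup>2 = (p i)\<^sup>2\<close> by the arithmetic-geometric mean inequality
  and summation by parts.\<close>

lemma autocovariance_summable:
  assumes u: "u \<in> bounded_borel"
    and c_nonneg: "\<And>n. c n \<ge> 0" and c_decreasing: "decseq c"
    and c_summable: "summable (\<lambda>n. c n / sqrt (real n))"
    and decay: "\<And>n. n \<ge> 1 \<Longrightarrow> AE x in \<mu>. \<bar>kernel_apply K n u x\<bar> \<le> c n"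
  shows "summable (\<lambda>l. \<integral>x. u x * kernel_apply K l u x \<partial>\<mu>)"
proof -
  define w where "w i = kernel_apply K i u" for i
  define e where "e i = sqrt (\<integral>x. w i x * w i x \<partial>\<mu>)" for i
  define p where "p i = sqrt (innov (w i) (w i))" for i
  have w: "w i \<in> bounded_borel" for i unfolding w_def by (rule kernel_apply_bounded_borel[OF u])
  have wSuc: "(\<integral>y. w i y \<partial>K x) = w (Suc i) x" for i x unfolding w_def by (rule kernel_apply_Suc[OF u, symmetric])
  have e2: "(e i)\<^sup>2 = (\<integral>x. w i x * w i x \<partial>\<mu>)" for i unfolding e_def by simp
  have e0: "e i \<ge> 0" for i unfolding e_def by simp
  have p2: "(p i)\<^sup>2 = (e i)\<^sup>2 - (e (Suc i))\<^sup>2" for i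
    unfolding p_def e2 using innov_nonneg[OF w, of i] by (simp add: innov_def wSuc)
  have p0: "p i \<ge> 0" for i unfolding p_def using innov_nonneg[OF w] by simp
  have e_dec: "e (Suc i) \<le> e i" for i
    using p2[of i] zero_le_power2[of "p i"] by (intro power2_le_imp_le[OF _ e0]) linarith
  have prod_le: "\<bar>\<integral>x. w i x * w j x \<partial>\<mu>\<bar> \<le> c i * c j" if "i \<ge> 1" "j \<ge> 1" for i j
  proof (rule integral_bound_prob[OF mu_prob mu_sets])
    show "(\<lambda>x. w i x * w j x) \<in> bounded_borel" using w by auto
    show "AE x in \<mu>. \<bar>w i x * w j x\<bar> \<le> c i * c j"
      using decay[OF that(1)] decay[OF that(2)] unfolding w_def
      by eventually_elim (auto simp: abs_mult intro!: mult_mono c_nonneg)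
  qed
  have ec: "e i \<le> c i" if "i \<ge> 1" for i
  proof (rule power2_le_imp_le[OF _ c_nonneg])
    show "(e i)\<^sup>2 \<le> (c i)\<^sup>2" unfolding e2 using prod_le[OF that that] by (simp add: power2_eq_square)
  qed
  \<comment> \<open>With x = e_i / sqrt i and y = sqrt i (e_i - e_(i+1)) / 2, (p i)^2 <= 2 e_i (e_i
    - e_(i+1)) = 4 x y <= (x + y)^2. Replacing sqrt i by sqrt (i + 1) in front of e_(i+1) makes
    \<open>y\<close> telescope and costs e_(i+1) / (2 sqrt (i + 1)).\<close>
  have p_le: "p i \<le> e i / sqrt (real i) + (sqrt (real i) * e i - sqrt (real (Suc i)) * e (Suc i)) / 2
      + e (Suc i) / sqrt (real (Suc i)) / 2" if i: "i \<ge> 1" for i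
  proof -
    let ?x = "e i / sqrt (real i)" and ?y = "sqrt (real i) * (e i - e (Suc i)) / 2"
    have xy: "0 \<le> ?x + ?y" using e0 e_dec by simp
    have "(p i)\<^sup>2 = (e i + e (Suc i)) * (e i - e (Suc i))" unfolding p2 by (simp add: power2_eq_square algebra_simps)
    also have "\<dots> \<le> (2 * e i) * (e i - e (Suc i))" using e_dec[of i] by (intro mult_right_mono) auto
    also have "\<dots> = 4 * (?x * ?y)" using i by simp
    also have "\<dots> \<le> (?x + ?y)\<^sup>2"
    proof -
      have "4 * (a * b) \<le> (a + b)\<^sup>2" for a b :: real
        using zero_le_power2[of "a - b"] by (simp add: power2_diff power2_sum)
      then show ?thesis .
    qed
    finally have "p i \<le> ?x + ?y" using xy by (rule power2_le_imp_le)
    then have 1: "p i \<le> ?x + (sqrt (real i) * e i - sqrt (real i) * e (Suc i)) / 2"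
      unfolding right_diff_distrib .
    have 2: "sqrt (real (Suc i)) * e (Suc i) - e (Suc i) / sqrt (real (Suc i)) \<le> sqrt (real i) * e (Suc i)"
    proof -
      define s where "s = sqrt (real (Suc i))"
      have s: "s > 0" "s * s = real i + 1" unfolding s_def by auto
      have "sqrt (real i) * sqrt (real i) \<le> sqrt (real i) * s"
        unfolding s_def by (intro mult_left_mono real_sqrt_le_mono) auto
      then have "s * s - 1 \<le> sqrt (real i) * s" using s(2) by simp
      then have "s - 1 / s \<le> sqrt (real i)" using s(1) by (simp add: field_simps)
      from mult_right_mono[OF this e0[of "Suc i"]] show ?thesis
        unfolding s_def[symmetric] by (simp add: left_diff_distrib)
    qed
    have "P \<le> A + (B - D) / 2 + E / 2" if "P \<le> A + (B - C) / 2" "D - E \<le> C" for A B C D E P :: real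
      using that by (simp add: field_simps)
    from this[OF 1 2] show ?thesis .
  qed
  define S where "S = (\<Sum>n. c n / sqrt (real n))"
  have part: "(\<Sum>i\<in>I. c i / sqrt (real i)) \<le> S" if "finite I" for I
    unfolding S_def using that c_nonneg by (intro sum_le_suminf[OF c_summable]) auto
  have *: "(\<Sum>i\<in>{1..I}. p i) + sqrt (real (Suc I)) * e (Suc I) / 2
      \<le> e 1 / 2 + (\<Sum>i\<in>{1..I}. e i / sqrt (real i)) + (\<Sum>i\<in>{1..I}. e (Suc i) / sqrt (real (Suc i))) / 2" for I
  proof (induction I)
    case (Suc I)
    then show ?case using p_le[of "Suc I"] by (simp add: add_divide_distrib diff_divide_distrib)
  qed simp
  have **: "(\<Sum>i\<in>{1..I}. e i / sqrt (real i)) \<le> S" for I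
    using ec by (intro order_trans[OF sum_mono part]) (auto intro!: divide_right_mono)
  have ***: "(\<Sum>i\<in>{1..I}. e (Suc i) / sqrt (real (Suc i))) \<le> S" for I
  proof -
    have "(\<Sum>i\<in>{1..I}. e (Suc i) / sqrt (real (Suc i))) \<le> (\<Sum>i\<in>{1..I}. c (Suc i) / sqrt (real (Suc i)))"
      using ec by (intro sum_mono divide_right_mono) auto
    also have "\<dots> = (\<Sum>i\<in>Suc ` {1..I}. c i / sqrt (real i))" by (simp only: sum.reindex[OF inj_Suc] o_def)
    also have "\<dots> \<le> S" by (rule part) simp
    finally show ?thesis .
  qed
  have psum1: "(\<Sum>i\<in>{1..I}. p i) \<le> e 1 / 2 + S + S / 2" for I
  proof -
    have "0 \<le> sqrt (real (Suc I)) * e (Suc I) / 2" using e0[of "Suc I"] by simp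
    moreover have "x \<le> d + S + S / 2" if "x + y \<le> d + u + u' / 2" "0 \<le> y" "u \<le> S" "u' \<le> S" for x y d u u' :: real
      using that by linarith
    ultimately show ?thesis using *[of I] **[of I] ***[of I] by blast
  qed
  define P where "P = p 0 + (e 1 / 2 + S + S / 2)"
  have psum: "(\<Sum>i\<in>A. p i) \<le> P" if fin: "finite A" for A
  proof -
    obtain I where I: "A \<subseteq> {..I}" using fin finite_nat_iff_bounded_le[of A] by blast
    then have "(\<Sum>i\<in>A. p i) \<le> (\<Sum>i\<in>{..I}. p i)" using p0 by (intro sum_mono2) auto
    also have "\<dots> = p 0 + (\<Sum>i\<in>{1..I}. p i)" by (simp add: sum.atMost_shift sum.atLeast1_atMost_eq)
    finally show ?thesis using psum1[of I] unfolding P_def by linarith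
  qed
  have P0: "P \<ge> 0" using psum[of "{}"] by simp
  let ?g = "\<lambda>l. \<integral>x. u x * kernel_apply K l u x \<partial>\<mu>"
  have g_eq: "?g l = (\<integral>x. w 0 x * w l x \<partial>\<mu>)" for l unfolding w_def using kernel_apply_0[OF u] by simp
  \<comment> \<open>Applying the kernel to both factors changes their inner product by exactly one
    \<open>innov\<close> term, so the covariance telescopes.\<close>
  have tele: "?g l = (\<Sum>i<I. innov (w i) (w (l + i))) + (\<integral>x. w I x * w (l + I) x \<partial>\<mu>)" for l I
    by (induction I) (simp_all add: g_eq innov_def wSuc)
  \<comment> \<open>The double sum of products of the \<open>p\<close> is at most P^2 for every
    truncation \<open>I\<close>. For a given \<open>N\<close> the truncation is taken so far out
    that the \<open>N\<close> remainders together stay below \<eta>.\<close>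
  have bound: "(\<Sum>l<N. \<bar>?g l\<bar>) \<le> P * P" for N
  proof (rule field_le_epsilon)
    fix \<eta> :: real assume \<eta>: "\<eta> > 0"
    obtain I where I: "I \<ge> 1" "c I < min 1 (\<eta> / (real N + 1))"
      using summable_over_sqrt_small[OF c_summable, of "min 1 (\<eta> / (real N + 1))" 1] \<eta> by auto
    have each: "\<bar>?g l\<bar> \<le> (\<Sum>i<I. p i * p (l + i)) + c I * c I" for l
    proof -
      have "\<bar>\<Sum>i<I. innov (w i) (w (l + i))\<bar> \<le> (\<Sum>i<I. p i * p (l + i))"
        unfolding p_def by (intro order_trans[OF sum_abs] sum_mono innov_Cauchy_Schwarz w)
      moreover have "\<bar>\<integral>x. w I x * w (l + I) x \<partial>\<mu>\<bar> \<le> c I * c I"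
      proof -
        have "c I * c (l + I) \<le> c I * c I"
          using decseqD[OF c_decreasing, of I "l + I"] by (intro mult_left_mono c_nonneg) simp
        then show ?thesis using prod_le[of I "l + I"] I(1) by simp
      qed
      ultimately show ?thesis unfolding tele[of l I] by linarith
    qed
    have "(\<Sum>l<N. \<bar>?g l\<bar>) \<le> (\<Sum>l<N. (\<Sum>i<I. p i * p (l + i)) + c I * c I)" by (intro sum_mono each)
    also have "\<dots> = (\<Sum>i<I. p i * (\<Sum>l<N. p (l + i))) + real N * (c I * c I)"
      unfolding sum.distrib sum_distrib_left by (subst sum.swap) simp
    also have "(\<Sum>i<I. p i * (\<Sum>l<N. p (l + i))) \<le> (\<Sum>i<I. p i * P)"
    proof (intro sum_mono mult_left_mono p0)
      fix i
      have "(\<Sum>l<N. p (l + i)) = (\<Sum>l\<in>(\<lambda>l. l + i) ` {..<N}. p l)" by (simp add: sum.reindex)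
      also have "\<dots> \<le> P" by (rule psum) simp
      finally show "(\<Sum>l<N. p (l + i)) \<le> P" .
    qed
    also have "(\<Sum>i<I. p i * P) \<le> P * P" unfolding sum_distrib_right[symmetric] using psum P0 by (intro mult_right_mono) auto
    also have "real N * (c I * c I) \<le> \<eta>"
    proof -
      have "c I * c I \<le> (\<eta> / (real N + 1)) * 1" using I c_nonneg[of I] \<eta> by (intro mult_mono) auto
      then have "real N * (c I * c I) \<le> real N * (\<eta> / (real N + 1))" by (intro mult_left_mono) auto
      also have "\<dots> \<le> \<eta>" using \<eta> by (simp add: divide_le_eq field_simps)
      finally show ?thesis .
    qed
    finally show "(\<Sum>l<N. \<bar>?g l\<bar>) \<le> P * P + \<eta>" by simp
  qed
  have "summable (\<lambda>l. \<bar>?g l\<bar>)" by (rule summableI_nonneg_bounded[OF _ bound]) simp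
  then show ?thesis by (rule summable_rabs_cancel)
qed

end

text \<open>Integral comparison on the geometric partition by C * \<rho>^n: an interval of the
  partition has length proportional to its right end, which cancels the 1 / t, and the logarithm
  grows at most linearly in \<open>n\<close>.\<close>

lemma modulus_summable:
  fixes h :: "real \<Rightarrow> real"
  assumes mono: "mono_on {0..} h" and nonneg: "\<And>t. t \<ge> 0 \<Longrightarrow> h t \<ge> 0"
    and int: "(\<integral>\<^sup>+t\<in>{0<..<1}. ennreal (h t / (t * sqrt \<bar>ln t\<bar>)) \<partial>lborel) < \<infinity>"
    and C: "C > 0" and \<rho>: "0 < \<rho>" "\<rho> < 1"
  shows "summable (\<lambda>n. h (C * \<rho> ^ n) / sqrt (real n))"
proof -
  define t where "t n = C * \<rho> ^ n" for n
  have t_pos: "t n > 0" for n unfolding t_def using C \<rho> by simp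
  have t_Suc: "t (Suc n) = \<rho> * t n" for n unfolding t_def by simp
  have t_dec: "t m \<le> t n" if "n \<le> m" for n m
    unfolding t_def using that C \<rho> by (intro mult_left_mono power_decreasing) auto
  have "t \<longlonglongrightarrow> C * 0" unfolding t_def using \<rho> by (intro tendsto_intros LIMSEQ_realpow_zero) auto
  then have "\<forall>\<^sub>F n in sequentially. t n < 1" by (rule order_tendstoD(2)) simp
  \<comment> \<open>Early points of the partition may exceed 1 when \<open>C\<close> is large; only
    intervals inside the unit interval are compared.\<close>
  then obtain N where N: "\<And>n. n \<ge> N \<Longrightarrow> t n < 1" unfolding eventually_sequentially by blast
  define D where "D = \<bar>ln C\<bar> + \<bar>ln \<rho>\<bar>"
  have "ln \<rho> < 0" using \<rho> by simp
  then have D: "D > 0" unfolding D_def by linarith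
  have lnt: "\<bar>ln (t (Suc n))\<bar> \<le> D * real (Suc n)" for n
  proof -
    have "ln (t (Suc n)) = ln C + real (Suc n) * ln \<rho>" unfolding t_def using C \<rho> by (simp add: ln_mult ln_realpow algebra_simps)
    then have "\<bar>ln (t (Suc n))\<bar> \<le> \<bar>ln C\<bar> + real (Suc n) * \<bar>ln \<rho>\<bar>"
      using abs_triangle_ineq[of "ln C" "real (Suc n) * ln \<rho>"] by (simp add: abs_mult)
    also have "\<bar>ln C\<bar> \<le> \<bar>ln C\<bar> * real (Suc n)" by (simp add: mult_le_cancel_left1)
    finally show ?thesis unfolding D_def by (simp add: algebra_simps)
  qed
  define J where "J n = {t (Suc n)<..<t n}" for n
  \<comment> \<open>Lower bound of the integrand on \<open>J n\<close>, each factor taken at its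
    worst: \<open>h\<close> at the left end, the variable at the right end, the logarithm at its
    linear bound.\<close>
  define v where "v n = h (t (Suc n)) / (t n * sqrt (D * real (Suc n)))" for n
  define G where "G x = ennreal (h x / (x * sqrt \<bar>ln x\<bar>)) * indicator {0<..<1} x" for x
  have v0: "v n \<ge> 0" for n unfolding v_def using nonneg t_pos D by (simp add: less_imp_le)
  have Jdis: "x \<notin> J n" if "x \<in> J m" "n \<noteq> m" for x n m
  proof -
    have "n < m \<or> m < n" using that(2) by auto
    then show ?thesis using that(1) t_dec[of "Suc n" m] t_dec[of "Suc m" n] unfolding J_def by auto
  qed
  have vG: "ennreal (v n) \<le> G x" if "n \<ge> N" "x \<in> J n" for n x
  proof -
    have x: "t (Suc n) < x" "x < t n" "0 < x" "x < 1" using that N[of n] t_pos[of "Suc n"] unfolding J_def by auto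
    have "\<bar>ln x\<bar> \<le> \<bar>ln (t (Suc n))\<bar>"
      using x t_pos[of "Suc n"] ln_less_cancel_iff[of "t (Suc n)" x] by (simp add: abs_if)
    then have "sqrt \<bar>ln x\<bar> \<le> sqrt (D * real (Suc n))" using lnt[of n] by (intro real_sqrt_le_mono) linarith
    moreover have "h (t (Suc n)) \<le> h x" using mono x t_pos[of "Suc n"] by (auto simp: mono_on_def)
    moreover have "0 < sqrt \<bar>ln x\<bar>" using x by simp
    ultimately have "v n \<le> h x / (x * sqrt \<bar>ln x\<bar>)"
      unfolding v_def using x nonneg[of x] t_pos[of "Suc n"] by (intro frac_le mult_mono mult_pos_pos) auto
    then show ?thesis unfolding G_def using x by (simp add: ennreal_leI)
  qed
  have int': "(\<integral>\<^sup>+x. G x \<partial>lborel) < \<infinity>" using int unfolding G_def .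
  have part: "(\<Sum>i<n. v (i + N) * (t (i + N) - t (Suc (i + N)))) \<le> enn2real (\<integral>\<^sup>+x. G x \<partial>lborel)" for n
  proof -
    let ?d = "\<lambda>i. t (i + N) - t (Suc (i + N))"
    have d0: "?d i \<ge> 0" for i using t_dec[of "i + N" "Suc (i + N)"] by simp
    have "ennreal (\<Sum>i<n. v (i + N) * ?d i) = (\<Sum>i<n. ennreal (v (i + N)) * ennreal (?d i))"
      using v0 d0 by (subst sum_ennreal[symmetric]) (auto simp: ennreal_mult intro!: sum.cong)
    also have "\<dots> = (\<Sum>i<n. \<integral>\<^sup>+x. ennreal (v (i + N)) * indicator (J (i + N)) x \<partial>lborel)"
      unfolding J_def using d0 by (simp add: nn_integral_cmult_indicator)
    also have "\<dots> = (\<integral>\<^sup>+x. (\<Sum>i<n. ennreal (v (i + N)) * indicator (J (i + N)) x) \<partial>lborel)"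
      by (rule nn_integral_sum[symmetric]) (simp add: J_def)
    also have "\<dots> \<le> (\<integral>\<^sup>+x. G x \<partial>lborel)"
    proof (rule nn_integral_mono)
      fix x
      show "(\<Sum>i<n. ennreal (v (i + N)) * indicator (J (i + N)) x) \<le> G x"
      proof (cases "\<exists>k<n. x \<in> J (k + N)")
        case True
        then obtain k where k: "k < n" "x \<in> J (k + N)" by blast
        have "(\<Sum>i<n. ennreal (v (i + N)) * indicator (J (i + N)) x)
            = (\<Sum>i\<in>{k}. ennreal (v (i + N)) * indicator (J (i + N)) x)"
        proof (rule sum.mono_neutral_right)
          show "\<forall>i\<in>{..<n} - {k}. ennreal (v (i + N)) * indicator (J (i + N)) x = 0"
            using Jdis[OF k(2)] by (auto simp: indicator_def)
        qed (use k in auto)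
        also have "\<dots> \<le> G x" using vG[OF _ k(2)] k(2) by simp
        finally show ?thesis .
      next
        case False
        then have "(\<Sum>i<n. ennreal (v (i + N)) * indicator (J (i + N)) x) = 0" by (auto simp: indicator_def)
        then show ?thesis by simp
      qed
    qed
    finally have "enn2real (ennreal (\<Sum>i<n. v (i + N) * ?d i)) \<le> enn2real (\<integral>\<^sup>+x. G x \<partial>lborel)"
      using int' by (intro enn2real_mono) auto
    moreover have "0 \<le> (\<Sum>i<n. v (i + N) * ?d i)"
      by (intro sum_nonneg mult_nonneg_nonneg v0 d0)
    ultimately show ?thesis by (simp only: enn2real_ennreal)
  qed
  have eq: "h (t (Suc (i + N))) / sqrt (real (Suc (i + N))) = (sqrt D / (1 - \<rho>)) * (v (i + N) * (t (i + N) - t (Suc (i + N))))" for i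
  proof -
    have "v (i + N) * (t (i + N) - t (Suc (i + N))) = h (t (Suc (i + N))) / (t (i + N) * (sqrt D * sqrt (real (Suc (i + N))))) * ((1 - \<rho>) * t (i + N))"
      unfolding v_def real_sqrt_mult t_Suc by (simp add: algebra_simps)
    also have "\<dots> = (1 - \<rho>) / sqrt D * (h (t (Suc (i + N))) / sqrt (real (Suc (i + N))))"
      using t_pos[of "i + N"] by simp
    finally show ?thesis using D \<rho> by simp
  qed
  have "summable (\<lambda>i. v (i + N) * (t (i + N) - t (Suc (i + N))))"
    using v0 t_dec by (intro summableI_nonneg_bounded[OF _ part]) simp
  then have "summable (\<lambda>i. h (t (Suc (i + N))) / sqrt (real (Suc (i + N))))"
    unfolding eq by (rule summable_mult)
  then have "summable (\<lambda>i. h (t (i + Suc N)) / sqrt (real (i + Suc N)))" by simp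
  then have "summable (\<lambda>i. h (t i) / sqrt (real i))" by (subst (asm) summable_iff_shift)
  then show ?thesis unfolding t_def .
qed

text \<open>The inf-convolution of \<open>f\<close> with L |x|. The affine majorant of
  \<open>h\<close> makes the infimum finite and keeps it within \<open>r\<close> of
  \<open>f\<close>.\<close>

lemma Lipschitz_minorant:
  fixes f h :: "real \<Rightarrow> real"
  assumes f: "\<And>x y. \<bar>f x - f y\<bar> \<le> h \<bar>x - y\<bar>" and h: "\<And>t. t \<ge> 0 \<Longrightarrow> h t \<le> r + L * t" and L: "L \<ge> 0"
  shows "\<exists>g. L-lipschitz_on UNIV g \<and> (\<forall>x. g x \<le> f x \<and> f x \<le> g x + r)"
proof -
  define g where "g x = (INF y. f y + L * \<bar>x - y\<bar>)" for x
  have low: "f x - r \<le> f y + L * \<bar>x - y\<bar>" for x y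
    using f[of x y] h[of "\<bar>x - y\<bar>"] by linarith
  have bdd: "bdd_below (range (\<lambda>y. f y + L * \<bar>x - y\<bar>))" for x
    using low[of x] by (intro bdd_belowI[of _ "f x - r"]) auto
  have g_le: "g x \<le> f y + L * \<bar>x - y\<bar>" for x y
    unfolding g_def by (intro cINF_lower bdd) simp
  have g_ge: "f x - r \<le> g x" for x
    unfolding g_def by (intro cINF_greatest low) simp
  have lip: "g x - g z \<le> L * \<bar>x - z\<bar>" for x z
  proof -
    have "g x - L * \<bar>x - z\<bar> \<le> f y + L * \<bar>z - y\<bar>" for y
    proof -
      have "L * \<bar>x - y\<bar> \<le> L * (\<bar>x - z\<bar> + \<bar>z - y\<bar>)" using L by (intro mult_left_mono) auto
      then show ?thesis using g_le[of x y] by (simp add: distrib_left)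
    qed
    then have "g x - L * \<bar>x - z\<bar> \<le> g z" unfolding g_def[of z] by (intro cINF_greatest) auto
    then show ?thesis by linarith
  qed
  have "L-lipschitz_on UNIV g"
  proof (rule lipschitz_onI)
    fix x z show "dist (g x) (g z) \<le> L * dist x z"
      using lip[of x z] lip[of z x] by (simp add: dist_real_def abs_minus_commute abs_le_iff)
  qed (rule L)
  moreover have "g x \<le> f x \<and> f x \<le> g x + r" for x using g_le[of x x] g_ge[of x] by simp
  ultimately show ?thesis by blast
qed

text \<open>Beyond \<open>d\<close>, the point \<open>d\<close> is a convex combination of 0 and
  \<open>t\<close>, so concavity and h 0 >= 0 give h t / t <= h d / d. This supplies the slope for
  the Lipschitz minorant at scale \<open>d\<close>.\<close>

lemma concave_modulus_linear:
  fixes h :: "real \<Rightarrow> real"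
  assumes conc: "concave_on {0..} h" and mono: "mono_on {0..} h" and nonneg: "\<And>t. t \<ge> 0 \<Longrightarrow> h t \<ge> 0"
    and d: "d > 0" and t: "t \<ge> 0"
  shows "h t \<le> h d + h d / d * t"
proof (cases "t \<le> d")
  case True
  then have "h t \<le> h d" using mono t d by (auto simp: mono_on_def)
  moreover have "0 \<le> h d / d * t" using nonneg[of d] d t by simp
  ultimately show ?thesis by linarith
next
  case False
  have td: "0 < d / t" "d / t \<le> 1" using False d by auto
  have "(1 - d / t) * h 0 + d / t * h t \<le> h ((1 - d / t) *\<^sub>R 0 + (d / t) *\<^sub>R t)"
    using td t by (intro concave_onD[OF conc]) auto
  also have "(1 - d / t) *\<^sub>R 0 + (d / t) *\<^sub>R t = d" using False d by simp
  finally have "(1 - d / t) * h 0 + d / t * h t \<le> h d" .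
  moreover have "0 \<le> (1 - d / t) * h 0" using nonneg[of 0] td by (intro mult_nonneg_nonneg) auto
  ultimately have "d / t * h t \<le> h d" by linarith
  then have "h t \<le> h d / d * t" using False d by (simp add: field_simps)
  then show ?thesis using nonneg[of d] d by simp
qed

section \<open>Observables with a concave modulus of continuity\<close>

lemma uniform_modulus_measurable:
  fixes f h :: "real \<Rightarrow> real"
  assumes f: "\<And>x y. \<bar>f x - f y\<bar> \<le> h \<bar>x - y\<bar>" and mono: "mono_on {0..} h"
    and small: "\<And>\<epsilon>. \<epsilon> > 0 \<Longrightarrow> \<exists>d>0. h d < \<epsilon>"
  shows "f \<in> borel_measurable borel"
proof (rule borel_measurable_continuous_onI)
  show "continuous_on UNIV f"
    unfolding continuous_on_iff
  proof (intro ballI allI impI)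
    fix x \<epsilon> :: real assume "\<epsilon> > 0"
    then obtain d where d: "d > 0" "h d < \<epsilon>" using small by blast
    have "dist (f y) (f x) < \<epsilon>" if "dist y x < d" for y
    proof -
      have "h \<bar>y - x\<bar> \<le> h d" using mono that d by (auto simp: mono_on_def dist_real_def)
      then show ?thesis using f[of y x] d(2) by (simp add: dist_real_def)
    qed
    then show "\<exists>d>0. \<forall>x'\<in>UNIV. dist x' x < d \<longrightarrow> dist (f x') (f x) < \<epsilon>" using d(1) by blast
  qed
qed

lemma ess_norm_AE:
  assumes "ess_norm \<mu> u \<le> ereal c" shows "AE x in \<mu>. \<bar>u x\<bar> \<le> c"
proof -
  have "AE x in \<mu>. ereal \<bar>u x\<bar> \<le> ess_norm \<mu> u" unfolding ess_norm_def by (rule esssup_AE)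
  then show ?thesis
  proof eventually_elim
    fix x assume "ereal \<bar>u x\<bar> \<le> ess_norm \<mu> u"
    then have "ereal \<bar>u x\<bar> \<le> ereal c" using assms by (rule order_trans)
    then show "\<bar>u x\<bar> \<le> c" by simp
  qed
qed

lemma Lip1_scale:
  assumes "L-lipschitz_on UNIV g" "L > 0" shows "(\<lambda>x. (g x - r) / L) \<in> Lip1"
  unfolding Lip1_def mem_Collect_eq
proof (rule lipschitz_onI)
  fix x y :: real
  have "dist (g x) (g y) \<le> L * dist x y" using assms(1) by (rule lipschitz_onD) auto
  then have "\<bar>g x - g y\<bar> / L \<le> \<bar>x - y\<bar>" using assms(2) by (simp add: dist_real_def divide_le_eq mult.commute)
  moreover have "(g x - r) / L - (g y - r) / L = (g x - g y) / L" by (simp add: diff_divide_distrib)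
  ultimately show "dist ((g x - r) / L) ((g y - r) / L) \<le> 1 * dist x y"
    using assms(2) by (simp add: dist_real_def abs_divide)
qed simp

lemma block_self_normalized_measurable:
  assumes [measurable]: "\<And>i. X i \<in> borel_measurable M"
  shows "(\<lambda>\<omega>. block_self_normalized (\<lambda>i. X i \<omega>) m n) \<in> borel_measurable M"
  unfolding block_self_normalized_def block_norm_def block_sum_def by measurable

section \<open>From Lipschitz functions to a concave modulus\<close>

context stationary_chain
begin

lemma kernel_apply_close:
  assumes "u \<in> bounded_borel" "v \<in> bounded_borel" "\<And>x. \<bar>u x - v x\<bar> \<le> r"
  shows "\<bar>kernel_apply K n u x - kernel_apply K n v x\<bar> \<le> r"
    and "\<bar>(\<integral>x. u x \<partial>\<mu>) - (\<integral>x. v x \<partial>\<mu>)\<bar> \<le> r"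
proof -
  have d: "(\<lambda>x. u x - v x) \<in> bounded_borel" using assms by auto
  show "\<bar>kernel_apply K n u x - kernel_apply K n v x\<bar> \<le> r"
    using kernel_apply_bound[OF d, of r n x] assms by (simp add: kernel_apply_diff)
  show "\<bar>(\<integral>x. u x \<partial>\<mu>) - (\<integral>x. v x \<partial>\<mu>)\<bar> \<le> r"
    using integral_bound_prob[OF mu_prob mu_sets d, of r] assms mu_integrable by simp
qed

text \<open>By invariance the mean of the \<open>n\<close>-step probability of leaving
  \<open>S\<close> is the \<open>\<mu>\<close>-measure of the complement, which is 0. It allows
  \<open>f\<close> to be replaced by a function that agrees with it only on the range of the
  chain.\<close>

lemma AE_kernel_power:
  assumes S: "S \<in> sets borel" and "AE x in \<mu>. x \<in> S"
  shows "AE x in \<mu>. AE y in kernel_power K n x. y \<in> S"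
proof -
  have ind: "(indicator (- S) :: real \<Rightarrow> real) \<in> bounded_borel"
    using S by (intro bounded_borelI[where B = 1]) (auto simp: indicator_def)
  have "(\<integral>x. kernel_apply K n (indicator (- S)) x \<partial>\<mu>) = (\<integral>x. indicator (- S) x \<partial>\<mu>)"
    by (rule kernel_apply_invariant[OF ind])
  also have "\<dots> = (\<integral>x. 0 \<partial>\<mu>)"
  proof (rule integral_cong_AE)
    show "AE x in \<mu>. indicator (- S) x = (0 :: real)" using assms(2) by eventually_elim simp
    show "(indicator (- S) :: real \<Rightarrow> real) \<in> borel_measurable \<mu>"
      using borel_measurable_integrable[OF mu_integrable[OF ind]] .
  qed simp
  finally have "(\<integral>x. kernel_apply K n (indicator (- S)) x \<partial>\<mu>) = 0" by simp
  moreover have "0 \<le> kernel_apply K n (indicator (- S)) x" for x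
    unfolding kernel_apply_def by (rule integral_nonneg_AE) simp
  ultimately have "AE x in \<mu>. kernel_apply K n (indicator (- S)) x = 0"
    using mu_integrable[OF kernel_apply_bounded_borel[OF ind]] by (subst (asm) integral_nonneg_eq_0_iff_AE) auto
  then show ?thesis
  proof eventually_elim
    fix x assume 0: "kernel_apply K n (indicator (- S)) x = 0"
    interpret P: prob_space "kernel_power K n x" by (rule kernel_prob[OF kernel_power_measurable])
    have sets: "sets (kernel_power K n x) = sets borel" by (rule kernel_sets[OF kernel_power_measurable])
    have "AE y in kernel_power K n x. indicator (- S) y = (0 :: real)"
      using 0 kernel_apply_integrable[OF ind, of n x] unfolding kernel_apply_def
      by (subst (asm) integral_nonneg_eq_0_iff_AE) auto
    then show "AE y in kernel_power K n x. y \<in> S" by eventually_elim (auto simp: indicator_def split: if_splits)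
  qed
qed

lemma kernel_apply_cong_support:
  assumes f: "f \<in> borel_measurable borel" and g: "g \<in> borel_measurable borel"
    and S: "S \<in> sets borel" "AE x in \<mu>. x \<in> S" and eq: "\<And>x. x \<in> S \<Longrightarrow> f x = g x"
  shows "AE x in \<mu>. kernel_apply K n f x = kernel_apply K n g x"
  using AE_kernel_power[OF S, of n]
proof eventually_elim
  fix x assume "AE y in kernel_power K n x. y \<in> S"
  then have ae: "AE y in kernel_power K n x. f y = g y" by eventually_elim (rule eq)
  have m: "f \<in> borel_measurable (kernel_power K n x)" "g \<in> borel_measurable (kernel_power K n x)"
    using f g measurable_cong_sets[OF kernel_sets[OF kernel_power_measurable] refl] by blast+
  show "kernel_apply K n f x = kernel_apply K n g x"
    unfolding kernel_apply_def by (rule integral_cong_AE[OF m ae])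
qed

lemma kernel_apply_measurable:
  assumes "f \<in> borel_measurable borel" shows "kernel_apply K n f \<in> borel_measurable borel"
  unfolding kernel_apply_def[abs_def]
  using measurable_compose[OF measurable_prob_algebraD[OF kernel_power_measurable]
      integral_measurable_subprob_algebra[OF assms]] .

text \<open>\<open>asymp_variance\<close> applies the kernel to the uncentred \<open>f\<close>;
  centring changes each term by a multiple of the mean of \<open>u\<close>, which is 0. Values of
  \<open>f\<close> off \<open>S\<close> never matter.\<close>

lemma asymp_variance_eq:
  assumes f: "f \<in> borel_measurable borel" and f0: "f0 \<in> bounded_borel"
    and S: "S \<in> sets borel" "AE x in \<mu>. x \<in> S" and eq: "\<And>x. x \<in> S \<Longrightarrow> f x = f0 x"
    and u: "\<And>x. u x = f0 x - (\<integral>x. f x \<partial>\<mu>)"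
  shows "asymp_variance \<mu> K f = (\<integral>x. u x * kernel_apply K 0 u x \<partial>\<mu>) + 2 * (\<Sum>n. \<integral>x. u x * kernel_apply K (Suc n) u x \<partial>\<mu>)"
    and "(\<integral>x. f x \<partial>\<mu>) = (\<integral>x. f0 x \<partial>\<mu>)"
proof -
  have f0m: "f0 \<in> borel_measurable borel" by (rule bounded_borel_measurable[OF f0])
  have mm: "v \<in> borel_measurable \<mu>" if "v \<in> borel_measurable borel" for v :: "real \<Rightarrow> real"
    using that measurable_cong_sets[OF mu_sets refl] by blast
  have AEf: "AE x in \<mu>. f x = f0 x" using S(2) by eventually_elim (rule eq)
  show mean: "(\<integral>x. f x \<partial>\<mu>) = (\<integral>x. f0 x \<partial>\<mu>)" by (rule integral_cong_AE[OF mm[OF f] mm[OF f0m] AEf])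
  define r where "r = (\<integral>x. f x \<partial>\<mu>)"
  have u': "u = (\<lambda>x. f0 x - r)" using u unfolding r_def by auto
  have ub: "u \<in> bounded_borel" unfolding u' using f0 by auto
  have um: "u \<in> borel_measurable borel" by (rule bounded_borel_measurable[OF ub])
  interpret P: prob_space \<mu> by (rule mu_prob)
  have u0: "(\<integral>x. u x \<partial>\<mu>) = 0"
    unfolding u' using mu_integrable[OF f0] mean by (simp add: P.prob_space r_def)
  have 1: "(\<integral>x. (f x - r)\<^sup>2 \<partial>\<mu>) = (\<integral>x. u x * kernel_apply K 0 u x \<partial>\<mu>)"
  proof (rule integral_cong_AE)
    show "AE x in \<mu>. (f x - r)\<^sup>2 = u x * kernel_apply K 0 u x"
      using AEf by eventually_elim (simp add: kernel_apply_0[OF ub], simp add: u' power2_eq_square)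
    show "(\<lambda>x. (f x - r)\<^sup>2) \<in> borel_measurable \<mu>" using mm[OF f] by simp
    show "(\<lambda>x. u x * kernel_apply K 0 u x) \<in> borel_measurable \<mu>"
      using mm[OF um] mm[OF kernel_apply_measurable[OF um]] by (rule borel_measurable_times)
  qed
  have 2: "(\<integral>x. kernel_apply K (Suc n) f x * (f x - r) \<partial>\<mu>) = (\<integral>x. u x * kernel_apply K (Suc n) u x \<partial>\<mu>)" for n
  proof -
    have KA: "kernel_apply K (Suc n) u \<in> bounded_borel" by (rule kernel_apply_bounded_borel[OF ub])
    have supp: "AE x in \<mu>. kernel_apply K (Suc n) f x = kernel_apply K (Suc n) f0 x"
      by (rule kernel_apply_cong_support[OF f f0m S]) (rule eq)
    have "(\<integral>x. kernel_apply K (Suc n) f x * (f x - r) \<partial>\<mu>)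
        = (\<integral>x. u x * kernel_apply K (Suc n) u x + r * u x \<partial>\<mu>)"
    proof (rule integral_cong_AE)
      show "AE x in \<mu>. kernel_apply K (Suc n) f x * (f x - r) = u x * kernel_apply K (Suc n) u x + r * u x"
        using AEf supp
      proof eventually_elim
        fix x assume 1: "f x = f0 x" and 2: "kernel_apply K (Suc n) f x = kernel_apply K (Suc n) f0 x"
        have 3: "kernel_apply K (Suc n) u x = kernel_apply K (Suc n) f0 x - r"
          unfolding u' using kernel_apply_diff[OF f0 bounded_borel_const] kernel_apply_const by simp
        have 4: "u x = f0 x - r" by (simp add: u')
        show "kernel_apply K (Suc n) f x * (f x - r) = u x * kernel_apply K (Suc n) u x + r * u x"
          unfolding 1 2 3 4 by (simp add: algebra_simps)
      qed
      show "(\<lambda>x. kernel_apply K (Suc n) f x * (f x - r)) \<in> borel_measurable \<mu>"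
        using mm[OF f] mm[OF kernel_apply_measurable[OF f, of "Suc n"]] by simp
      show "(\<lambda>x. u x * kernel_apply K (Suc n) u x + r * u x) \<in> borel_measurable \<mu>"
        using mm[OF um] mm[OF kernel_apply_measurable[OF um, of "Suc n"]] by simp
    qed
    also have "\<dots> = (\<integral>x. u x * kernel_apply K (Suc n) u x \<partial>\<mu>) + (\<integral>x. r * u x \<partial>\<mu>)"
      using ub KA by (intro Bochner_Integration.integral_add mu_integrable) auto
    finally show ?thesis using u0 by simp
  qed
  show "asymp_variance \<mu> K f = (\<integral>x. u x * kernel_apply K 0 u x \<partial>\<mu>) + 2 * (\<Sum>n. \<integral>x. u x * kernel_apply K (Suc n) u x \<partial>\<mu>)"
    unfolding asymp_variance_def r_def[symmetric] 1 2 ..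
qed

text \<open>The minorant at scale \<open>d\<close> has Lipschitz constant L = (h d + e) / d, so the
  contraction contributes d L = h d + e. The replacement errors under kernel and under
  \<open>\<mu>\<close> both lie between 0 and \<open>h d\<close>, so their difference adds
  \<open>h d\<close> only once. The positive \<open>e\<close> makes division by \<open>L\<close>
  legitimate even if \<open>h d\<close> is 0.\<close>

lemma kernel_decay_modulus:
  assumes contr: "\<And>g. g \<in> Lip1 \<Longrightarrow> ess_norm \<mu> (\<lambda>x. kernel_apply K n g x - (\<integral>y. g y \<partial>\<mu>)) \<le> ereal d"
    and f0: "f0 \<in> bounded_borel" "\<And>x y. \<bar>f0 x - f0 y\<bar> \<le> h \<bar>x - y\<bar>"
    and h: "\<And>t. t \<ge> 0 \<Longrightarrow> h t \<le> h d + h d / d * t" "h d \<ge> 0" and d: "d > 0" and e: "e > 0"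
  shows "AE x in \<mu>. \<bar>kernel_apply K n f0 x - (\<integral>x. f0 x \<partial>\<mu>)\<bar> \<le> 2 * h d + e"
proof -
  define L where "L = (h d + e) / d"
  have L: "L > 0" unfolding L_def using h(2) d e by simp
  have hL: "h t \<le> h d + L * t" if "t \<ge> 0" for t
  proof -
    have "h d / d * t \<le> L * t" unfolding L_def using that d e by (intro mult_right_mono divide_right_mono) auto
    then show ?thesis using h(1)[OF that] by linarith
  qed
  obtain g where g: "L-lipschitz_on UNIV g" "\<And>x. g x \<le> f0 x \<and> f0 x \<le> g x + h d"
    using Lipschitz_minorant[OF f0(2) hL less_imp_le[OF L]] by blast
  obtain B where B: "\<And>x. \<bar>f0 x\<bar> \<le> B" using bounded_borel_bound[OF f0(1)] by blast
  have gb: "g \<in> bounded_borel"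
  proof (rule bounded_borelI)
    show "g \<in> borel_measurable borel"
      using g(1) by (intro borel_measurable_continuous_onI lipschitz_on_continuous_on)
    show "\<bar>g x\<bar> \<le> B + h d" for x using g(2)[of x] B[of x] h(2) by linarith
  qed
  have "AE x in \<mu>. \<bar>kernel_apply K n (\<lambda>x. (g x - 0) / L) x - (\<integral>y. (g y - 0) / L \<partial>\<mu>)\<bar> \<le> d"
    by (rule ess_norm_AE[OF contr[OF Lip1_scale[OF g(1) L]]])
  then show ?thesis
  proof eventually_elim
    fix x assume *: "\<bar>kernel_apply K n (\<lambda>x. (g x - 0) / L) x - (\<integral>y. (g y - 0) / L \<partial>\<mu>)\<bar> \<le> d"
    have "kernel_apply K n (\<lambda>x. (g x - 0) / L) x = kernel_apply K n g x / L" unfolding kernel_apply_def by simp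
    then have "\<bar>kernel_apply K n g x / L - (\<integral>y. g y \<partial>\<mu>) / L\<bar> \<le> d" using * by simp
    then have "\<bar>kernel_apply K n g x - (\<integral>y. g y \<partial>\<mu>)\<bar> / L \<le> d"
      using L by (simp add: diff_divide_distrib[symmetric])
    then have "\<bar>kernel_apply K n g x - (\<integral>y. g y \<partial>\<mu>)\<bar> \<le> d * L" using L by (simp add: divide_le_eq)
    also have "d * L = h d + e" unfolding L_def using d by simp
    finally have 1: "\<bar>kernel_apply K n g x - (\<integral>y. g y \<partial>\<mu>)\<bar> \<le> h d + e" .
    have nn: "0 \<le> (\<integral>y. (f0 y - g y) \<partial>\<mu>)" "0 \<le> (\<integral>y. (f0 y - g y) \<partial>kernel_power K n x)"
      using g(2) by (auto intro!: integral_nonneg_AE)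
    have "0 \<le> (\<integral>x. f0 x \<partial>\<mu>) - (\<integral>x. g x \<partial>\<mu>)" "0 \<le> kernel_apply K n f0 x - kernel_apply K n g x"
      using nn mu_integrable[OF f0(1)] mu_integrable[OF gb] kernel_apply_integrable[OF f0(1)] kernel_apply_integrable[OF gb]
      by (simp_all add: kernel_apply_def)
    moreover have "\<bar>f0 x - g x\<bar> \<le> h d" for x using g(2)[of x] by linarith
    note kernel_apply_close(1)[OF f0(1) gb this, of n x] kernel_apply_close(2)[OF f0(1) gb this]
    ultimately show "\<bar>kernel_apply K n f0 x - (\<integral>x. f0 x \<partial>\<mu>)\<bar> \<le> 2 * h d + e" using 1 by linarith
  qed
qed

text \<open>Mixing is applied to a single Lipschitz approximation in both factors, after division by
  its Lipschitz constant; the product therefore scales by L^2, harmless as no rate is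
  claimed.\<close>

lemma covariance_limit_modulus:
  assumes mix: "\<And>g. g \<in> Lip1 \<Longrightarrow>
      (\<lambda>n. ess_norm \<mu> (\<lambda>x. kernel_apply K n (\<lambda>y. g y * kernel_apply K l g y) x
             - (\<integral>y. g y * kernel_apply K l g y \<partial>\<mu>))) \<longlonglongrightarrow> 0"
    and f0: "f0 \<in> bounded_borel" "\<And>x y. \<bar>f0 x - f0 y\<bar> \<le> h \<bar>x - y\<bar>"
    and h: "\<And>d t. d > 0 \<Longrightarrow> t \<ge> 0 \<Longrightarrow> h t \<le> h d + h d / d * t" "\<And>d. d \<ge> 0 \<Longrightarrow> h d \<ge> 0"
    and small: "\<And>\<epsilon>. \<epsilon> > 0 \<Longrightarrow> \<exists>d>0. h d < \<epsilon>" and \<eta>: "\<eta> > 0"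
  shows "\<exists>i0. \<forall>i\<ge>i0. AE x in \<mu>. \<bar>kernel_apply K i (\<lambda>y. f0 y * kernel_apply K l f0 y) x
    - (\<integral>y. f0 y * kernel_apply K l f0 y \<partial>\<mu>)\<bar> \<le> \<eta>"
proof -
  obtain B where B: "B \<ge> 0" "\<And>x. \<bar>f0 x\<bar> \<le> B" using bounded_borel_bound[OF f0(1)] by blast
  \<comment> \<open>Replacing both factors changes the product by at most r B + (B + 1) r = r (2 B +
    1) <= \<eta> / 4. This error occurs under the kernel and under \<open>\<mu>\<close>, and the
    other half of \<eta> is left for the limit.\<close>
  obtain d where d: "d > 0" "h d < min 1 (\<eta> / (4 * (2 * B + 1)))"
    using small[of "min 1 (\<eta> / (4 * (2 * B + 1)))"] \<eta> B(1) by auto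
  define r where "r = h d"
  have r: "r \<ge> 0" "r < 1" "r * (2 * B + 1) \<le> \<eta> / 4"
  proof -
    show "r \<ge> 0" "r < 1" unfolding r_def using h(2) d by auto
    have "r * (2 * B + 1) \<le> \<eta> / (4 * (2 * B + 1)) * (2 * B + 1)"
      unfolding r_def using d(2) B(1) by (intro mult_right_mono) auto
    also have "\<eta> / (4 * (2 * B + 1)) * (2 * B + 1) = \<eta> / 4" using B(1) by (simp add: field_simps)
    finally show "r * (2 * B + 1) \<le> \<eta> / 4" .
  qed
  define L where "L = (r + 1) / d"
  have L: "L > 0" unfolding L_def using r d by simp
  have hL: "h t \<le> r + L * t" if "t \<ge> 0" for t
  proof -
    have "h d / d * t \<le> L * t" unfolding L_def r_def using that d by (intro mult_right_mono divide_right_mono) auto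
    then show ?thesis using h(1)[OF d(1) that] unfolding r_def by linarith
  qed
  obtain g where g: "L-lipschitz_on UNIV g" "\<And>x. g x \<le> f0 x \<and> f0 x \<le> g x + r"
    using Lipschitz_minorant[OF f0(2) hL less_imp_le[OF L]] by blast
  have fg: "\<bar>f0 x - g x\<bar> \<le> r" for x using g(2)[of x] by linarith
  have gB: "\<bar>g x\<bar> \<le> B + 1" for x using g(2)[of x] B(2)[of x] r by linarith
  have gb: "g \<in> bounded_borel"
    using g(1) gB by (intro bounded_borelI borel_measurable_continuous_onI lipschitz_on_continuous_on)
  let ?w = "\<lambda>y. f0 y * kernel_apply K l f0 y" and ?v = "\<lambda>y. g y * kernel_apply K l g y"
  have w: "?w \<in> bounded_borel" and v: "?v \<in> bounded_borel"
    using f0(1) gb kernel_apply_bounded_borel by auto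
  have wv: "\<bar>?w x - ?v x\<bar> \<le> \<eta> / 4" for x
  proof -
    let ?F = "kernel_apply K l f0 x" and ?G = "kernel_apply K l g x"
    have "?w x - ?v x = (f0 x - g x) * ?F + g x * (?F - ?G)" by (simp add: algebra_simps)
    also have "\<bar>\<dots>\<bar> \<le> \<bar>f0 x - g x\<bar> * \<bar>?F\<bar> + \<bar>g x\<bar> * \<bar>?F - ?G\<bar>"
      by (metis abs_mult abs_triangle_ineq)
    also have "\<dots> \<le> r * B + (B + 1) * r"
      using fg gB r B kernel_apply_bound[OF f0(1) B(2)] kernel_apply_close(1)[OF f0(1) gb fg]
      by (intro add_mono mult_mono) auto
    finally show ?thesis using r(3) by (simp add: algebra_simps)
  qed
  let ?g = "\<lambda>x. (g x - 0) / L"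
  have KAdiv: "kernel_apply K i (\<lambda>y. u y / s) x = kernel_apply K i u x / s" for i u s x
    unfolding kernel_apply_def by simp
  have sc: "?g y * kernel_apply K l ?g y = ?v y / (L * L)" for y
    using KAdiv[of l g L y] by simp
  have "0 < ereal (\<eta> / 2 / (L * L))" using \<eta> L by simp
  from order_tendstoD(2)[OF mix[OF Lip1_scale[OF g(1) L, of 0]] this]
  obtain i0 where i0: "\<And>i. i \<ge> i0 \<Longrightarrow> ess_norm \<mu> (\<lambda>x. kernel_apply K i (\<lambda>y. ?g y * kernel_apply K l ?g y) x
             - (\<integral>y. ?g y * kernel_apply K l ?g y \<partial>\<mu>)) < ereal (\<eta> / 2 / (L * L))"
    unfolding eventually_sequentially by blast
  show ?thesis
  proof (intro exI[of _ i0] allI impI)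
    fix i assume i: "i \<ge> i0"
    have "AE x in \<mu>. \<bar>kernel_apply K i (\<lambda>y. ?v y / (L * L)) x - (\<integral>y. ?v y / (L * L) \<partial>\<mu>)\<bar> \<le> \<eta> / 2 / (L * L)"
      using ess_norm_AE[OF less_imp_le[OF i0[OF i]]] unfolding sc .
    then show "AE x in \<mu>. \<bar>kernel_apply K i ?w x - (\<integral>y. ?w y \<partial>\<mu>)\<bar> \<le> \<eta>"
    proof eventually_elim
      fix x assume *: "\<bar>kernel_apply K i (\<lambda>y. ?v y / (L * L)) x - (\<integral>y. ?v y / (L * L) \<partial>\<mu>)\<bar> \<le> \<eta> / 2 / (L * L)"
      have LL: "L * L > 0" using L by simp
      have "\<bar>(kernel_apply K i ?v x - (\<integral>y. ?v y \<partial>\<mu>)) / (L * L)\<bar> \<le> \<eta> / 2 / (L * L)"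
        using * unfolding KAdiv[of i ?v "L * L"] integral_divide_zero diff_divide_distrib .
      then have "\<bar>kernel_apply K i ?v x - (\<integral>y. ?v y \<partial>\<mu>)\<bar> / (L * L) \<le> \<eta> / 2 / (L * L)"
        unfolding abs_divide using LL by (simp only: abs_of_pos)
      then have "\<bar>kernel_apply K i ?v x - (\<integral>y. ?v y \<partial>\<mu>)\<bar> \<le> \<eta> / 2"
        using LL by (simp only: divide_le_cancel)
      then show "\<bar>kernel_apply K i ?w x - (\<integral>y. ?w y \<partial>\<mu>)\<bar> \<le> \<eta>"
        using kernel_apply_close(1)[OF w v wv, of i x] kernel_apply_close(2)[OF w v wv] by linarith
    qed
  qed
qed

end

theorem proposition3p2:
  fixes M :: "'w measure"
    and Y :: "nat \<Rightarrow> 'w \<Rightarrow> real"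
    and \<mu> :: "real measure"
    and K :: "real \<Rightarrow> real measure"
    and C \<rho> :: real
    and f :: "real \<Rightarrow> real"
    and X :: "nat \<Rightarrow> 'w \<Rightarrow> real"
    and m :: "nat \<Rightarrow> nat"
    and a :: "nat \<Rightarrow> real"
    and B :: "real set"
  assumes "stationary_markov_chain M Y \<mu> K"
    and "\<exists>b. \<forall>n. AE \<omega> in M. \<bar>Y n \<omega>\<bar> \<le> b"
    and "C > 0" and "\<rho> \<in> {0<..<1}"
    and "\<And>n. n \<ge> 1 \<Longrightarrow>
          (SUP g\<in>Lip1. ess_norm \<mu> (\<lambda>x. kernel_apply K n g x - (\<integral>y. g y \<partial>\<mu>))) \<le> ereal (C * \<rho> ^ n)"
    and "\<And>g g' l. g \<in> Lip1 \<Longrightarrow> g' \<in> Lip1 \<Longrightarrow>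
          (\<lambda>n. ess_norm \<mu> (\<lambda>x. kernel_apply K n (\<lambda>y. g' y * kernel_apply K l g y) x
                 - (\<integral>y. g' y * kernel_apply K l g y \<partial>\<mu>))) \<longlonglongrightarrow> 0"
    and "f \<in> class_L"
    and "\<And>n \<omega>. X n \<omega> = f (Y n \<omega>) - (\<integral>y. f y \<partial>\<mu>)"
    and "\<And>n. n \<ge> 1 \<Longrightarrow> 1 \<le> m n \<and> m n \<le> n"
    and "filterlim m at_top sequentially"
    and "filterlim (\<lambda>n. sqrt (real n) / real (m n)) at_top sequentially"
    and "a \<longlonglongrightarrow> 0"
    and "filterlim (\<lambda>n. a n * sqrt (real n) / real (m n)) at_top sequentially"
    and "asymp_variance \<mu> K f > 0"
    and "B \<in> sets borel"
  shows "- (INF x\<in>interior B. ereal (x\<^sup>2 / 2))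
           \<le> liminf (\<lambda>n. ereal ((a n)\<^sup>2) * eln (measure M
               {\<omega> \<in> space M. a n * block_self_normalized (\<lambda>i. X i \<omega>) (m n) n \<in> B}))
       \<and> liminf (\<lambda>n. ereal ((a n)\<^sup>2) * eln (measure M
               {\<omega> \<in> space M. a n * block_self_normalized (\<lambda>i. X i \<omega>) (m n) n \<in> B}))
           \<le> limsup (\<lambda>n. ereal ((a n)\<^sup>2) * eln (measure M
               {\<omega> \<in> space M. a n * block_self_normalized (\<lambda>i. X i \<omega>) (m n) n \<in> B}))
       \<and> limsup (\<lambda>n. ereal ((a n)\<^sup>2) * eln (measure M
               {\<omega> \<in> space M. a n * block_self_normalized (\<lambda>i. X i \<omega>) (m n) n \<in> B}))
           \<le> - (INF x\<in>closure B. ereal (x\<^sup>2 / 2))"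
proof -
  interpret stationary_chain M Y \<mu> K by unfold_locales (rule assms(1))
  have \<rho>: "0 < \<rho>" "\<rho> < 1" using assms(4) by auto
  obtain b0 where b0: "\<And>n. AE \<omega> in M. \<bar>Y n \<omega>\<bar> \<le> b0" using assms(2) by blast
  define b where "b = max b0 0"
  have Yb: "AE \<omega> in M. \<bar>Y n \<omega>\<bar> \<le> b" for n using b0[of n] by eventually_elim (simp add: b_def)
  have b: "b \<ge> 0" by (simp add: b_def)
  obtain h where conc: "concave_on {0..} h" and mono: "mono_on {0..} h"
    and int: "(\<integral>\<^sup>+t\<in>{0<..<1}. ennreal (h t / (t * sqrt \<bar>ln t\<bar>)) \<partial>lborel) < \<infinity>"
    and fh: "\<And>x y. \<bar>f x - f y\<bar> \<le> h \<bar>x - y\<bar>"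
    using assms(7) unfolding class_L_def by blast
  have h0: "h t \<ge> 0" if "t \<ge> 0" for t using fh[of t 0] that by simp
  define t where "t n = C * \<rho> ^ n" for n
  have t: "t n > 0" for n unfolding t_def using assms(3) \<rho> by simp
  have hsum: "summable (\<lambda>n. h (t n) / sqrt (real n))"
    unfolding t_def by (rule modulus_summable[OF mono h0 int assms(3) \<rho>])
  \<comment> \<open>The witness is some \<open>t n\<close>: values of \<open>h\<close> bounded away
    from 0 along this sequence would contradict \<open>hsum\<close>.\<close>
  have small: "\<exists>d>0. h d < \<epsilon>" if "\<epsilon> > 0" for \<epsilon>
    using summable_over_sqrt_small[OF hsum that, of 0] t by blast
  have hlin: "h s \<le> h d + h d / d * s" if "d > 0" "s \<ge> 0" for d s
    by (rule concave_modulus_linear[OF conc mono h0 that])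
  \<comment> \<open>The chain is bounded only almost surely and \<open>f\<close> may be unbounded.
    Clipping the argument is 1-Lipschitz, so the monotone modulus \<open>h\<close> is kept, and
    \<open>f0\<close> is bounded everywhere.\<close>
  define f0 where "f0 x = f (max (- b) (min b x))" for x
  have f0h: "\<bar>f0 x - f0 y\<bar> \<le> h \<bar>x - y\<bar>" for x y
  proof -
    have "\<bar>f0 x - f0 y\<bar> \<le> h \<bar>max (- b) (min b x) - max (- b) (min b y)\<bar>" unfolding f0_def by (rule fh)
    also have "\<dots> \<le> h \<bar>x - y\<bar>" using mono by (intro mono_onD[OF mono]) (auto simp: max_def min_def)
    finally show ?thesis .
  qed
  have f0b: "f0 \<in> bounded_borel"
  proof (rule bounded_borelI)
    show "f0 \<in> borel_measurable borel" by (rule uniform_modulus_measurable[OF f0h mono small])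
    fix x
    have "\<bar>f0 x - f0 0\<bar> \<le> h \<bar>max (- b) (min b x) - max (- b) (min b 0)\<bar>" unfolding f0_def by (rule fh)
    also have "\<dots> \<le> h b" using b by (intro mono_onD[OF mono]) (auto simp: max_def min_def)
    finally show "\<bar>f0 x\<bar> \<le> \<bar>f0 0\<bar> + h b" by linarith
  qed
  have fm: "f \<in> borel_measurable borel" by (rule uniform_modulus_measurable[OF fh mono small])
  have ff0: "f x = f0 x" if "x \<in> {- b..b}" for x using that by (simp add: f0_def)
  have AEb: "AE x in \<mu>. x \<in> {- b..b}"
  proof -
    have "AE \<omega> in M. Y 0 \<omega> \<in> {- b..b}" using Yb[of 0] by eventually_elim (auto simp: abs_le_iff)
    then have "AE x in distr M borel (Y 0). x \<in> {- b..b}" by (subst AE_distr_iff) auto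
    then show ?thesis unfolding Y_law .
  qed
  define u where "u x = f0 x - (\<integral>x. f x \<partial>\<mu>)" for x
  have ub: "u \<in> bounded_borel" unfolding u_def using f0b by auto
  have uh: "\<bar>u x - u y\<bar> \<le> h \<bar>x - y\<bar>" for x y unfolding u_def using f0h[of x y] by simp
  note var = asymp_variance_eq[OF fm f0b _ AEb ff0 u_def]
  have mean: "(\<integral>x. f x \<partial>\<mu>) = (\<integral>x. f0 x \<partial>\<mu>)" by (rule var(2)) auto
  obtain Bu where Bu: "\<And>x. \<bar>u x\<bar> \<le> Bu" using bounded_borel_bound[OF ub] by blast
  \<comment> \<open>The geometric term is the positive \<open>e\<close> of
    \<open>kernel_decay_modulus\<close>; it also makes \<open>c\<close> strictly positive, even
    where \<open>h\<close> vanishes, without affecting summability.\<close>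
  define c where "c n = 2 * h (t n) + (1 / 2) ^ n" for n
  have c_pos: "c n > 0" for n unfolding c_def using h0[of "t n"] t[of n] by (simp add: add_nonneg_pos)
  have c_dec: "decseq c"
    unfolding decseq_def
  proof (intro allI impI)
    fix i j :: nat assume ij: "i \<le> j"
    have "t j \<le> t i" unfolding t_def using ij assms(3) \<rho> by (intro mult_left_mono power_decreasing) auto
    then have "h (t j) \<le> h (t i)" using t[of i] t[of j] by (intro mono_onD[OF mono]) auto
    moreover have "(1 / 2 :: real) ^ j \<le> (1 / 2) ^ i" using ij by (intro power_decreasing) auto
    ultimately show "c j \<le> c i" unfolding c_def by linarith
  qed
  have c_sum: "summable (\<lambda>n. c n / sqrt (real n))"
  proof -
    have "summable (\<lambda>n. (1 / 2) ^ n / sqrt (real n))"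
    proof (rule summable_comparison_test)
      show "\<exists>N. \<forall>n\<ge>N. norm ((1 / 2) ^ n / sqrt (real n)) \<le> (1 / 2 :: real) ^ n"
        by (intro exI[of _ 1] allI impI) (simp add: divide_le_eq)
    qed (simp add: summable_geometric)
    from summable_add[OF summable_mult[OF hsum, of 2] this] show ?thesis
      unfolding c_def by (simp add: add_divide_distrib)
  qed
  have decay: "AE x in \<mu>. \<bar>kernel_apply K n u x\<bar> \<le> c n" if n: "n \<ge> 1" for n
  proof -
    have "ess_norm \<mu> (\<lambda>x. kernel_apply K n g x - (\<integral>y. g y \<partial>\<mu>)) \<le> ereal (t n)" if "g \<in> Lip1" for g
      using order_trans[OF SUP_upper[OF that] assms(5)[OF n]] unfolding t_def .
    from kernel_decay_modulus[OF this f0b f0h hlin[OF t] h0[OF less_imp_le[OF t]] t, of "(1 / 2) ^ n"]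
    have "AE x in \<mu>. \<bar>kernel_apply K n f0 x - (\<integral>x. f0 x \<partial>\<mu>)\<bar> \<le> c n" unfolding c_def by simp
    moreover have "kernel_apply K n u x = kernel_apply K n f0 x - (\<integral>x. f0 x \<partial>\<mu>)" for x
      unfolding u_def[abs_def] mean using kernel_apply_diff[OF f0b bounded_borel_const] kernel_apply_const by simp
    ultimately show ?thesis by simp
  qed
  define \<gamma> where "\<gamma> l = (\<integral>x. u x * kernel_apply K l u x \<partial>\<mu>)" for l
  have \<gamma>_sum: "summable \<gamma>"
    unfolding \<gamma>_def[abs_def] using autocovariance_summable[OF ub less_imp_le[OF c_pos] c_dec c_sum decay] .
  \<comment> \<open>Almost surely equal to \<open>X\<close> at all times, but bounded at every point
    of the space, as \<open>block_scaling\<close> demands.\<close>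
  define X' where "X' n \<omega> = u (Y n \<omega>)" for n \<omega>
  interpret block_scaling M "natural_algebra M Y" X' Bu c \<gamma> m a
  proof unfold_locales
    show "X' n \<in> borel_measurable (natural_algebra M Y n)" for n
      unfolding X'_def[abs_def] using Linf_measurable[OF Y_Linf[OF ub, of n n]] by simp
    show "\<bar>X' n \<omega>\<bar> \<le> Bu" for n \<omega> unfolding X'_def by (rule Bu)
    show "AE \<omega> in M. \<bar>cond i (X' (i + n)) \<omega>\<bar> \<le> c n" if "n \<ge> 1" for n i
      unfolding X'_def[abs_def] using cond_steps[OF ub, of i n] AE_Y[OF decay[OF that], of i]
      by eventually_elim simp
    show "\<exists>i0. \<forall>i\<ge>i0. \<forall>k. AE \<omega> in M. \<bar>cond k (\<lambda>\<omega>. X' (k + i) \<omega> * X' (k + i + l) \<omega>) \<omega> - \<gamma> l\<bar> \<le> \<eta>"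
      if \<eta>: "\<eta> > 0" for \<eta> l
    proof -
      obtain i0 where i0: "\<And>i. i \<ge> i0 \<Longrightarrow> AE x in \<mu>. \<bar>kernel_apply K i (\<lambda>y. u y * kernel_apply K l u y) x - \<gamma> l\<bar> \<le> \<eta>"
        using covariance_limit_modulus[OF assms(6) ub uh hlin h0 small \<eta>, of l] unfolding \<gamma>_def by blast
      have "AE \<omega> in M. \<bar>cond k (\<lambda>\<omega>. X' (k + i) \<omega> * X' (k + i + l) \<omega>) \<omega> - \<gamma> l\<bar> \<le> \<eta>" if "i \<ge> i0" for i k
        unfolding X'_def using cond_product[OF ub ub, of k i l] AE_Y[OF i0[OF that], of k]
        by eventually_elim simp
      then show ?thesis by blast
    qed
    show "\<gamma> 0 + 2 * (\<Sum>l. \<gamma> (Suc l)) > 0"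
      unfolding \<gamma>_def using assms(14) var(1) by simp
  qed (use c_pos c_sum \<gamma>_sum assms(9-13) in auto)
  have XX': "AE \<omega> in M. \<forall>i. X i \<omega> = X' i \<omega>"
    unfolding AE_all_countable
  proof
    fix i show "AE \<omega> in M. X i \<omega> = X' i \<omega>"
      using Yb[of i] by eventually_elim (simp add: assms(8) X'_def u_def ff0 abs_le_iff)
  qed
  have Xm: "X i \<in> borel_measurable M" for i
    unfolding assms(8)[abs_def] using measurable_compose[OF Y_measurable fm] by simp
  have X'm: "X' i \<in> borel_measurable M" for i by (rule Linf_measurable[OF X_LinfM])
  have eq: "measure M {\<omega> \<in> space M. a n * block_self_normalized (\<lambda>i. X i \<omega>) (m n) n \<in> B}
      = measure M {\<omega> \<in> space M. a n * block_self_normalized (\<lambda>i. X' i \<omega>) (m n) n \<in> B}" for n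
  proof (rule measure_eq_AE)
    show "AE \<omega> in M. \<omega> \<in> {\<omega> \<in> space M. a n * block_self_normalized (\<lambda>i. X i \<omega>) (m n) n \<in> B}
        \<longleftrightarrow> \<omega> \<in> {\<omega> \<in> space M. a n * block_self_normalized (\<lambda>i. X' i \<omega>) (m n) n \<in> B}"
      using XX' by eventually_elim simp
    note [measurable] = block_self_normalized_measurable[OF Xm] block_self_normalized_measurable[OF X'm] assms(15)
    show "{\<omega> \<in> space M. a n * block_self_normalized (\<lambda>i. X i \<omega>) (m n) n \<in> B} \<in> sets M" by measurable
    show "{\<omega> \<in> space M. a n * block_self_normalized (\<lambda>i. X' i \<omega>) (m n) n \<in> B} \<in> sets M" by measurable
  qed
  show ?thesis
    unfolding eq using block_moderate_deviations[OF assms(15)] by (intro conjI Liminf_le_Limsup) auto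
qed

end
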